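(* Let $A=[f_1\ \dots\ f_m]^T\in\mathfrak m\cdot M_{m,1}$ with $m\ge1$, and if $1<m<s$ assume that $K$ is infinite. Then the following are equivalent: 1. $A$ is finitely $G$-determined; 2. $d_e:=\dim_K\big(M_{m,1}/\tilde T^e_A(GA)\big)<\infty$. The implication 2 $\Rightarrow$ 1 holds for any field $K$. Moreover, if condition 2 holds then $A$ is $G$ $(2d_e-\mathrm{ord}(A)+2)$-determined.
   Context: $K$ is a field of arbitrary characteristic, $R=K[[x_1,\dots,x_s]]$, $\mathfrak m=\langle x_1,\dots,x_s\rangle$, $M_{m,n}=Mat(m,n,R)$, $M_{m,1}\cong R^m$. Let $Aut(R)$ be the group of $K$-algebra automorphisms of $R$ and $G=(GL(m,R)\times GL(n,R)^{op})\rtimes Aut(R)$ act on $M_{m,n}$ by $(U,V,\phi)\cdot A=U\cdot\phi(A)\cdot V$, with $\phi(A)=[a_{ij}(\phi(x_1),\dots,\phi(x_s))]$. $A\sim_G B$ means same orbit. $A$ is $G$ $k$-determined if every $B$ with $B-A\in\mathfrak m^{k+1}M_{m,n}$ satisfies $B\sim_G A$; finitely $G$-determined if $G$ $k$-determined for some $k$. For $A=[f_1\ \dots\ f_m]^T$, the extended tangent image is $\tilde T^e_A(GA):=\langle f_1,\dots,f_m\rangle R^m+$ the $R$-submodule of $R^m$ generated by the columns of the Jacobian matrix $[\partial f_i/\partial x_j]$. $\mathrm{ord}(A)$ is the minimum of the orders (lowest degree of a nonzero homogeneous part) of the entries of $A$. *)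

theory Defs
  imports Main
begin

text \<open>Formal power series in the variables of a finite type 'v (so s = CARD('v))
  over a field 'a, represented by their coefficient functions on exponent vectors.\<close>

type_synonym ('v,'a) ps = "('v \<Rightarrow> nat) \<Rightarrow> 'a"

definition ps_zero :: "('v,'a::field) ps" where
  "ps_zero = (\<lambda>\<alpha>. 0)"

definition ps_one :: "('v,'a::field) ps" where
  "ps_one = (\<lambda>\<alpha>. if \<alpha> = (\<lambda>_. 0) then 1 else 0)"

definition ps_add :: "('v,'a::field) ps \<Rightarrow> ('v,'a) ps \<Rightarrow> ('v,'a) ps" where
  "ps_add f g = (\<lambda>\<alpha>. f \<alpha> + g \<alpha>)"

definition ps_scale :: "'a::field \<Rightarrow> ('v,'a) ps \<Rightarrow> ('v,'a) ps" where
  "ps_scale c f = (\<lambda>\<alpha>. c * f \<alpha>)"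

definition ps_sum :: "('i \<Rightarrow> ('v,'a::field) ps) \<Rightarrow> 'i set \<Rightarrow> ('v,'a) ps" where
  "ps_sum F S = (\<lambda>\<alpha>. \<Sum>x\<in>S. F x \<alpha>)"

definition ps_mult :: "('v::finite,'a::field) ps \<Rightarrow> ('v,'a) ps \<Rightarrow> ('v,'a) ps" where
  "ps_mult f g = (\<lambda>\<alpha>. \<Sum>\<beta>\<in>{\<beta>. \<forall>v. \<beta> v \<le> \<alpha> v}. f \<beta> * g (\<lambda>v. \<alpha> v - \<beta> v))"

primrec ps_pow :: "('v::finite,'a::field) ps \<Rightarrow> nat \<Rightarrow> ('v,'a) ps" where
  "ps_pow f 0 = ps_one"
| "ps_pow f (Suc n) = ps_mult f (ps_pow f n)"

definition mdeg :: "('v::finite \<Rightarrow> nat) \<Rightarrow> nat" where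
  "mdeg \<alpha> = (\<Sum>v\<in>UNIV. \<alpha> v)"

definition ps_monpow :: "('v::{finite,linorder} \<Rightarrow> ('v,'a::field) ps) \<Rightarrow> ('v \<Rightarrow> nat) \<Rightarrow> ('v,'a) ps" where
  "ps_monpow \<phi> \<alpha> = foldr (\<lambda>v acc. ps_mult (ps_pow (\<phi> v) (\<alpha> v)) acc) (sorted_list_of_set UNIV) ps_one"

text \<open>Substitution f(phi(x_1),...,phi(x_s)) for phi(x_v) in the maximal ideal
  (each coefficient is a finite sum since ord(phi^alpha) \<ge> mdeg alpha).\<close>
definition ps_subst :: "('v::{finite,linorder} \<Rightarrow> ('v,'a::field) ps) \<Rightarrow> ('v,'a) ps \<Rightarrow> ('v,'a) ps" where
  "ps_subst \<phi> f = (\<lambda>\<gamma>. \<Sum>\<alpha>\<in>{\<alpha>. mdeg \<alpha> \<le> mdeg \<gamma>}. f \<alpha> * ps_monpow \<phi> \<alpha> \<gamma>)"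

definition in_max_ideal :: "('v,'a::field) ps \<Rightarrow> bool" where
  "in_max_ideal f \<longleftrightarrow> f (\<lambda>_. 0) = 0"

definition in_mpow :: "nat \<Rightarrow> ('v::finite,'a::field) ps \<Rightarrow> bool" where
  "in_mpow k f \<longleftrightarrow> (\<forall>\<alpha>. mdeg \<alpha> < k \<longrightarrow> f \<alpha> = 0)"

definition ps_deriv :: "'v \<Rightarrow> ('v,'a::field) ps \<Rightarrow> ('v,'a) ps" where
  "ps_deriv v f = (\<lambda>\<alpha>. of_nat (\<alpha> v + 1) * f (\<alpha>(v := \<alpha> v + 1)))"

text \<open>Aut(R): K-algebra automorphisms of R, given by substitutions
  x_v \<mapsto> phi v with phi v in m that are bijective on R.\<close>
definition is_aut :: "('v::{finite,linorder} \<Rightarrow> ('v,'a::field) ps) \<Rightarrow> bool" where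
  "is_aut \<phi> \<longleftrightarrow> (\<forall>v. in_max_ideal (\<phi> v)) \<and> bij (ps_subst \<phi>)"

definition ps_unit :: "('v::finite,'a::field) ps \<Rightarrow> bool" where
  "ps_unit u \<longleftrightarrow> (\<exists>w. ps_mult u w = ps_one)"

definition mat_mult :: "nat \<Rightarrow> (nat \<Rightarrow> nat \<Rightarrow> ('v::finite,'a::field) ps) \<Rightarrow> (nat \<Rightarrow> nat \<Rightarrow> ('v,'a) ps)
    \<Rightarrow> nat \<Rightarrow> nat \<Rightarrow> ('v,'a) ps" where
  "mat_mult m U W = (\<lambda>i j. ps_sum (\<lambda>k. ps_mult (U i k) (W k j)) {..<m})"

definition in_GL :: "nat \<Rightarrow> (nat \<Rightarrow> nat \<Rightarrow> ('v::finite,'a::field) ps) \<Rightarrow> bool" where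
  "in_GL m U \<longleftrightarrow> (\<exists>W. \<forall>i<m. \<forall>j<m.
      mat_mult m U W i j = (if i = j then ps_one else ps_zero) \<and>
      mat_mult m W U i j = (if i = j then ps_one else ps_zero))"

definition mat_vec :: "nat \<Rightarrow> (nat \<Rightarrow> nat \<Rightarrow> ('v::finite,'a::field) ps) \<Rightarrow> (nat \<Rightarrow> ('v,'a) ps)
    \<Rightarrow> nat \<Rightarrow> ('v,'a) ps" where
  "mat_vec m U w = (\<lambda>i. ps_sum (\<lambda>k. ps_mult (U i k) (w k)) {..<m})"

text \<open>G-equivalence on M_{m,1} (column vectors, entries indexed by i < m):
  B = U * phi(A) * V, with U in GL(m,R), V = [u] in GL(1,R), phi in Aut(R).\<close>
definition G_equiv :: "nat \<Rightarrow> (nat \<Rightarrow> ('v::{finite,linorder},'a::field) ps) \<Rightarrow> (nat \<Rightarrow> ('v,'a) ps) \<Rightarrow> bool" where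
  "G_equiv m A B \<longleftrightarrow> (\<exists>U u \<phi>. in_GL m U \<and> ps_unit u \<and> is_aut \<phi> \<and>
      (\<forall>i<m. B i = ps_mult (mat_vec m U (\<lambda>k. ps_subst \<phi> (A k)) i) u))"

definition G_determined :: "nat \<Rightarrow> (nat \<Rightarrow> ('v::{finite,linorder},'a::field) ps) \<Rightarrow> nat \<Rightarrow> bool" where
  "G_determined m A k \<longleftrightarrow>
     (\<forall>B. (\<forall>i<m. in_mpow (Suc k) (\<lambda>\<alpha>. B i \<alpha> - A i \<alpha>)) \<longrightarrow> G_equiv m A B)"

definition G_finitely_determined :: "nat \<Rightarrow> (nat \<Rightarrow> ('v::{finite,linorder},'a::field) ps) \<Rightarrow> bool" where
  "G_finitely_determined m A \<longleftrightarrow> (\<exists>k. G_determined m A k)"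

text \<open>Extended tangent image: <f_1..f_m> R^m + R-span of the Jacobian columns.\<close>
definition tangent_ext :: "nat \<Rightarrow> (nat \<Rightarrow> ('v::finite,'a::field) ps) \<Rightarrow> (nat \<Rightarrow> ('v,'a) ps) set" where
  "tangent_ext m A = {w. \<exists>(c :: nat \<Rightarrow> nat \<Rightarrow> ('v,'a) ps) (g :: 'v \<Rightarrow> ('v,'a) ps).
      \<forall>k<m. w k = ps_add (ps_sum (\<lambda>i. ps_mult (c k i) (A i)) {..<m})
                          (ps_sum (\<lambda>v. ps_mult (g v) (ps_deriv v (A k))) UNIV)}"

definition spans_mod :: "nat \<Rightarrow> (nat \<Rightarrow> ('v,'a::field) ps) set \<Rightarrow> (nat \<Rightarrow> ('v,'a) ps) set \<Rightarrow> bool" where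
  "spans_mod m T B \<longleftrightarrow> finite B \<and>
     (\<forall>w. \<exists>(a :: (nat \<Rightarrow> ('v,'a) ps) \<Rightarrow> 'a). \<exists>t\<in>T.
        \<forall>i<m. w i = ps_add (ps_sum (\<lambda>b. ps_scale (a b) (b i)) B) (t i))"

definition finite_codim :: "nat \<Rightarrow> (nat \<Rightarrow> ('v,'a::field) ps) set \<Rightarrow> bool" where
  "finite_codim m T \<longleftrightarrow> (\<exists>B. spans_mod m T B)"

definition codim :: "nat \<Rightarrow> (nat \<Rightarrow> ('v,'a::field) ps) set \<Rightarrow> nat" where
  "codim m T = (LEAST n. \<exists>B. spans_mod m T B \<and> card B = n)"

definition vec_ord :: "nat \<Rightarrow> (nat \<Rightarrow> ('v::finite,'a::field) ps) \<Rightarrow> nat" where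
  "vec_ord m A = (LEAST d. \<exists>i<m. \<exists>\<alpha>. mdeg \<alpha> = d \<and> A i \<alpha> \<noteq> 0)"

end

(* 2 implies 1: if d = d_e, some j <= d has m^j R^m contained in T + m^(j+1) R^m, for otherwise d + 1 vectors
   would be independent modulo T. With e = d - ord(A) + 3, an equation (1 + C) A(x + xi) = B with
   B - A in m^(d+e) R^m is then solved for C and xi in m^e by Newton iteration: T supplies the linear
   correction, and the quadratic error gains one order in each step.

   1 implies 2: the dimension of R^m / T does not increase from B to A when B ~ A, so it is enough to find,
   arbitrarily close to A, some B of finite codimension. Make A polynomial and treat one variable x_v after the
   other, adding x_v^E and the x_u x_v^E' for u different from v, with very sparse exponents. If no power of x_v
   annihilated R^m / T, the powers of x_v so introduced would outnumber the quantities through which they are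
   expressed by polynomials of bounded degree, and counting monomials would give a nonzero polynomial relation
   between them; sparseness turns it into x_v^w * unit = 0. *)

theory Submission
  imports Defs "HOL-Library.Function_Algebras" "HOL-Library.FuncSet" HOL.Vector_Spaces
begin

section \<open>The ring of formal power series\<close>

text \<open>In 2 implies 1, Taylor remainders are needed in every characteristic, so they are
  estimated without factorials, monomial by monomial. The value of e is the least for which the
  remainder at step p, of order ord(A) - 2 + 2e + p, reaches d + e + p + 1. In 1 implies 2 there are
  two obstacles. K may have few elements, so coefficients cannot be generic: exponents are made
  generic instead. And in characteristic p the derivative of a power may vanish: the derivative of
  x_u x_v^E' along x_u is x_v^E' in every characteristic. The count behind the polynomial relation
  is that of an incidence variety. A point x, a nonzero covector up to scaling and the ms parameters
  have s + (m - 1) + ms coordinates; the m equations B_k = 0 and the s - 1 derivative equations for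
  u different from v leave dimension ms, while x_v and the parameters are ms + 1 quantities. The
  exponents are chosen in terms of the degree of the relation, so a bound for this degree must be
  known before them. Counting monomials provides it, which a mere comparison of transcendence
  degrees would not.\<close>

typedef (overloaded) ('v, 'a) mps = "UNIV :: (('v \<Rightarrow> nat) \<Rightarrow> 'a) set"
  morphisms coeff Mps ..

lemma coeff_Mps [simp]: "coeff (Mps f) = f"
  by (simp add: Mps_inverse)

lemma Mps_coeff [simp]: "Mps (coeff f) = f"
  by (rule coeff_inverse)

lemma mps_eq_iff: "f = g \<longleftrightarrow> (\<forall>\<alpha>. coeff f \<alpha> = coeff g \<alpha>)"
  by (metis coeff_inject ext)

lemma mps_eqI: "(\<And>\<alpha>. coeff f \<alpha> = coeff g \<alpha>) \<Longrightarrow> f = g"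
  by (simp add: mps_eq_iff)

text \<open>A separate type is needed because \<open>Function_Algebras\<close> gives functions the
  pointwise operations. These are used for adding exponent vectors, whereas the product of series is
  a convolution.\<close>

instantiation mps :: (finite, field) comm_ring_1
begin

definition zero_mps_def: "0 = Mps ps_zero"
definition one_mps_def: "1 = Mps ps_one"
definition plus_mps_def: "f + g = Mps (ps_add (coeff f) (coeff g))"
definition uminus_mps_def: "- f = Mps (\<lambda>\<alpha>. - coeff f \<alpha>)"
definition minus_mps_def: "f - g = Mps (\<lambda>\<alpha>. coeff f \<alpha> - coeff g \<alpha>)"
definition times_mps_def: "f * g = Mps (ps_mult (coeff f) (coeff g))"

lemma box_eq: "{\<beta>. \<forall>v. \<beta> v \<le> \<alpha> v} = {..\<alpha> :: 'c \<Rightarrow> nat}"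
  by (auto simp: le_fun_def)

lemma finite_exps_le [simp]: "finite {..\<alpha> :: 'c::finite \<Rightarrow> nat}"
proof -
  have "{..\<alpha>} \<subseteq> PiE UNIV (\<lambda>v. {..\<alpha> v})"
    by (auto simp: le_fun_def)
  then show ?thesis
    by (rule finite_subset) (auto intro: finite_PiE)
qed

lemma coeff_mult: "coeff (f * g) \<alpha> = (\<Sum>\<beta>\<le>\<alpha>. coeff f \<beta> * coeff g (\<alpha> - \<beta>))"
  by (simp add: times_mps_def ps_mult_def box_eq fun_diff_def)

lemma exp_diff_diff: "\<beta> \<le> \<alpha> \<Longrightarrow> \<alpha> - (\<alpha> - \<beta>) = (\<beta> :: 'c \<Rightarrow> nat)"
  by (auto simp: fun_eq_iff le_fun_def)

lemma exp_add_diff: "\<beta> \<le> \<alpha> \<Longrightarrow> \<beta> + (\<alpha> - \<beta>) = (\<alpha> :: 'c \<Rightarrow> nat)"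
  by (auto simp: fun_eq_iff le_fun_def)

instance
proof
  fix f g h :: "('a, 'b) mps"
  show "f * g * h = f * (g * h)"
  proof (rule mps_eqI)
    fix \<alpha> :: "'a \<Rightarrow> nat"
    have "coeff (f * g * h) \<alpha> =
        (\<Sum>(\<beta>,\<gamma>)\<in>(SIGMA \<beta>:{..\<alpha>}. {..\<beta>}). coeff f \<gamma> * coeff g (\<beta> - \<gamma>) * coeff h (\<alpha> - \<beta>))"
      by (simp add: coeff_mult sum_distrib_right sum.Sigma)
    also have "\<dots> = (\<Sum>(\<gamma>,\<epsilon>)\<in>(SIGMA \<gamma>:{..\<alpha>}. {..\<alpha> - \<gamma>}).
        coeff f \<gamma> * (coeff g \<epsilon> * coeff h (\<alpha> - \<gamma> - \<epsilon>)))"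
      by (rule sum.reindex_bij_witness[of _ "\<lambda>(\<gamma>,\<epsilon>). (\<gamma> + \<epsilon>, \<gamma>)" "\<lambda>(\<beta>,\<gamma>). (\<gamma>, \<beta> - \<gamma>)"])
        (auto simp: le_fun_def fun_eq_iff mult.assoc le_diff_conv2 add.commute
           intro: order_trans intro!: diff_le_mono arg_cong2[of _ _ _ _ "(*)"] arg_cong[of _ _ "coeff h"])
    also have "\<dots> = coeff (f * (g * h)) \<alpha>"
      by (simp add: coeff_mult sum_distrib_left sum.Sigma)
    finally show "coeff (f * g * h) \<alpha> = coeff (f * (g * h)) \<alpha>" .
  qed
  show "f * g = g * f"
  proof (rule mps_eqI)
    fix \<alpha> :: "'a \<Rightarrow> nat"
    show "coeff (f * g) \<alpha> = coeff (g * f) \<alpha>"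
      unfolding coeff_mult
      by (rule sum.reindex_bij_witness[of _ "\<lambda>\<beta>. \<alpha> - \<beta>" "\<lambda>\<beta>. \<alpha> - \<beta>"])
        (auto simp: exp_diff_diff mult.commute, auto simp: le_fun_def)
  qed
  show "1 * f = f"
  proof (rule mps_eqI)
    fix \<alpha> :: "'a \<Rightarrow> nat"
    have "coeff (1 * f) \<alpha> = (\<Sum>\<beta>\<in>{..\<alpha>}. if \<beta> = (\<lambda>_. 0) then coeff f \<alpha> else 0)"
      unfolding coeff_mult by (intro sum.cong refl) (auto simp: one_mps_def ps_one_def fun_diff_def)
    then show "coeff (1 * f) \<alpha> = coeff f \<alpha>"
      by (simp add: sum.delta le_fun_def)
  qed
  show "(f + g) * h = f * h + g * h"
    by (rule mps_eqI) (simp add: coeff_mult plus_mps_def ps_add_def sum.distrib distrib_right)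
  show "(0 :: ('a, 'b) mps) \<noteq> 1"
    by (simp add: mps_eq_iff zero_mps_def one_mps_def ps_zero_def ps_one_def)
qed (simp_all add: mps_eq_iff plus_mps_def zero_mps_def uminus_mps_def minus_mps_def
      ps_add_def ps_zero_def)

end

lemma coeff_zero [simp]: "coeff 0 \<alpha> = 0"
  and coeff_add [simp]: "coeff (f + g) \<alpha> = coeff f \<alpha> + coeff g \<alpha>"
  and coeff_diff [simp]: "coeff (f - g) \<alpha> = coeff f \<alpha> - coeff g \<alpha>"
  and coeff_uminus [simp]: "coeff (- f) \<alpha> = - coeff f \<alpha>"
  and coeff_one: "coeff 1 \<alpha> = (if \<alpha> = 0 then 1 else 0)"
  by (simp_all add: zero_mps_def plus_mps_def minus_mps_def uminus_mps_def one_mps_def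
      ps_zero_def ps_add_def ps_one_def zero_fun_def)

lemma coeff_sum: "coeff (sum F S) \<alpha> = (\<Sum>i\<in>S. coeff (F i) \<alpha>)"
  by (induction S rule: infinite_finite_induct) auto

lemma Mps_zero: "Mps ps_zero = 0"
  and Mps_one: "Mps ps_one = 1"
  and Mps_add: "Mps (ps_add f g) = Mps f + Mps g"
  and Mps_mult: "Mps (ps_mult f g) = Mps f * Mps g"
  by (simp_all add: zero_mps_def one_mps_def plus_mps_def times_mps_def)

lemma Mps_sum: "Mps (ps_sum F S) = (\<Sum>i\<in>S. Mps (F i))"
  by (rule mps_eqI) (simp add: coeff_sum ps_sum_def)

lemma Mps_pow: "Mps (ps_pow f n) = Mps f ^ n"
  by (induction n) (simp_all add: Mps_one Mps_mult)

lemmas Mps_simps = Mps_zero Mps_one Mps_add Mps_mult Mps_sum Mps_pow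

section \<open>Monomials\<close>

definition xmon :: "('v \<Rightarrow> nat) \<Rightarrow> ('v, 'a::field) mps" where
  "xmon \<alpha> = Mps (\<lambda>\<beta>. if \<beta> = \<alpha> then 1 else 0)"

definition const :: "'a::field \<Rightarrow> ('v, 'a) mps" where
  "const c = Mps (\<lambda>\<beta>. if \<beta> = 0 then c else 0)"

definition var :: "'v \<Rightarrow> ('v, 'a::field) mps" where
  "var v = xmon (0(v := 1))"

lemma coeff_const_mult [simp]: "coeff (const c * f) \<alpha> = c * coeff f \<alpha>"
proof -
  have "coeff (const c * f) \<alpha> = (\<Sum>\<beta>\<in>{..\<alpha>}. if \<beta> = 0 then c * coeff f \<alpha> else 0)"
    unfolding coeff_mult by (intro sum.cong refl) (auto simp: const_def)
  then show ?thesis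
    by (simp add: sum.delta le_fun_def)
qed

lemma coeff_const: "coeff (const c) \<alpha> = (if \<alpha> = 0 then c else 0)"
  by (simp add: const_def)

lemma const_0 [simp]: "const 0 = 0" and const_1 [simp]: "const 1 = 1"
  and const_add: "const (a + b) = const a + const b"
  and const_mult: "const (a * b) = const a * const b"
  by (rule mps_eqI, simp add: coeff_const coeff_one)+

lemma coeff_xmon: "coeff (xmon \<alpha>) \<beta> = (if \<beta> = \<alpha> then 1 else 0)"
  by (simp add: xmon_def)

lemma coeff_xmon_mult: "coeff (xmon \<alpha> * f) \<beta> = (if \<alpha> \<le> \<beta> then coeff f (\<beta> - \<alpha>) else 0)"
proof -
  have "coeff (xmon \<alpha> * f) \<beta> = (\<Sum>\<gamma>\<in>{..\<beta>}. if \<gamma> = \<alpha> then coeff f (\<beta> - \<alpha>) else 0)"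
    unfolding coeff_mult by (intro sum.cong refl) (auto simp: coeff_xmon)
  then show ?thesis
    by (simp add: sum.delta)
qed

lemma xmon_0 [simp]: "xmon 0 = 1"
  by (rule mps_eqI) (simp add: coeff_xmon coeff_one)

lemma xmon_add: "xmon (\<alpha> + \<beta>) = xmon \<alpha> * xmon \<beta>"
  by (rule mps_eqI) (auto simp: coeff_xmon_mult coeff_xmon fun_eq_iff le_fun_def exp_add_diff,
     metis le_add_diff_inverse)

lemma var_mult_xmon: "var v * xmon \<alpha> = xmon (\<alpha>(v := Suc (\<alpha> v)))"
  unfolding var_def xmon_add[symmetric] by (rule arg_cong[of _ _ xmon]) (auto simp: fun_eq_iff)

lemma mdeg_0 [simp]: "mdeg 0 = 0"
  by (simp add: mdeg_def)

lemma mdeg_add [simp]: "mdeg (\<alpha> + \<beta>) = mdeg \<alpha> + mdeg \<beta>"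
  by (simp add: mdeg_def sum.distrib)

lemma mdeg_upd_Suc [simp]: "mdeg (\<alpha>(v := Suc (\<alpha> v))) = Suc (mdeg \<alpha>)"
proof -
  have "\<alpha>(v := Suc (\<alpha> v)) = \<alpha> + 0(v := 1)"
    by (auto simp: fun_eq_iff)
  moreover have "mdeg (0(v := Suc 0)) = 1"
    by (simp add: mdeg_def fun_upd_def sum.delta cong: if_cong)
  ultimately show ?thesis by simp
qed

lemma mdeg_eq_0_iff [simp]: "mdeg \<alpha> = 0 \<longleftrightarrow> \<alpha> = 0"
  by (auto simp: mdeg_def fun_eq_iff)

lemma le_mdeg: "\<alpha> v \<le> mdeg \<alpha>"
  unfolding mdeg_def by (rule member_le_sum) auto

lemma finite_bounded_exps [simp]: "finite {\<alpha> :: 'v::finite \<Rightarrow> nat. \<forall>v. \<alpha> v \<le> n}"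
  using finite_exps_le[of "\<lambda>_. n"] by (simp add: box_eq[symmetric])

lemma finite_mdeg_le [simp]: "finite {\<alpha> :: 'v::finite \<Rightarrow> nat. mdeg \<alpha> \<le> n}"
  by (rule finite_subset[OF _ finite_bounded_exps[of n]]) (use le_mdeg order_trans in blast)

lemma finite_mdeg_less [simp]: "finite {\<alpha> :: 'v::finite \<Rightarrow> nat. mdeg \<alpha> < n}"
  by (rule finite_subset[OF _ finite_mdeg_le[of n]]) auto

lemma finite_mdeg_eq [simp]: "finite {\<alpha> :: 'v::finite \<Rightarrow> nat. mdeg \<alpha> = n}"
  by (rule finite_subset[OF _ finite_mdeg_le[of n]]) auto

lemma mdeg_SucE:
  assumes "mdeg (\<alpha> :: 'v::finite \<Rightarrow> nat) = Suc n"
  obtains v \<beta> where "\<alpha> = \<beta>(v := Suc (\<beta> v))" "mdeg \<beta> = n"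
proof -
  obtain v where v: "\<alpha> v \<noteq> 0"
    using assms by (metis mdeg_eq_0_iff nat.distinct(1) zero_fun_apply ext)
  let ?\<beta> = "\<alpha>(v := \<alpha> v - 1)"
  have eq: "\<alpha> = ?\<beta>(v := Suc (?\<beta> v))"
    using v by (auto simp: fun_eq_iff)
  then have "mdeg \<alpha> = Suc (mdeg ?\<beta>)"
    by (metis mdeg_upd_Suc)
  with assms have "mdeg ?\<beta> = n" by simp
  with eq show thesis by (rule that)
qed

lemma exists_le_mdeg_eq:
  "n \<le> mdeg \<alpha> \<Longrightarrow> \<exists>\<beta>\<le>\<alpha>. mdeg (\<beta> :: 'v::finite \<Rightarrow> nat) = n"
proof (induction "mdeg \<alpha>" arbitrary: \<alpha>)
  case 0
  then have "mdeg \<alpha> = n" by linarith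
  then show ?case by blast
next
  case (Suc k)
  show ?case
  proof (cases "n = Suc k")
    case True
    with Suc show ?thesis by auto
  next
    case False
    obtain v \<beta> where \<beta>: "\<alpha> = \<beta>(v := Suc (\<beta> v))" "mdeg \<beta> = k"
      using mdeg_SucE Suc.hyps(2) by metis
    then obtain \<gamma> where "\<gamma> \<le> \<beta>" "mdeg \<gamma> = n"
      using Suc.hyps(1)[of \<beta>] Suc.hyps(2) Suc.prems False by auto
    moreover have "\<beta> \<le> \<alpha>"
      using \<beta> by (auto simp: le_fun_def)
    ultimately have "\<gamma> \<le> \<alpha>" "mdeg \<gamma> = n"
      by simp_all
    then show ?thesis by blast
  qed
qed

section \<open>The powers of the maximal ideal\<close>

definition mp :: "nat \<Rightarrow> ('v::finite, 'a::field) mps set" where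
  "mp k = {f. in_mpow k (coeff f)}"

lemma mp_iff: "f \<in> mp k \<longleftrightarrow> (\<forall>\<alpha>. mdeg \<alpha> < k \<longrightarrow> coeff f \<alpha> = 0)"
  by (simp add: mp_def in_mpow_def)

lemma mp_0 [simp]: "f \<in> mp 0"
  by (simp add: mp_iff)

lemma zero_mp [simp]: "0 \<in> mp k"
  by (simp add: mp_iff)

lemma mp_add: "f \<in> mp k \<Longrightarrow> g \<in> mp k \<Longrightarrow> f + g \<in> mp k"
  and mp_diff: "f \<in> mp k \<Longrightarrow> g \<in> mp k \<Longrightarrow> f - g \<in> mp k"
  and mp_uminus: "f \<in> mp k \<Longrightarrow> - f \<in> mp k"
  and mp_mono: "f \<in> mp k \<Longrightarrow> l \<le> k \<Longrightarrow> f \<in> mp l"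
  by (simp_all add: mp_iff)

lemma mp_sum: "(\<And>i. i \<in> S \<Longrightarrow> F i \<in> mp k) \<Longrightarrow> sum F S \<in> mp k"
  by (auto simp: mp_iff coeff_sum intro!: sum.neutral)

lemma mp_mult:
  assumes "f \<in> mp k" "g \<in> mp l"
  shows "f * g \<in> mp (k + l)"
  unfolding mp_iff
proof (intro allI impI)
  fix \<alpha> :: "'a \<Rightarrow> nat"
  assume \<alpha>: "mdeg \<alpha> < k + l"
  have "coeff f \<beta> * coeff g (\<alpha> - \<beta>) = 0" if "\<beta> \<le> \<alpha>" for \<beta>
  proof -
    have "mdeg \<beta> + mdeg (\<alpha> - \<beta>) < k + l"
      using exp_add_diff[OF that] mdeg_add[of \<beta> "\<alpha> - \<beta>"] \<alpha> by simp
    then have "mdeg \<beta> < k \<or> mdeg (\<alpha> - \<beta>) < l" by linarith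
    with assms show ?thesis by (auto simp: mp_iff)
  qed
  then show "coeff (f * g) \<alpha> = 0"
    unfolding coeff_mult by (intro sum.neutral) blast
qed

lemma mp_mult': "f \<in> mp k \<Longrightarrow> g \<in> mp l \<Longrightarrow> n \<le> k + l \<Longrightarrow> f * g \<in> mp n"
  using mp_mono mp_mult by blast

lemma mp_multl: "f \<in> mp k \<Longrightarrow> f * g \<in> mp k"
  and mp_multr: "f \<in> mp k \<Longrightarrow> g * f \<in> mp k"
  using mp_mult[of f k g 0] mp_mult[of g 0 f k] by simp_all

lemma mp_eq_0: "(\<And>k. f \<in> mp k) \<Longrightarrow> f = 0"
  by (rule mps_eqI) (metis coeff_zero lessI mp_iff)

lemma xmon_mp: "k \<le> mdeg \<alpha> \<Longrightarrow> xmon \<alpha> \<in> mp k"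
  by (auto simp: mp_iff coeff_xmon)

lemma mp_power: "f \<in> mp 1 \<Longrightarrow> f ^ n \<in> mp n"
  by (induction n) (auto dest: mp_mult)

lemma mp_prod: "(\<And>i. i \<in> S \<Longrightarrow> F i \<in> mp (n i)) \<Longrightarrow> prod F S \<in> mp (sum n S)"
  by (induction S rule: infinite_finite_induct) (auto intro: mp_mult)

text \<open>Every exponent of degree at least d is assigned one divisor of degree d, so that each
  coefficient of f is used exactly once. The quotients keep the order p, which later controls the
  size of the Newton corrections.\<close>

lemma mp_decompose:
  assumes "f \<in> mp (d + p)"
  obtains h where "f = (\<Sum>\<beta>\<in>{\<beta>. mdeg \<beta> = d}. xmon \<beta> * h \<beta>)" "\<And>\<beta>. h \<beta> \<in> mp p"
proof -
  define b where "b \<alpha> = (SOME \<beta>. \<beta> \<le> \<alpha> \<and> mdeg \<beta> = d)" for \<alpha> :: "'a \<Rightarrow> nat"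
  have b: "b \<alpha> \<le> \<alpha> \<and> mdeg (b \<alpha>) = d" if "d \<le> mdeg \<alpha>" for \<alpha>
    using someI_ex[OF exists_le_mdeg_eq[OF that, unfolded]] unfolding b_def by blast
  define h where "h \<beta> = Mps (\<lambda>\<gamma>. if mdeg \<beta> = d \<and> b (\<beta> + \<gamma>) = \<beta> then coeff f (\<beta> + \<gamma>) else 0)" for \<beta>
  have "f = (\<Sum>\<beta>\<in>{\<beta>. mdeg \<beta> = d}. xmon \<beta> * h \<beta>)"
  proof (rule mps_eqI)
    fix \<alpha>
    have "coeff (\<Sum>\<beta>\<in>{\<beta>. mdeg \<beta> = d}. xmon \<beta> * h \<beta>) \<alpha>
       = (\<Sum>\<beta>\<in>{\<beta>. mdeg \<beta> = d}. if \<beta> = b \<alpha> then (if b \<alpha> \<le> \<alpha> then coeff f \<alpha> else 0) else 0)"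
      unfolding coeff_sum coeff_xmon_mult
      by (intro sum.cong refl) (auto simp: h_def exp_add_diff)
    also have "\<dots> = coeff f \<alpha>"
    proof (cases "d \<le> mdeg \<alpha>")
      case True
      then show ?thesis using b[OF True] by (simp add: sum.delta)
    next
      case False
      then have "coeff f \<alpha> = 0" using assms by (simp add: mp_iff)
      then show ?thesis by (simp add: sum.delta)
    qed
    finally show "coeff f \<alpha> = coeff (\<Sum>\<beta>\<in>{\<beta>. mdeg \<beta> = d}. xmon \<beta> * h \<beta>) \<alpha>" ..
  qed
  moreover have "h \<beta> \<in> mp p" for \<beta>
    using assms by (auto simp: mp_iff h_def)
  ultimately show thesis using that by blast
qed

lemma mp_truncate: "f - (\<Sum>\<alpha>\<in>{\<alpha>. mdeg \<alpha> < n}. const (coeff f \<alpha>) * xmon \<alpha>) \<in> mp n"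
  by (auto simp: mp_iff coeff_sum coeff_xmon if_distrib sum.delta cong: if_cong)

text \<open>A series is a finite sum of monomials plus a tail of high order. The loss
  \<open>c\<close> is 0 for substitutions and 1 where a derivative occurs. This reduces identities
  and order estimates to monomials.\<close>

lemma additive_mp_extend:
  assumes add: "\<And>f g. F (f + g) = F f + F g"
    and cont: "\<And>f. f \<in> mp (t + c) \<Longrightarrow> F f \<in> mp t"
    and mon: "\<And>a \<alpha>. n \<le> mdeg \<alpha> \<Longrightarrow> F (const a * xmon \<alpha>) \<in> mp t"
    and f: "f \<in> mp n"
  shows "F f \<in> mp t"
proof -
  let ?p = "\<Sum>\<alpha>\<in>{\<alpha>. mdeg \<alpha> < t + c}. const (coeff f \<alpha>) * xmon \<alpha>"
  have F0: "F 0 = 0" using add[of 0 0] by simp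
  have F_sum: "F (sum h S) = (\<Sum>i\<in>S. F (h i))" for h and S :: "('a \<Rightarrow> nat) set"
    by (induction S rule: infinite_finite_induct) (auto simp: add F0)
  have "F (const (coeff f \<alpha>) * xmon \<alpha>) \<in> mp t" for \<alpha>
    using f mon[of \<alpha>] by (cases "n \<le> mdeg \<alpha>") (auto simp: mp_iff F0)
  then have "F ?p \<in> mp t"
    unfolding F_sum by (intro mp_sum)
  moreover have "F (f - ?p) \<in> mp t"
    by (intro cont mp_truncate)
  ultimately show ?thesis
    using mp_add add[of "f - ?p" ?p] by fastforce
qed

lemma additive_eq_0:
  assumes add: "\<And>f g. F (f + g) = F f + F g"
    and cont: "\<And>t f. f \<in> mp (t + c) \<Longrightarrow> F f \<in> mp t"
    and mon: "\<And>a \<alpha>. F (const a * xmon \<alpha>) = 0"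
  shows "F f = 0"
  by (rule mp_eq_0, rule additive_mp_extend[where F = F and n = 0, OF add cont]) (auto simp: mon)

lemma exps_induct [case_names zero upd]:
  fixes \<alpha> :: "'v::finite \<Rightarrow> nat"
  assumes "P 0" and "\<And>u \<alpha>. P \<alpha> \<Longrightarrow> P (\<alpha>(u := Suc (\<alpha> u)))"
  shows "P \<alpha>"
proof (induction "mdeg \<alpha>" arbitrary: \<alpha>)
  case 0
  then show ?case using assms(1) mdeg_eq_0_iff by metis
next
  case (Suc n)
  then show ?case using mdeg_SucE[of \<alpha> n] assms(2) by metis
qed

lemma xmon_const_0 [simp]: "xmon (\<lambda>_. 0) = 1"
  using xmon_0 unfolding zero_fun_def .

lemma mdeg_upd_Suc' [simp]: "mdeg (\<lambda>w. if w = v then Suc (\<alpha> v) else \<alpha> w) = Suc (mdeg \<alpha>)"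
  using mdeg_upd_Suc[of \<alpha> v] unfolding fun_upd_def .

text \<open>Coefficients of degree below n no longer change from \<open>s n\<close> on, so the one
  at \<alpha> can be read from the term whose index is one more than the degree of \<alpha>.\<close>

lemma mp_limit:
  assumes step: "\<And>n. s (Suc n) - s n \<in> mp n"
  obtains l where "\<And>n. l - s n \<in> mp n"
proof -
  have far: "s (n + k) - s n \<in> mp n" for n k
  proof (induction k)
    case (Suc k)
    have "s (n + Suc k) - s n = (s (Suc (n + k)) - s (n + k)) + (s (n + k) - s n)"
      by simp
    then show ?case
      using Suc mp_mono[OF step[of "n + k"], of n] by (metis le_add1 mp_add)
  qed simp
  let ?l = "Mps (\<lambda>\<alpha>. coeff (s (Suc (mdeg \<alpha>))) \<alpha>)"
  have "?l - s n \<in> mp n" for n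
    unfolding mp_iff
  proof (intro allI impI)
    fix \<alpha> :: "'a \<Rightarrow> nat"
    assume \<alpha>: "mdeg \<alpha> < n"
    have "s (Suc (mdeg \<alpha>) + (n - Suc (mdeg \<alpha>))) - s (Suc (mdeg \<alpha>)) \<in> mp (Suc (mdeg \<alpha>))"
      by (rule far)
    with \<alpha> show "coeff (?l - s n) \<alpha> = 0"
      by (simp add: mp_iff)
  qed
  with that show thesis by blast
qed

text \<open>Banach's fixed point theorem for the m-adic metric. It produces the inverses of series,
  of matrices near the identity, and of substitutions near the identity.\<close>

lemma contraction_fixpoint:
  fixes G :: "('i \<Rightarrow> ('v::finite, 'a::field) mps) \<Rightarrow> 'i \<Rightarrow> ('v, 'a) mps"
  assumes contr: "\<And>k w w'. (\<And>i. w i - w' i \<in> mp k) \<Longrightarrow> (\<And>i. G w i - G w' i \<in> mp (Suc k))"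
  obtains w where "G w = w"
proof -
  define s where "s n = (G ^^ n) (\<lambda>_. 0)" for n
  have step: "s (Suc n) i - s n i \<in> mp n" for n i
  proof (induction n arbitrary: i)
    case (Suc n)
    have "G (s (Suc n)) i - G (s n) i \<in> mp (Suc n)"
      by (rule contr) (rule Suc)
    then show ?case by (simp add: s_def)
  qed simp
  have "\<exists>l. \<forall>n. l - s n i \<in> mp n" for i
    using mp_limit[of "\<lambda>n. s n i"] step by metis
  then obtain w where w: "\<And>i n. w i - s n i \<in> mp n"
    by metis
  have "G w i - w i = 0" for i
  proof (rule mp_eq_0)
    fix n
    have "G w i - G (s n) i \<in> mp (Suc n)"
      by (rule contr) (rule w)
    moreover have "w i - s (Suc n) i \<in> mp (Suc n)"
      by (rule w)
    ultimately have "(G w i - G (s n) i) - (w i - s (Suc n) i) \<in> mp (Suc n)"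
      by (rule mp_diff)
    then show "G w i - w i \<in> mp n"
      by (auto simp: s_def intro: mp_mono)
  qed
  then have "G w = w" by auto
  with that show thesis .
qed

text \<open>Write f = c + N with N of positive order. The inverse w solves w = c^-1 (1 - N w), and
  the right side is a contraction in w.\<close>

lemma mps_unit:
  assumes "coeff f 0 \<noteq> 0"
  obtains g where "f * g = 1"
proof -
  define c where "c = coeff f 0"
  have c: "const c * const (inverse c) = 1"
    using assms by (simp add: c_def const_mult[symmetric])
  define N where "N = f - const c"
  have N: "N \<in> mp 1"
    by (auto simp: N_def c_def mp_iff coeff_const)
  have "const (inverse c) * (1 - N * w) - const (inverse c) * (1 - N * w') \<in> mp (Suc k)"
    if "w - w' \<in> mp k" for w w' k
  proof -
    have "const (inverse c) * (1 - N * w) - const (inverse c) * (1 - N * w')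
        = - const (inverse c) * (N * (w - w'))"
      by (simp add: algebra_simps)
    then show ?thesis
      using mp_uminus[OF mp_multr[OF mp_mult[OF N that], of "const (inverse c)"]] by simp
  qed
  then obtain w :: "unit \<Rightarrow> _" where w: "(\<lambda>i. const (inverse c) * (1 - N * w i)) = w"
    by (rule contraction_fixpoint[of "\<lambda>w i. const (inverse c) * (1 - N * w i)"])
  have "const c * w () = const c * (const (inverse c) * (1 - N * w ()))"
    using fun_cong[OF w, of "()"] by simp
  also have "\<dots> = 1 - N * w ()"
    by (simp only: mult.assoc[symmetric] c mult_1)
  finally have "f * w () = 1"
    by (simp add: N_def algebra_simps)
  with that show thesis .
qed

section \<open>Partial derivatives and substitution\<close>

definition pd :: "'v \<Rightarrow> ('v, 'a::field) mps \<Rightarrow> ('v, 'a) mps" where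
  "pd v f = Mps (ps_deriv v (coeff f))"

lemma coeff_pd: "coeff (pd v f) \<alpha> = of_nat (Suc (\<alpha> v)) * coeff f (\<alpha>(v := Suc (\<alpha> v)))"
  by (simp add: pd_def ps_deriv_def)

lemma Mps_deriv: "Mps (ps_deriv v f) = pd v (Mps f)"
  by (simp add: pd_def)

lemma pd_zero [simp]: "pd v 0 = 0"
  and pd_add: "pd v (f + g) = pd v f + pd v g"
  by (rule mps_eqI, simp add: coeff_pd algebra_simps)+

lemma pd_const_mult: "pd v (const c * f) = const c * pd v f"
  by (rule mps_eqI) (simp add: coeff_pd mult.left_commute)

lemma pd_sum: "pd v (sum F S) = (\<Sum>i\<in>S. pd v (F i))"
  by (induction S rule: infinite_finite_induct) (auto simp: pd_add)

lemma pd_mp: "f \<in> mp (Suc k) \<Longrightarrow> pd v f \<in> mp k"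
  by (auto simp: mp_iff coeff_pd)

lemma pd_xmon: "pd v (xmon \<alpha>) = const (of_nat (\<alpha> v)) * xmon (\<alpha>(v := \<alpha> v - 1))"
proof (rule mps_eqI)
  fix \<beta> :: "'a \<Rightarrow> nat"
  show "coeff (pd v (xmon \<alpha>)) \<beta> = coeff (const (of_nat (\<alpha> v)) * xmon (\<alpha>(v := \<alpha> v - 1))) \<beta>"
  proof (cases "\<alpha> v = 0")
    case True
    then have "\<beta>(v := Suc (\<beta> v)) \<noteq> \<alpha>"
      by (metis fun_upd_same nat.distinct(1))
    with True show ?thesis by (simp add: coeff_pd coeff_xmon)
  next
    case False
    then have "\<beta>(v := Suc (\<beta> v)) = \<alpha> \<longleftrightarrow> \<beta> = \<alpha>(v := \<alpha> v - 1)"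
      by (auto simp: fun_eq_iff)
    then show ?thesis using False
      by (auto simp: coeff_pd coeff_xmon simp del: of_nat_Suc)
  qed
qed

lemma pd_one [simp]: "pd v 1 = 0"
  using pd_xmon[of v 0] by simp

lemma pd_var: "pd v (var u) = (if u = v then 1 else 0)"
proof (cases "u = v")
  case True
  have "(0(v := 1))(v := 0) = (0 :: 'a \<Rightarrow> nat)" by auto
  with True show ?thesis by (simp add: var_def pd_xmon)
qed (simp add: var_def pd_xmon)

lemma pd_mult_xmon:
  "pd v (xmon \<alpha> * xmon \<beta>) = pd v (xmon \<alpha>) * xmon \<beta> + xmon \<alpha> * pd v (xmon \<beta>)"
proof -
  \<comment> \<open>If \<open>\<alpha> v = 0\<close>, truncated subtraction may give different
    exponents on the two sides, but both are multiplied by 0.\<close>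
  have *: "const (of_nat (\<alpha> v)) * xmon (\<alpha>(v := \<alpha> v - 1)) * xmon \<beta>
     = const (of_nat (\<alpha> v)) * xmon ((\<alpha> + \<beta>)(v := \<alpha> v + \<beta> v - 1))" for \<alpha> \<beta> :: "'a \<Rightarrow> nat"
  proof (cases "\<alpha> v = 0")
    case False
    then have "\<alpha>(v := \<alpha> v - 1) + \<beta> = (\<alpha> + \<beta>)(v := \<alpha> v + \<beta> v - 1)"
      by (auto simp: fun_eq_iff)
    then show ?thesis by (metis mult.assoc xmon_add)
  qed simp
  show ?thesis
    unfolding xmon_add[symmetric] pd_xmon
    unfolding * mult.commute[of "xmon \<alpha>" "const _ * _"]
    by (simp add: const_add distrib_right add.commute)
qed

text \<open>The defect of the product rule is additive in each argument, vanishes on monomials and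
  loses at most one order. Hence it vanishes everywhere, extending one argument at a time. The same
  scheme proves \<open>subst_mult\<close>.\<close>

lemma pd_mult: "pd v (f * g) = pd v f * g + f * pd v g"
proof -
  let ?F = "\<lambda>f g. pd v (f * g) - (pd v f * g + f * pd v g)"
  have c: "?F f g \<in> mp t" if "f \<in> mp (t + 1)" for f g t
    using that by (auto intro!: mp_diff mp_add pd_mp mp_multl intro: mp_mono)
  have c': "?F f g \<in> mp t" if "g \<in> mp (t + 1)" for f g t
    using c[OF that, of f] by (simp add: mult.commute add.commute)
  have mon: "?F (const a * xmon \<alpha>) (const b * xmon \<beta>) = 0" for a b \<alpha> \<beta>
  proof -
    have "const a * xmon \<alpha> * (const b * xmon \<beta>) = const a * (const b * (xmon \<alpha> * xmon \<beta>))"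
      by (simp add: ac_simps)
    then have "pd v (const a * xmon \<alpha> * (const b * xmon \<beta>))
      = const a * (const b * pd v (xmon \<alpha> * xmon \<beta>))"
      by (simp only: pd_const_mult)
    then show ?thesis
      by (simp only: pd_const_mult pd_mult_xmon) (simp add: algebra_simps)
  qed
  have "?F (const a * xmon \<alpha>) g = 0" for a \<alpha>
    by (rule additive_eq_0[where F = "?F (const a * xmon \<alpha>)" and c = 1, OF _ c' mon])
      (simp_all add: algebra_simps pd_add)
  then have "?F f g = 0"
    by (intro additive_eq_0[where F = "\<lambda>f. ?F f g" and c = 1 and f = f] c)
      (simp_all add: algebra_simps pd_add)
  then show ?thesis by simp
qed

section \<open>Substitution as a continuous ring endomorphism\<close>

definition subst :: "('v::{finite,linorder} \<Rightarrow> ('v, 'a::field) mps) \<Rightarrow> ('v, 'a) mps \<Rightarrow> ('v, 'a) mps" where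
  "subst \<phi> f = Mps (ps_subst (\<lambda>v. coeff (\<phi> v)) (coeff f))"

lemma Mps_monpow: "Mps (ps_monpow \<phi> \<alpha>) = (\<Prod>v\<in>UNIV. Mps (\<phi> v) ^ \<alpha> v)"
proof -
  have "Mps (foldr (\<lambda>v acc. ps_mult (ps_pow (\<phi> v) (\<alpha> v)) acc) xs ps_one)
     = prod_list (map (\<lambda>v. Mps (\<phi> v) ^ \<alpha> v) xs)" for xs
    by (induction xs) (simp_all add: Mps_simps)
  then show ?thesis
    unfolding ps_monpow_def
    by (simp add: prod.distinct_set_conv_list[of "sorted_list_of_set UNIV", symmetric])
qed

lemma coeff_subst: "coeff (subst \<phi> f) \<gamma> =
    (\<Sum>\<alpha>\<in>{\<alpha>. mdeg \<alpha> \<le> mdeg \<gamma>}. coeff f \<alpha> * coeff (\<Prod>v\<in>UNIV. \<phi> v ^ \<alpha> v) \<gamma>)"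
proof -
  have "ps_monpow (\<lambda>v. coeff (\<phi> v)) \<alpha> = coeff (\<Prod>v\<in>UNIV. \<phi> v ^ \<alpha> v)" for \<alpha>
    using arg_cong[OF Mps_monpow[of "\<lambda>v. coeff (\<phi> v)" \<alpha>], of coeff] by simp
  then show ?thesis by (simp add: subst_def ps_subst_def)
qed

lemma subst_add: "subst \<phi> (f + g) = subst \<phi> f + subst \<phi> g"
  and subst_diff: "subst \<phi> (f - g) = subst \<phi> f - subst \<phi> g"
  and subst_zero [simp]: "subst \<phi> 0 = 0"
  by (rule mps_eqI, simp add: coeff_subst algebra_simps sum.distrib sum_subtractf)+

lemma subst_const_mult: "subst \<phi> (const c * f) = const c * subst \<phi> f"
  by (rule mps_eqI) (simp add: coeff_subst sum_distrib_left mult.assoc)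

lemma subst_mp: "f \<in> mp k \<Longrightarrow> subst \<phi> f \<in> mp k"
  by (auto simp: mp_iff coeff_subst intro!: sum.neutral)

context
  fixes \<phi> :: "'v::{finite,linorder} \<Rightarrow> ('v, 'a::field) mps"
  assumes \<phi>: "\<And>v. \<phi> v \<in> mp 1"
begin

lemma subst_xmon: "subst \<phi> (xmon \<alpha>) = (\<Prod>v\<in>UNIV. \<phi> v ^ \<alpha> v)"
proof (rule mps_eqI)
  fix \<gamma> :: "'v \<Rightarrow> nat"
  have "(\<Prod>v\<in>UNIV. \<phi> v ^ \<alpha> v) \<in> mp (mdeg \<alpha>)"
    unfolding mdeg_def by (intro mp_prod mp_power \<phi>)
  moreover have "coeff (subst \<phi> (xmon \<alpha>)) \<gamma> = (\<Sum>\<beta>\<in>{\<beta>. mdeg \<beta> \<le> mdeg \<gamma>}.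
      if \<beta> = \<alpha> then coeff (\<Prod>v\<in>UNIV. \<phi> v ^ \<alpha> v) \<gamma> else 0)"
    unfolding coeff_subst by (intro sum.cong refl) (auto simp: coeff_xmon)
  ultimately show "coeff (subst \<phi> (xmon \<alpha>)) \<gamma> = coeff (\<Prod>v\<in>UNIV. \<phi> v ^ \<alpha> v) \<gamma>"
    by (simp add: sum.delta mp_iff)
qed

lemma subst_one [simp]: "subst \<phi> 1 = 1"
  using subst_xmon[of 0] by simp

lemma subst_mult: "subst \<phi> (f * g) = subst \<phi> f * subst \<phi> g"
proof -
  let ?F = "\<lambda>f g. subst \<phi> (f * g) - subst \<phi> f * subst \<phi> g"
  have c: "?F f g \<in> mp t" if "f \<in> mp (t + 0)" for f g t
    using that by (auto intro!: mp_diff subst_mp mp_multl)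
  have c': "?F f g \<in> mp t" if "g \<in> mp (t + 0)" for f g t
    using c[OF that, of f] by (simp add: mult.commute)
  have mon: "?F (const a * xmon \<alpha>) (const b * xmon \<beta>) = 0" for a b \<alpha> \<beta>
  proof -
    have "const a * xmon \<alpha> * (const b * xmon \<beta>) = const a * (const b * xmon (\<alpha> + \<beta>))"
      by (simp add: ac_simps xmon_add)
    then have "subst \<phi> (const a * xmon \<alpha> * (const b * xmon \<beta>))
      = const a * (const b * subst \<phi> (xmon (\<alpha> + \<beta>)))"
      by (simp only: subst_const_mult)
    then show ?thesis
      by (simp add: subst_const_mult subst_xmon prod.distrib power_add ac_simps)
  qed
  have "?F (const a * xmon \<alpha>) g = 0" for a \<alpha>
    by (rule additive_eq_0[where F = "?F (const a * xmon \<alpha>)" and c = 0, OF _ c' mon])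
      (simp_all add: algebra_simps subst_add)
  then have "?F f g = 0"
    by (intro additive_eq_0[where F = "\<lambda>f. ?F f g" and c = 0 and f = f] c)
      (simp_all add: algebra_simps subst_add)
  then show ?thesis by simp
qed

lemma subst_var: "subst \<phi> (var u) = \<phi> u"
proof -
  have "(\<Prod>v\<in>UNIV. \<phi> v ^ (0(u := 1)) v) = (\<Prod>v\<in>UNIV. if v = u then \<phi> u else 1)"
    by (intro prod.cong) auto
  then show ?thesis
    by (simp add: var_def subst_xmon prod.delta)
qed

lemma pd_subst: "pd i (subst \<phi> f) = (\<Sum>v\<in>UNIV. subst \<phi> (pd v f) * pd i (\<phi> v))"
proof -
  let ?F = "\<lambda>f. pd i (subst \<phi> f) - (\<Sum>v\<in>UNIV. subst \<phi> (pd v f) * pd i (\<phi> v))"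
  have xmon: "?F (xmon \<alpha>) = 0" for \<alpha>
  proof (induction \<alpha> rule: exps_induct)
    case (upd u \<alpha>)
    have "(\<Sum>v\<in>UNIV. subst \<phi> (pd v (var u * xmon \<alpha>)) * pd i (\<phi> v))
       = (\<Sum>v\<in>UNIV. subst \<phi> (pd v (var u)) * subst \<phi> (xmon \<alpha>) * pd i (\<phi> v))
       + \<phi> u * (\<Sum>v\<in>UNIV. subst \<phi> (pd v (xmon \<alpha>)) * pd i (\<phi> v))"
      by (simp add: pd_mult subst_add subst_mult subst_var distrib_right sum.distrib
          sum_distrib_left mult.assoc)
    also have "(\<Sum>v\<in>UNIV. subst \<phi> (pd v (var u)) * subst \<phi> (xmon \<alpha>) * pd i (\<phi> v))
       = (\<Sum>v\<in>UNIV. if v = u then subst \<phi> (xmon \<alpha>) * pd i (\<phi> u) else 0)"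
      by (intro sum.cong refl) (auto simp: pd_var)
    finally have "(\<Sum>v\<in>UNIV. subst \<phi> (pd v (var u * xmon \<alpha>)) * pd i (\<phi> v))
       = subst \<phi> (xmon \<alpha>) * pd i (\<phi> u)
       + \<phi> u * (\<Sum>v\<in>UNIV. subst \<phi> (pd v (xmon \<alpha>)) * pd i (\<phi> v))"
      by (simp add: sum.delta)
    moreover have "pd i (subst \<phi> (var u * xmon \<alpha>))
       = pd i (\<phi> u) * subst \<phi> (xmon \<alpha>) + \<phi> u * pd i (subst \<phi> (xmon \<alpha>))"
      by (simp add: subst_mult subst_var pd_mult)
    ultimately show ?case using upd
      unfolding var_mult_xmon[symmetric] by (simp add: mult.commute)
  qed simp
  have "?F f = 0"
  proof (rule additive_eq_0[where F = ?F and c = 1])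
    show "?F f \<in> mp t" if "f \<in> mp (t + 1)" for f t
      using that by (auto intro!: mp_diff mp_sum mp_multl subst_mp pd_mp)
    show "?F (const a * xmon \<alpha>) = 0" for a \<alpha>
      using xmon[of \<alpha>]
      by (simp add: subst_const_mult pd_const_mult mult.assoc sum_distrib_left[symmetric])
  qed (simp add: subst_add pd_add distrib_right sum.distrib)
  then show ?thesis by simp
qed

end

section \<open>Orders under substitutions, in particular near the identity\<close>

lemma var_mp: "var v \<in> mp 1"
  unfolding var_def by (rule xmon_mp) (metis fun_upd_same le_mdeg zero_neq_one One_nat_def)

lemma var_mp_Suc_0 [simp]: "var v \<in> mp (Suc 0)"
  using var_mp by simp

lemma subst_id: "subst var f = f"
proof -
  have "subst var (xmon \<alpha>) = (xmon \<alpha> :: ('a, 'b) mps)" for \<alpha>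
  proof (induction \<alpha> rule: exps_induct)
    case (upd u \<alpha>)
    then show ?case
      unfolding var_mult_xmon[symmetric] by (simp add: subst_mult[OF var_mp] subst_var[OF var_mp])
  qed (simp add: subst_one[OF var_mp])
  then have "subst var f - f = 0"
    by (intro additive_eq_0[where F = "\<lambda>f. subst var f - f" and c = 0 and f = f])
      (auto simp: subst_add subst_const_mult intro!: mp_diff subst_mp)
  then show ?thesis by simp
qed

text \<open>Exchanging the factors of a monomial of degree n one after another leaves each time n -
  1 factors of order at least 1 and one difference of order e. Writing the bound with
  \<open>Suc t\<close> avoids subtraction.\<close>

lemma subst_diff_mp:
  assumes \<phi>: "\<And>v. \<phi> v \<in> mp 1" and \<psi>: "\<And>v. \<psi> v \<in> mp 1"
    and e: "\<And>v. \<psi> v - \<phi> v \<in> mp e"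
    and f: "f \<in> mp n" and t: "Suc t \<le> n + e"
  shows "subst \<psi> f - subst \<phi> f \<in> mp t"
proof -
  have xmon: "subst \<psi> (xmon \<alpha>) - subst \<phi> (xmon \<alpha>) \<in> mp t" if "Suc t \<le> mdeg \<alpha> + e" for \<alpha> t
    using that
  proof (induction \<alpha> arbitrary: t rule: exps_induct)
    case zero
    then show ?case by (simp add: subst_one[OF \<phi>] subst_one[OF \<psi>])
  next
    case (upd u \<alpha>)
    show ?case
    proof (cases t)
      case (Suc t')
      have "subst \<psi> (var u * xmon \<alpha>) - subst \<phi> (var u * xmon \<alpha>)
        = \<phi> u * (subst \<psi> (xmon \<alpha>) - subst \<phi> (xmon \<alpha>)) + (\<psi> u - \<phi> u) * subst \<psi> (xmon \<alpha>)"
        by (simp add: subst_mult[OF \<phi>] subst_var[OF \<phi>] subst_mult[OF \<psi>] subst_var[OF \<psi>] algebra_simps)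
      moreover have "\<phi> u * (subst \<psi> (xmon \<alpha>) - subst \<phi> (xmon \<alpha>)) \<in> mp t"
        using mp_mult[OF \<phi> upd.IH[of t']] upd.prems Suc by auto
      moreover have "(\<psi> u - \<phi> u) * subst \<psi> (xmon \<alpha>) \<in> mp t"
        by (rule mp_mult'[OF e subst_mp[OF xmon_mp[OF order_refl]]]) (use upd.prems in auto)
      ultimately show ?thesis
        unfolding var_mult_xmon[symmetric] by (simp add: mp_add)
    qed simp
  qed
  show ?thesis
  proof (rule additive_mp_extend[where F = "\<lambda>f. subst \<psi> f - subst \<phi> f" and c = 0 and n = n])
    show "subst \<psi> (const a * xmon \<alpha>) - subst \<phi> (const a * xmon \<alpha>) \<in> mp t" if "n \<le> mdeg \<alpha>" for a \<alpha>
      using mp_multr[OF xmon[of t \<alpha>], of "const a"] that t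
      by (simp add: subst_const_mult right_diff_distrib)
  qed (use f in \<open>auto simp: subst_add intro!: mp_diff subst_mp\<close>)
qed

text \<open>The remainder of x_u g is x_u times the remainder of g, plus (\<phi> u - x_u) (\<psi>(g)
  - \<phi>(g)), plus (\<psi> u - \<phi> u) (\<psi>(g) - g); this permits induction on monomials
  without dividing by factorials. The derivatives are those of f itself, not composed with \<phi>,
  because the linear equations will be solved in \<open>tang\<close>; this costs nothing more than
  pairing e' with e in the bound.\<close>

lemma subst_taylor_mp:
  assumes \<phi>: "\<And>v. \<phi> v - var v \<in> mp e" and \<psi>: "\<And>v. \<psi> v - \<phi> v \<in> mp e'"
    and e: "1 \<le> e" "e \<le> e'"
    and f: "f \<in> mp n" and t: "t + 2 \<le> n + e + e'"
  shows "subst \<psi> f - subst \<phi> f - (\<Sum>v\<in>UNIV. (\<psi> v - \<phi> v) * pd v f) \<in> mp t"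
proof -
  have \<psi>': "\<psi> v - var v \<in> mp e" for v
    using mp_add[OF mp_mono[OF \<psi> e(2)] \<phi>, of v v] by simp
  have \<phi>1: "\<phi> v \<in> mp 1" for v
    using mp_add[OF mp_mono[OF \<phi> e(1)] var_mp, of v v] by simp
  have \<psi>1: "\<psi> v \<in> mp 1" for v
    using mp_add[OF mp_mono[OF \<psi>' e(1)] var_mp, of v v] by simp
  let ?D = "\<lambda>f. \<Sum>v\<in>UNIV. (\<psi> v - \<phi> v) * pd v f"
  let ?F = "\<lambda>f. subst \<psi> f - subst \<phi> f - ?D f"
  have xmon: "?F (xmon \<alpha>) \<in> mp t" if "t + 2 \<le> mdeg \<alpha> + e + e'" for \<alpha> t
    using that
  proof (induction \<alpha> arbitrary: t rule: exps_induct)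
    case zero
    then show ?case by (simp add: subst_one[OF \<phi>1] subst_one[OF \<psi>1])
  next
    case (upd u \<alpha>)
    let ?g = "xmon \<alpha>"
    show ?case
    proof (cases t)
      case (Suc t')
      have "?D (var u * ?g) = (\<Sum>v\<in>UNIV. if v = u then (\<psi> u - \<phi> u) * ?g else 0) + var u * ?D ?g"
        unfolding sum_distrib_left sum.distrib[symmetric]
        by (intro sum.cong refl) (auto simp: pd_mult pd_var algebra_simps)
      then have "?D (var u * ?g) = (\<psi> u - \<phi> u) * ?g + var u * ?D ?g"
        by (simp add: sum.delta)
      then have eq: "?F (var u * ?g) = var u * ?F ?g + (\<phi> u - var u) * (subst \<psi> ?g - subst \<phi> ?g)
          + (\<psi> u - \<phi> u) * (subst \<psi> ?g - subst var ?g)"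
        by (simp add: subst_mult[OF \<phi>1] subst_var[OF \<phi>1] subst_mult[OF \<psi>1] subst_var[OF \<psi>1]
            subst_id algebra_simps)
      have 1: "var u * ?F ?g \<in> mp t"
        using mp_mult[OF var_mp upd.IH[of t']] upd.prems Suc by auto
      have 2: "(\<phi> u - var u) * (subst \<psi> ?g - subst \<phi> ?g) \<in> mp t"
      proof (cases "e \<le> t")
        case True
        have "subst \<psi> ?g - subst \<phi> ?g \<in> mp (t - e)"
          by (rule subst_diff_mp[OF \<phi>1 \<psi>1 \<psi> xmon_mp[OF order_refl]]) (use upd.prems True in auto)
        from mp_mult[OF \<phi> this] True show ?thesis by simp
      qed (use mp_multl[OF mp_mono[OF \<phi>]] in auto)
      have 3: "(\<psi> u - \<phi> u) * (subst \<psi> ?g - subst var ?g) \<in> mp t"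
      proof (cases "e' \<le> t")
        case True
        have "subst \<psi> ?g - subst var ?g \<in> mp (t - e')"
          by (rule subst_diff_mp[OF var_mp \<psi>1 \<psi>' xmon_mp[OF order_refl]]) (use upd.prems True in auto)
        from mp_mult[OF \<psi> this] True show ?thesis by simp
      qed (use mp_multl[OF mp_mono[OF \<psi>]] in auto)
      show ?thesis
        unfolding var_mult_xmon[symmetric] eq by (intro mp_add 1 2 3)
    qed simp
  qed
  show ?thesis
  proof (rule additive_mp_extend[where F = ?F and c = 1 and n = n])
    show "?F (f + g) = ?F f + ?F g" for f g
      by (simp add: subst_add pd_add distrib_left sum.distrib)
    show "?F f \<in> mp t" if "f \<in> mp (t + 1)" for f
      using that by (auto intro!: mp_diff mp_sum mp_multr subst_mp pd_mp intro: mp_mono)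
    show "?F (const a * xmon \<alpha>) \<in> mp t" if "n \<le> mdeg \<alpha>" for a \<alpha>
      using mp_multr[OF xmon[of t \<alpha>], of "const a"] that t
      by (simp add: subst_const_mult pd_const_mult right_diff_distrib sum_distrib_left mult.left_commute)
    show "f \<in> mp n" by (rule f)
  qed
qed

text \<open>Order 2 of the deviation makes \<open>subst \<phi> f - f\<close> gain one order over f.
  Injectivity follows at once, and surjectivity by solving f = g - (\<open>subst \<phi> f\<close> -
  f) as a fixed point.\<close>

lemma bij_subst:
  fixes \<phi> :: "'v::{finite,linorder} \<Rightarrow> ('v, 'a::field) mps"
  assumes "\<And>v. \<phi> v - var v \<in> mp 2"
  shows "bij (subst \<phi>)"
proof -
  have \<phi>1: "\<phi> v \<in> mp 1" for v
    using mp_add[OF mp_mono[OF assms] var_mp, of v v] by simp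
  have gain: "subst \<phi> f - f \<in> mp (Suc k)" if "f \<in> mp k" for f k
    using subst_diff_mp[where e = 2 and \<phi> = var, OF var_mp \<phi>1 assms that, of "Suc k"]
    by (simp add: subst_id)
  have "inj (subst \<phi>)"
  proof (rule injI)
    fix f g assume eq: "subst \<phi> f = subst \<phi> g"
    have "f - g \<in> mp k" for k
    proof (induction k)
      case (Suc k)
      from mp_uminus[OF gain[OF this]] show ?case by (simp add: subst_diff eq)
    qed simp
    then show "f = g" using mp_eq_0 by fastforce
  qed
  moreover have "surj (subst \<phi>)"
  proof (rule surjI[of _ "\<lambda>g. SOME f. subst \<phi> f = g"], rule someI_ex)
    fix g
    obtain w :: "unit \<Rightarrow> _" where "(\<lambda>i. g - (subst \<phi> (w i) - w i)) = w"
    proof (rule contraction_fixpoint[of "\<lambda>w i. g - (subst \<phi> (w i) - w i)"])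
      fix k and w w' :: "unit \<Rightarrow> ('v, 'a) mps" and i
      assume "\<And>i. w i - w' i \<in> mp k"
      from mp_uminus[OF gain[OF this[of i]]]
      show "g - (subst \<phi> (w i) - w i) - (g - (subst \<phi> (w' i) - w' i)) \<in> mp (Suc k)"
        by (simp add: subst_diff algebra_simps)
    qed
    then have "g - (subst \<phi> (w ()) - w ()) = w ()" by metis
    then show "\<exists>f. subst \<phi> f = g" by (auto simp: algebra_simps)
  qed
  ultimately show ?thesis by (simp add: bij_def)
qed

section \<open>Submodules of the free module and the extended tangent image\<close>

text \<open>Elements of \<open>R\<^sup>m\<close> are functions on \<open>nat\<close> of which only the entries below \<open>m\<close> matter.\<close>

definition submod :: "nat \<Rightarrow> (nat \<Rightarrow> ('v::finite, 'a::field) mps) set \<Rightarrow> bool" where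
  "submod m Y \<longleftrightarrow> (\<lambda>_. 0) \<in> Y \<and> (\<forall>w\<in>Y. \<forall>w'\<in>Y. (\<lambda>k. w k + w' k) \<in> Y) \<and>
     (\<forall>r. \<forall>w\<in>Y. (\<lambda>k. r * w k) \<in> Y) \<and> (\<forall>w\<in>Y. \<forall>w'. (\<forall>k<m. w' k = w k) \<longrightarrow> w' \<in> Y)"

definition unitv :: "nat \<Rightarrow> ('v::finite, 'a::field) mps \<Rightarrow> nat \<Rightarrow> ('v, 'a) mps" where
  "unitv k r = (\<lambda>i. if i = k then r else 0)"

text \<open>The condition m^l R^m \<subseteq> Y, the form in which finite codimension is carried
  through the implication from 1 to 2.\<close>

definition full :: "nat \<Rightarrow> nat \<Rightarrow> (nat \<Rightarrow> ('v::finite, 'a::field) mps) set \<Rightarrow> bool" where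
  "full m l Y \<longleftrightarrow> (\<forall>w. (\<forall>k<m. w k \<in> mp l) \<longrightarrow> w \<in> Y)"

definition tang :: "nat \<Rightarrow> (nat \<Rightarrow> ('v::finite, 'a::field) mps) \<Rightarrow> (nat \<Rightarrow> ('v, 'a) mps) set" where
  "tang m A = {w. \<exists>c g. \<forall>k<m. w k = (\<Sum>i<m. c k i * A i) + (\<Sum>v\<in>UNIV. g v * pd v (A k))}"

context
  fixes m :: nat and Y :: "(nat \<Rightarrow> ('v::finite, 'a::field) mps) set"
  assumes Y: "submod m Y"
begin

lemma submod_0: "(\<lambda>_. 0) \<in> Y"
  and submod_add: "w \<in> Y \<Longrightarrow> w' \<in> Y \<Longrightarrow> (\<lambda>k. w k + w' k) \<in> Y"
  and submod_scale: "w \<in> Y \<Longrightarrow> (\<lambda>k. r * w k) \<in> Y"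
  and submod_cong: "w \<in> Y \<Longrightarrow> (\<And>k. k < m \<Longrightarrow> w' k = w k) \<Longrightarrow> w' \<in> Y"
  using Y unfolding submod_def by blast+

lemma submod_diff: "w \<in> Y \<Longrightarrow> w' \<in> Y \<Longrightarrow> (\<lambda>k. w k - w' k) \<in> Y"
  using submod_add[of w "\<lambda>k. - 1 * w' k"] submod_scale[of w' "- 1"] by simp

lemma submod_sum: "(\<And>i. i \<in> S \<Longrightarrow> F i \<in> Y) \<Longrightarrow> (\<lambda>k. \<Sum>i\<in>S. F i k) \<in> Y"
  by (induction S rule: infinite_finite_induct) (auto simp: submod_0 submod_add)

lemma submod_lincomb: "(\<And>i. i \<in> S \<Longrightarrow> F i \<in> Y) \<Longrightarrow> (\<lambda>k. \<Sum>i\<in>S. r i * F i k) \<in> Y"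
  using submod_sum[of S "\<lambda>i k. r i * F i k"] submod_scale by blast

lemma submod_units:
  assumes "\<And>j i. j < m \<Longrightarrow> i \<in> S \<Longrightarrow> unitv j (a i) \<in> Y"
  shows "(\<lambda>k. \<Sum>i\<in>S. c k i * a i) \<in> Y"
proof (rule submod_cong)
  show "(\<lambda>k. \<Sum>j<m. \<Sum>i\<in>S. c j i * unitv j (a i) k) \<in> Y"
    by (intro submod_sum submod_scale assms) auto
  show "(\<Sum>i\<in>S. c k i * a i) = (\<Sum>j<m. \<Sum>i\<in>S. c j i * unitv j (a i) k)" if "k < m" for k
  proof -
    have "(\<Sum>j<m. \<Sum>i\<in>S. c j i * unitv j (a i) k)
       = (\<Sum>j<m. if j = k then \<Sum>i\<in>S. c k i * a i else 0)"
      by (intro sum.cong refl) (auto simp: unitv_def)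
    with that show ?thesis by (simp add: sum.delta)
  qed
qed

lemma submod_units1: "(\<And>j. j < m \<Longrightarrow> unitv j a \<in> Y) \<Longrightarrow> (\<lambda>k. a * w k) \<in> Y"
  using submod_units[of "{()}" "\<lambda>_. a" "\<lambda>k _. w k"] by (simp add: mult.commute)

lemma full_of_monomials:
  assumes "\<And>k \<beta>. k < m \<Longrightarrow> mdeg \<beta> = l \<Longrightarrow> unitv k (xmon \<beta>) \<in> Y"
  shows "full m l Y"
  unfolding full_def
proof (intro allI impI)
  fix w :: "nat \<Rightarrow> ('v, 'a) mps"
  assume w: "\<forall>k<m. w k \<in> mp l"
  have "\<exists>h. k < m \<longrightarrow> w k = (\<Sum>\<beta>\<in>{\<beta>. mdeg \<beta> = l}. h \<beta> * xmon \<beta>)" for k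
    using mp_decompose[of "w k" l 0] w by (metis (no_types, lifting) add_0_right mult.commute sum.cong)
  then obtain h where h: "\<And>k. k < m \<Longrightarrow> w k = (\<Sum>\<beta>\<in>{\<beta>. mdeg \<beta> = l}. h k \<beta> * xmon \<beta>)"
    by metis
  have "(\<lambda>k. \<Sum>\<beta>\<in>{\<beta>. mdeg \<beta> = l}. h k \<beta> * xmon \<beta>) \<in> Y"
    by (rule submod_units) (auto intro: assms)
  then show "w \<in> Y"
    by (rule submod_cong) (rule h)
qed

end

lemma fullD: "full m l Y \<Longrightarrow> (\<And>k. k < m \<Longrightarrow> w k \<in> mp l) \<Longrightarrow> w \<in> Y"
  unfolding full_def by blast

lemma submodI:
  assumes "(\<lambda>_. 0) \<in> Y"
    and "\<And>w w'. w \<in> Y \<Longrightarrow> w' \<in> Y \<Longrightarrow> (\<lambda>k. w k + w' k) \<in> Y"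
    and "\<And>r w. w \<in> Y \<Longrightarrow> (\<lambda>k. r * w k) \<in> Y"
    and "\<And>w w'. w \<in> Y \<Longrightarrow> (\<And>k. k < m \<Longrightarrow> w' k = w k) \<Longrightarrow> w' \<in> Y"
  shows "submod m Y"
  unfolding submod_def using assms by blast

section \<open>The extended tangent image as a submodule\<close>

lemma submod_tang: "submod m (tang m A)"
proof (rule submodI)
  show "(\<lambda>_. 0) \<in> tang m A"
    unfolding tang_def by (rule CollectI, rule exI[of _ "\<lambda>_ _. 0"], rule exI[of _ "\<lambda>_. 0"]) simp
next
  fix w w' assume "w \<in> tang m A" "w' \<in> tang m A"
  then obtain c g c' g' where
    "\<And>k. k < m \<Longrightarrow> w k = (\<Sum>i<m. c k i * A i) + (\<Sum>v\<in>UNIV. g v * pd v (A k))"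
    "\<And>k. k < m \<Longrightarrow> w' k = (\<Sum>i<m. c' k i * A i) + (\<Sum>v\<in>UNIV. g' v * pd v (A k))"
    unfolding tang_def by blast
  then have "\<forall>k<m. w k + w' k = (\<Sum>i<m. (c k i + c' k i) * A i) + (\<Sum>v\<in>UNIV. (g v + g' v) * pd v (A k))"
    by (simp add: distrib_right sum.distrib)
  then show "(\<lambda>k. w k + w' k) \<in> tang m A"
    unfolding tang_def
    by (intro CollectI exI[of _ "\<lambda>k i. c k i + c' k i"] exI[of _ "\<lambda>v. g v + g' v"])
next
  fix r w assume "w \<in> tang m A"
  then obtain c g where
    "\<And>k. k < m \<Longrightarrow> w k = (\<Sum>i<m. c k i * A i) + (\<Sum>v\<in>UNIV. g v * pd v (A k))"
    unfolding tang_def by blast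
  then have "\<forall>k<m. r * w k = (\<Sum>i<m. (r * c k i) * A i) + (\<Sum>v\<in>UNIV. (r * g v) * pd v (A k))"
    by (simp add: distrib_left sum_distrib_left mult.assoc)
  then show "(\<lambda>k. r * w k) \<in> tang m A"
    unfolding tang_def
    by (intro CollectI exI[of _ "\<lambda>k i. r * c k i"] exI[of _ "\<lambda>v. r * g v"])
next
  fix w w' :: "nat \<Rightarrow> ('a, 'b) mps" assume "w \<in> tang m A" "\<And>k. k < m \<Longrightarrow> w' k = w k"
  then show "w' \<in> tang m A" unfolding tang_def by auto
qed

lemma tang_unitv:
  assumes "i < m" shows "unitv k (A i) \<in> tang m A"
proof -
  have "(\<Sum>j<m. (if k' = k \<and> j = i then 1 else 0) * A j) = unitv k (A i) k'" for k'
  proof -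
    have "(\<Sum>j<m. (if k' = k \<and> j = i then 1 else 0) * A j)
       = (\<Sum>j<m. if j = i then unitv k (A i) k' else 0)"
      by (intro sum.cong refl) (auto simp: unitv_def)
    with assms show ?thesis by (simp add: sum.delta)
  qed
  then show ?thesis
    unfolding tang_def
    by (intro CollectI exI[of _ "\<lambda>k' j. if k' = k \<and> j = i then 1 else 0"] exI[of _ "\<lambda>_. 0"]) simp
qed

lemma tang_pd: "(\<lambda>k. pd v (A k)) \<in> tang m A"
proof -
  have "(\<Sum>u\<in>UNIV. (if u = v then 1 else 0) * pd u (A k)) = pd v (A k)" for k
  proof -
    have "(\<Sum>u\<in>UNIV. (if u = v then 1 else 0) * pd u (A k))
       = (\<Sum>u\<in>UNIV. if u = v then pd v (A k) else 0)"
      by (intro sum.cong refl) auto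
    then show ?thesis by (simp add: sum.delta)
  qed
  then show ?thesis
    unfolding tang_def
    by (intro CollectI exI[of _ "\<lambda>_ _. 0"] exI[of _ "\<lambda>u. if u = v then 1 else 0"]) simp
qed

lemma tang_least:
  assumes Y: "submod m Y"
    and "\<And>i k. i < m \<Longrightarrow> k < m \<Longrightarrow> unitv k (A i) \<in> Y"
    and "\<And>v. (\<lambda>k. pd v (A k)) \<in> Y"
  shows "tang m A \<subseteq> Y"
proof
  fix w assume "w \<in> tang m A"
  then obtain c g where
    w: "\<And>k. k < m \<Longrightarrow> w k = (\<Sum>i<m. c k i * A i) + (\<Sum>v\<in>UNIV. g v * pd v (A k))"
    unfolding tang_def by blast
  have "(\<lambda>k. (\<Sum>i<m. c k i * A i) + (\<Sum>v\<in>UNIV. g v * pd v (A k))) \<in> Y"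
    by (intro submod_add[OF Y] submod_units[OF Y] submod_lincomb[OF Y] assms) auto
  then show "w \<in> Y"
    by (rule submod_cong[OF Y]) (rule w)
qed

lemma Mps_inject_iff: "f = g \<longleftrightarrow> Mps f = Mps g"
  by (metis coeff_Mps)

lemma tangent_ext_iff:
  "w \<in> tangent_ext m A \<longleftrightarrow> (\<lambda>k. Mps (w k)) \<in> tang m (\<lambda>i. Mps (A i))"
proof
  assume "w \<in> tangent_ext m A"
  then obtain c g where "\<forall>k<m. w k = ps_add (ps_sum (\<lambda>i. ps_mult (c k i) (A i)) {..<m})
      (ps_sum (\<lambda>v. ps_mult (g v) (ps_deriv v (A k))) UNIV)"
    unfolding tangent_ext_def by blast
  then show "(\<lambda>k. Mps (w k)) \<in> tang m (\<lambda>i. Mps (A i))"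
    unfolding tang_def
    by (intro CollectI exI[of _ "\<lambda>k i. Mps (c k i)"] exI[of _ "\<lambda>v. Mps (g v)"])
      (simp add: Mps_simps Mps_deriv)
next
  assume "(\<lambda>k. Mps (w k)) \<in> tang m (\<lambda>i. Mps (A i))"
  then obtain c g where "\<forall>k<m. Mps (w k) = (\<Sum>i<m. c k i * Mps (A i))
      + (\<Sum>v\<in>UNIV. g v * pd v (Mps (A k)))"
    unfolding tang_def by blast
  then show "w \<in> tangent_ext m A"
    unfolding tangent_ext_def
    by (intro CollectI exI[of _ "\<lambda>k i. coeff (c k i)"] exI[of _ "\<lambda>v. coeff (g v)"])
      (simp add: Mps_inject_iff Mps_simps Mps_deriv)
qed

lemma finite_codim_of_full:
  fixes A :: "nat \<Rightarrow> ('v::finite \<Rightarrow> nat) \<Rightarrow> 'a::field"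
  assumes full: "full m l (tang m (\<lambda>i. Mps (A i)))"
  shows "finite_codim m (tangent_ext m A)"
proof -
  define I where "I = {..<m} \<times> {\<alpha> :: 'v \<Rightarrow> nat. mdeg \<alpha> < l}"
  define b :: "nat \<times> ('v \<Rightarrow> nat) \<Rightarrow> nat \<Rightarrow> ('v \<Rightarrow> nat) \<Rightarrow> 'a"
    where "b = (\<lambda>(k, \<alpha>) i \<beta>. if i = k \<and> \<beta> = \<alpha> then 1 else 0)"
  have finI: "finite I" by (simp add: I_def)
  have inj: "inj b"
  proof (rule injI)
    fix x y assume "b x = b y"
    then have "b x (fst x) (snd x) = b y (fst x) (snd x)" by simp
    then show "x = y" by (auto simp: b_def split: prod.splits if_splits)
  qed
  have "spans_mod m (tangent_ext m A) (b ` I)"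
    unfolding spans_mod_def
  proof (intro conjI allI)
    fix w :: "nat \<Rightarrow> ('v \<Rightarrow> nat) \<Rightarrow> 'a"
    \<comment> \<open>\<open>spans_mod\<close> indexes coefficients by the spanning vectors
      themselves, so component and exponent are recovered through the inverse of
      \<open>b\<close>.\<close>
    define a where "a = (\<lambda>x. case inv b x of (k, \<alpha>) \<Rightarrow> w k \<alpha>)"
    have sum: "(\<Sum>x\<in>b ` I. a x * x i \<beta>) = (if mdeg \<beta> < l then w i \<beta> else 0)" if "i < m" for i \<beta>
    proof -
      have "(\<Sum>x\<in>b ` I. a x * x i \<beta>) = (\<Sum>x\<in>I. a (b x) * b x i \<beta>)"
        by (rule sum.reindex_cong[OF inj_on_subset[OF inj]]) auto
      also have "\<dots> = (\<Sum>x\<in>I. if x = (i, \<beta>) then w i \<beta> else 0)"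
      proof (intro sum.cong refl)
        fix x
        have "a (b x) = w (fst x) (snd x)"
          by (simp add: a_def inv_f_f[OF inj] split_beta)
        moreover have "b x i \<beta> = (if x = (i, \<beta>) then 1 else 0)"
          by (auto simp: b_def split: prod.split)
        ultimately show "a (b x) * b x i \<beta> = (if x = (i, \<beta>) then w i \<beta> else 0)"
          by simp
      qed
      also have "\<dots> = (if mdeg \<beta> < l then w i \<beta> else 0)"
        using finI that by (simp add: sum.delta I_def)
      finally show ?thesis .
    qed
    define t where "t = (\<lambda>i \<beta>. w i \<beta> - (\<Sum>x\<in>b ` I. a x * x i \<beta>))"
    have "\<forall>k<m. Mps (t k) \<in> mp l"
      by (auto simp: mp_iff t_def sum)
    then have "t \<in> tangent_ext m A"
      unfolding tangent_ext_iff using full unfolding full_def by simp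
    moreover have "w i = ps_add (ps_sum (\<lambda>b. ps_scale (a b) (b i)) (b ` I)) (t i)" for i
      unfolding t_def ps_add_def ps_sum_def ps_scale_def
      by (simp only: add_diff_eq add_diff_cancel_left')
    ultimately show "\<exists>a. \<exists>t\<in>tangent_ext m A. \<forall>i<m.
        w i = ps_add (ps_sum (\<lambda>b. ps_scale (a b) (b i)) (b ` I)) (t i)"
      by blast
  qed (simp add: finI)
  then show ?thesis unfolding finite_codim_def by blast
qed

section \<open>Equivalent vectors have equivalent tangent images\<close>

lemma matrix_cancel:
  fixes U W :: "nat \<Rightarrow> nat \<Rightarrow> 'r::comm_ring_1"
  assumes "\<And>i j. i < m \<Longrightarrow> j < m \<Longrightarrow> (\<Sum>k<m. U i k * W k j) = (if i = j then 1 else 0)" and "i < m"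
  shows "(\<Sum>k<m. U i k * (\<Sum>j<m. W k j * z j)) = z i"
proof -
  have "(\<Sum>k<m. U i k * (\<Sum>j<m. W k j * z j)) = (\<Sum>j<m. (\<Sum>k<m. U i k * W k j) * z j)"
    unfolding sum_distrib_left sum_distrib_right by (subst sum.swap) (simp add: mult.assoc)
  also have "\<dots> = (\<Sum>j<m. if j = i then z i else 0)"
    by (intro sum.cong refl) (auto simp: assms)
  finally show ?thesis using assms(2) by (simp add: sum.delta)
qed

text \<open>U \<phi>(T_A) is a submodule because \<phi> is onto, and it contains the generators of
  T_B: by the product and chain rules, derivatives of U and u contribute only multiples of the
  \<phi>(A_j), and the rest is U applied to \<phi> of Jacobian columns. If w has order l, then so
  has U \<phi>(w), which thus lies in T_B and in U \<phi>(T_A); cancelling U and \<phi> gives w in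
  T_A.\<close>

lemma full_tang_transfer:
  fixes A B :: "nat \<Rightarrow> ('v::{finite,linorder}, 'a::field) mps"
  assumes UW: "\<And>i j. i < m \<Longrightarrow> j < m \<Longrightarrow> (\<Sum>k<m. U i k * W k j) = (if i = j then 1 else 0)"
    and WU: "\<And>i j. i < m \<Longrightarrow> j < m \<Longrightarrow> (\<Sum>k<m. W i k * U k j) = (if i = j then 1 else 0)"
    and \<phi>: "\<And>v. \<phi> v \<in> mp 1" and bij: "bij (subst \<phi>)"
    and B: "\<And>i. i < m \<Longrightarrow> B i = (\<Sum>k<m. U i k * subst \<phi> (A k)) * u"
    and full: "full m l (tang m B)"
  shows "full m l (tang m A)"
proof -
  define Z where "Z = {w. \<exists>t\<in>tang m A. \<forall>k<m. w k = subst \<phi> (t k)}"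
  define Y where "Y = {w. \<exists>z\<in>Z. \<forall>k<m. w k = (\<Sum>j<m. U k j * z j)}"
  have ZI: "w \<in> Z" if "t \<in> tang m A" "\<And>k. k < m \<Longrightarrow> w k = subst \<phi> (t k)" for t w
    using that unfolding Z_def by blast
  have YI: "w \<in> Y" if "z \<in> Z" "\<And>k. k < m \<Longrightarrow> w k = (\<Sum>j<m. U k j * z j)" for z w
    using that unfolding Y_def by blast
  note T = submod_tang[of m A]
  have Z: "submod m Z"
  proof (rule submodI)
    show "(\<lambda>_. 0) \<in> Z" by (rule ZI[OF submod_0[OF T]]) simp
  next
    fix w w' assume "w \<in> Z" "w' \<in> Z"
    then obtain t t' where "t \<in> tang m A" "t' \<in> tang m A"
      and "\<And>k. k < m \<Longrightarrow> w k = subst \<phi> (t k)" "\<And>k. k < m \<Longrightarrow> w' k = subst \<phi> (t' k)"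
      unfolding Z_def by blast
    then show "(\<lambda>k. w k + w' k) \<in> Z"
      by (intro ZI[OF submod_add[OF T]]) (simp_all add: subst_add)
  next
    fix r w assume "w \<in> Z"
    then obtain t where t: "t \<in> tang m A" "\<And>k. k < m \<Longrightarrow> w k = subst \<phi> (t k)"
      unfolding Z_def by blast
    obtain s where "r = subst \<phi> s" using bij by (metis bij_pointE)
    with t show "(\<lambda>k. r * w k) \<in> Z"
      by (intro ZI[OF submod_scale[OF T, of t s]]) (simp_all add: subst_mult[OF \<phi>])
  next
    fix w w' :: "nat \<Rightarrow> ('v, 'a) mps" assume "w \<in> Z" "\<And>k. k < m \<Longrightarrow> w' k = w k"
    then show "w' \<in> Z" unfolding Z_def by auto
  qed
  have Y: "submod m Y"
  proof (rule submodI)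
    show "(\<lambda>_. 0) \<in> Y" by (rule YI[OF submod_0[OF Z]]) simp
  next
    fix w w' assume "w \<in> Y" "w' \<in> Y"
    then obtain z z' where "z \<in> Z" "z' \<in> Z"
      and "\<And>k. k < m \<Longrightarrow> w k = (\<Sum>j<m. U k j * z j)" "\<And>k. k < m \<Longrightarrow> w' k = (\<Sum>j<m. U k j * z' j)"
      unfolding Y_def by blast
    then show "(\<lambda>k. w k + w' k) \<in> Y"
      by (intro YI[OF submod_add[OF Z]]) (simp_all add: distrib_left sum.distrib)
  next
    fix r w assume "w \<in> Y"
    then obtain z where "z \<in> Z" "\<And>k. k < m \<Longrightarrow> w k = (\<Sum>j<m. U k j * z j)"
      unfolding Y_def by blast
    then show "(\<lambda>k. r * w k) \<in> Y"
      by (intro YI[OF submod_scale[OF Z, of z r]]) (simp_all add: sum_distrib_left mult.left_commute)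
  next
    fix w w' :: "nat \<Rightarrow> ('v, 'a) mps" assume "w \<in> Y" "\<And>k. k < m \<Longrightarrow> w' k = w k"
    then show "w' \<in> Y" unfolding Y_def by auto
  qed
  have unitZ: "unitv k (subst \<phi> (A j)) \<in> Z" if "j < m" for j k
    by (rule ZI[OF tang_unitv[OF that, of k]]) (simp add: unitv_def)
  \<comment> \<open>U maps column k of W to the k-th unit vector, and multiples of \<phi>(A_j) in
    any component already belong to Z.\<close>
  have unitY: "unitv k (subst \<phi> (A j)) \<in> Y" if "j < m" "k < m" for j k
  proof (rule YI)
    show "(\<lambda>i. \<Sum>l\<in>{()}. W i k * subst \<phi> (A j)) \<in> Z"
      by (rule submod_units[OF Z]) (rule unitZ[OF that(1)])
    show "unitv k (subst \<phi> (A j)) i = (\<Sum>l<m. U i l * (\<Sum>_\<in>{()}. W l k * subst \<phi> (A j)))" if "i < m" for i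
      using UW[OF that \<open>k < m\<close>]
      by (simp add: unitv_def mult.assoc[symmetric] sum_distrib_right[symmetric])
  qed
  have combY: "(\<lambda>k. \<Sum>j<m. c k j * subst \<phi> (A j)) \<in> Y" for c
    by (rule submod_units[OF Y]) (auto intro: unitY)
  have "tang m B \<subseteq> Y"
  proof (rule tang_least[OF Y])
    fix i k assume ik: "i < m" "k < m"
    have "(\<lambda>k'. \<Sum>j<m. (if k' = k then U i j * u else 0) * subst \<phi> (A j)) \<in> Y"
      by (rule combY)
    then show "unitv k (B i) \<in> Y"
      by (rule submod_cong[OF Y]) (auto simp: unitv_def B ik sum_distrib_left ac_simps)
  next
    fix v
    have 1: "(\<lambda>k. \<Sum>j<m. (pd v (U k j) * u + U k j * pd v u) * subst \<phi> (A j)) \<in> Y"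
      by (rule combY)
    have "(\<lambda>j. \<Sum>i\<in>UNIV. pd v (\<phi> i) * u * subst \<phi> (pd i (A j))) \<in> Z"
      by (rule submod_lincomb[OF Z]) (rule ZI[OF tang_pd refl])
    then have 2: "(\<lambda>k. \<Sum>j<m. U k j * (\<Sum>i\<in>UNIV. pd v (\<phi> i) * u * subst \<phi> (pd i (A j)))) \<in> Y"
      by (rule YI) simp
    show "(\<lambda>k. pd v (B k)) \<in> Y"
    proof (rule submod_cong[OF Y submod_add[OF Y 1 2]])
      fix k assume "k < m"
      have "pd v (B k) = (\<Sum>j<m. pd v (U k j * subst \<phi> (A j) * u))"
        unfolding B[OF \<open>k < m\<close>] by (simp add: sum_distrib_right pd_sum)
      also have "\<dots> = (\<Sum>j<m. (pd v (U k j) * u + U k j * pd v u) * subst \<phi> (A j)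
          + U k j * (\<Sum>i\<in>UNIV. pd v (\<phi> i) * u * subst \<phi> (pd i (A j))))"
        by (intro sum.cong refl)
          (simp add: pd_mult pd_subst[OF \<phi>] algebra_simps sum_distrib_left)
      finally show "pd v (B k) = (\<Sum>j<m. (pd v (U k j) * u + U k j * pd v u) * subst \<phi> (A j))
          + (\<Sum>j<m. U k j * (\<Sum>i\<in>UNIV. pd v (\<phi> i) * u * subst \<phi> (pd i (A j))))"
        by (simp add: sum.distrib)
    qed
  qed
  show ?thesis
    unfolding full_def
  proof (intro allI impI)
    fix w :: "nat \<Rightarrow> ('v, 'a) mps" assume w: "\<forall>k<m. w k \<in> mp l"
    have "(\<lambda>k. \<Sum>j<m. U k j * subst \<phi> (w j)) \<in> tang m B"
      using w by (intro fullD[OF full] mp_sum mp_multr subst_mp) auto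
    with \<open>tang m B \<subseteq> Y\<close> obtain z where z: "z \<in> Z"
      and eq: "\<And>k. k < m \<Longrightarrow> (\<Sum>j<m. U k j * subst \<phi> (w j)) = (\<Sum>j<m. U k j * z j)"
      unfolding Y_def by blast
    from z obtain t where t: "t \<in> tang m A" "\<And>k. k < m \<Longrightarrow> z k = subst \<phi> (t k)"
      unfolding Z_def by blast
    show "w \<in> tang m A"
    proof (rule submod_cong[OF T t(1)])
      fix k assume k: "k < m"
      have "subst \<phi> (w k) = (\<Sum>i<m. W k i * (\<Sum>j<m. U i j * subst \<phi> (w j)))"
        by (rule matrix_cancel[OF WU k, symmetric])
      also have "\<dots> = (\<Sum>i<m. W k i * (\<Sum>j<m. U i j * z j))"
        by (simp add: eq)
      also have "\<dots> = z k"
        by (rule matrix_cancel[OF WU k])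
      finally have "subst \<phi> (w k) = subst \<phi> (t k)"
        using t(2) k by simp
      then show "w k = t k"
        using bij by (simp add: bij_def inj_eq)
    qed
  qed
qed

lemma subst_Mps: "subst (\<lambda>v. Mps (\<phi> v)) (Mps f) = Mps (ps_subst \<phi> f)"
  by (simp add: subst_def)

lemma bij_subst_iff: "bij (subst (\<lambda>v. Mps (\<phi> v))) \<longleftrightarrow> bij (ps_subst \<phi>)"
proof -
  have "bij Mps" "bij coeff"
    by (auto intro: bij_betw_byWitness[where f' = coeff] bij_betw_byWitness[where f' = Mps])
  moreover have "subst (\<lambda>v. Mps (\<phi> v)) = Mps \<circ> ps_subst \<phi> \<circ> coeff"
    by (simp add: fun_eq_iff subst_def)
  moreover have "ps_subst \<phi> = coeff \<circ> subst (\<lambda>v. Mps (\<phi> v)) \<circ> Mps"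
    by (simp add: fun_eq_iff subst_def)
  ultimately show ?thesis
    by (metis bij_comp)
qed

lemma in_max_ideal_iff: "in_max_ideal f \<longleftrightarrow> Mps f \<in> mp 1"
  by (auto simp: in_max_ideal_def mp_iff zero_fun_def)

lemma mat_mult_Mps:
  "mat_mult m U W i j = (if i = j then ps_one else ps_zero) \<longleftrightarrow>
    (\<Sum>k<m. Mps (U i k) * Mps (W k j)) = (if i = j then 1 else 0)"
  by (simp add: mat_mult_def Mps_inject_iff Mps_simps)

lemma G_equiv_full:
  assumes G: "G_equiv m A B" and full: "full m l (tang m (\<lambda>i. Mps (B i)))"
  shows "full m l (tang m (\<lambda>i. Mps (A i)))"
proof -
  obtain U u \<phi> where "in_GL m U" and \<phi>: "is_aut \<phi>"
    and B: "\<And>i. i < m \<Longrightarrow> B i = ps_mult (mat_vec m U (\<lambda>k. ps_subst \<phi> (A k)) i) u"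
    using G unfolding G_equiv_def by blast
  then obtain W where W: "\<forall>i<m. \<forall>j<m. mat_mult m U W i j = (if i = j then ps_one else ps_zero) \<and>
      mat_mult m W U i j = (if i = j then ps_one else ps_zero)"
    unfolding in_GL_def by blast
  show ?thesis
  proof (rule full_tang_transfer[OF _ _ _ _ _ full])
    show "bij (subst (\<lambda>v. Mps (\<phi> v)))" "\<And>v. Mps (\<phi> v) \<in> mp 1"
      using \<phi> by (simp_all add: is_aut_def bij_subst_iff in_max_ideal_iff)
    show "Mps (B i) = (\<Sum>k<m. Mps (U i k) * subst (\<lambda>v. Mps (\<phi> v)) (Mps (A k))) * Mps u" if "i < m" for i
      by (simp add: B[OF that] Mps_simps mat_vec_def subst_Mps)
    show "(\<Sum>k<m. Mps (U i k) * Mps (W k j)) = (if i = j then 1 else 0)"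
      "(\<Sum>k<m. Mps (W i k) * Mps (U k j)) = (if i = j then 1 else 0)" if "i < m" "j < m" for i j
      using W that unfolding mat_mult_Mps by blast+
  qed
qed

section \<open>Finite codimension implies finite determinacy\<close>

lemma choice_pair: "(\<And>x. \<exists>a b. P x a b) \<Longrightarrow> \<exists>f g. \<forall>x. P x (f x) (g x)"
  by metis

lemma choice_pair2: "(\<And>x y. \<exists>a b. P x y a b) \<Longrightarrow> \<exists>f g. \<forall>x y. P x y (f x y) (g x y)"
  by metis

text \<open>Gaussian elimination: a pivot j0 clears the coordinate b in the other vectors, and a
  relation among these determines the coefficient of j0. It is stated for families, so that vectors
  may repeat; it serves both the argument on d + 1 vectors modulo T and the counting of
  monomials.\<close>

lemma linear_relation:
  fixes a :: "'i \<Rightarrow> 'b \<Rightarrow> 'a::field"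
  assumes "finite B" "finite J" "card B < card J"
  shows "\<exists>c. (\<exists>j\<in>J. c j \<noteq> 0) \<and> (\<forall>b\<in>B. (\<Sum>j\<in>J. c j * a j b) = 0)"
  using assms
proof (induction B arbitrary: J a rule: finite_induct)
  case empty
  then have "\<exists>j. j \<in> J" by (metis card.empty ex_in_conv less_irrefl)
  then show ?case by (intro exI[of _ "\<lambda>_. 1"]) auto
next
  case (insert b B)
  show ?case
  proof (cases "\<forall>j\<in>J. a j b = 0")
    case True
    then show ?thesis
      using insert.IH[of J a] insert.prems insert.hyps by auto
  next
    case False
    then obtain j0 where j0: "j0 \<in> J" "a j0 b \<noteq> 0" by blast
    let ?J = "J - {j0}"
    let ?a = "\<lambda>j x. a j x - a j b / a j0 b * a j0 x"
    have "finite ?J" "card B < card ?J"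
      using insert.prems insert.hyps j0 by auto
    then obtain c where c: "\<exists>j\<in>?J. c j \<noteq> 0" "\<And>x. x \<in> B \<Longrightarrow> (\<Sum>j\<in>?J. c j * ?a j x) = 0"
      using insert.IH[of ?J ?a] by blast
    define c' where "c' = c(j0 := - (\<Sum>j\<in>?J. c j * a j b / a j0 b))"
    have sum: "(\<Sum>j\<in>J. c' j * a j x) = (\<Sum>j\<in>?J. c j * ?a j x)" for x
    proof -
      have "(\<Sum>j\<in>J. c' j * a j x) = c' j0 * a j0 x + (\<Sum>j\<in>?J. c' j * a j x)"
        using insert.prems(1) j0(1) by (rule sum.remove)
      also have "(\<Sum>j\<in>?J. c' j * a j x) = (\<Sum>j\<in>?J. c j * a j x)"
        by (intro sum.cong) (auto simp: c'_def)
      also have "c' j0 * a j0 x = - (\<Sum>j\<in>?J. c j * (a j b / a j0 b * a j0 x))"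
        by (simp add: c'_def sum_distrib_right mult.assoc)
      finally show ?thesis
        by (simp add: right_diff_distrib sum_subtractf)
    qed
    have "(\<Sum>j\<in>J. c' j * a j x) = 0" if "x \<in> insert b B" for x
      unfolding sum using that c(2) j0(2) by auto
    moreover have "\<exists>j\<in>J. c' j \<noteq> 0"
      using c(1) by (auto simp: c'_def)
    ultimately show ?thesis by blast
  qed
qed

text \<open>If every level j \<le> d failed, take for each a vector w_j in m^j R^m outside T +
  m^(j+1) R^m. Some nontrivial combination of these d + 1 vectors lies in T; dividing by its first
  nonzero coefficient, at j0, puts w_j0 into T + m^(j0+1) R^m.\<close>

lemma spans_mod_stable:
  fixes A :: "nat \<Rightarrow> ('v::finite \<Rightarrow> nat) \<Rightarrow> 'a::field"
  assumes span: "spans_mod m (tangent_ext m A) B"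
  obtains j where "j \<le> card B"
    "\<And>w. (\<And>k. k < m \<Longrightarrow> w k \<in> mp j) \<Longrightarrow>
      \<exists>t\<in>tang m (\<lambda>i. Mps (A i)). \<forall>k<m. w k - t k \<in> mp (Suc j)"
proof -
  let ?T = "tang m (\<lambda>i. Mps (A i))"
  note T = submod_tang[of m "\<lambda>i. Mps (A i)"]
  have "\<exists>j\<le>card B. \<forall>w. (\<forall>k<m. w k \<in> mp j) \<longrightarrow> (\<exists>t\<in>?T. \<forall>k<m. w k - t k \<in> mp (Suc j))"
  proof (rule ccontr)
    assume "\<not> ?thesis"
    then have "\<forall>j. \<exists>w. j \<le> card B \<longrightarrow>
        (\<forall>k<m. w k \<in> mp j) \<and> \<not> (\<exists>t\<in>?T. \<forall>k<m. w k - t k \<in> mp (Suc j))"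
      by blast
    then obtain w where w: "\<And>j k. j \<le> card B \<Longrightarrow> k < m \<Longrightarrow> w j k \<in> mp j"
      and not: "\<And>j t. j \<le> card B \<Longrightarrow> t \<in> ?T \<Longrightarrow> \<not> (\<forall>k<m. w j k - t k \<in> mp (Suc j))"
      by metis
    have at: "\<exists>a t. t \<in> tangent_ext m A \<and> (\<forall>i<m. coeff (w j i) =
        ps_add (ps_sum (\<lambda>b. ps_scale (a b) (b i)) B) (t i))" for j
      using span[unfolded spans_mod_def, THEN conjunct2, THEN spec, of "\<lambda>i. coeff (w j i)"] by blast
    define P where "P j a t \<longleftrightarrow> t \<in> tangent_ext m A \<and> (\<forall>i<m. coeff (w j i) =
        ps_add (ps_sum (\<lambda>b. ps_scale (a b) (b i)) B) (t i))" for j a t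
    obtain a t where "\<And>j. P j (a j) (t j)"
      using choice_pair[of P] at unfolding P_def by blast
    then have t: "\<And>j. t j \<in> tangent_ext m A"
      and eq: "\<And>j i. i < m \<Longrightarrow> coeff (w j i) =
        ps_add (ps_sum (\<lambda>b. ps_scale (a j b) (b i)) B) (t j i)"
      unfolding P_def by blast+
    have "finite B" using span unfolding spans_mod_def by blast
    then obtain c where c: "\<exists>j\<in>{..card B}. c j \<noteq> 0"
      and rel: "\<And>b. b \<in> B \<Longrightarrow> (\<Sum>j\<in>{..card B}. c j * a j b) = 0"
      using linear_relation[of B "{..card B}" a] by auto
    have sum: "(\<Sum>j\<le>card B. const (c j) * w j i) = (\<Sum>j\<le>card B. const (c j) * Mps (t j i))"
      if "i < m" for i
    proof (rule mps_eqI)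
      fix \<alpha>
      have "coeff (\<Sum>j\<le>card B. const (c j) * w j i) \<alpha>
        = (\<Sum>j\<le>card B. \<Sum>b\<in>B. c j * a j b * b i \<alpha>) + (\<Sum>j\<le>card B. c j * t j i \<alpha>)"
        by (simp add: coeff_sum eq[OF that] ps_add_def ps_sum_def ps_scale_def distrib_left
            sum.distrib sum_distrib_left mult.assoc)
      also have "(\<Sum>j\<le>card B. \<Sum>b\<in>B. c j * a j b * b i \<alpha>)
        = (\<Sum>b\<in>B. (\<Sum>j\<le>card B. c j * a j b) * b i \<alpha>)"
        unfolding sum_distrib_right by (rule sum.swap)
      also have "\<dots> = 0" by (simp add: rel)
      finally show "coeff (\<Sum>j\<le>card B. const (c j) * w j i) \<alpha>
        = coeff (\<Sum>j\<le>card B. const (c j) * Mps (t j i)) \<alpha>"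
        by (simp add: coeff_sum)
    qed
    \<comment> \<open>With the least such index, all remaining terms have order at least j0 +
      1.\<close>
    define j0 where "j0 = (LEAST j. j \<le> card B \<and> c j \<noteq> 0)"
    have j0: "j0 \<le> card B" "c j0 \<noteq> 0"
      using LeastI_ex[of "\<lambda>j. j \<le> card B \<and> c j \<noteq> 0"] c unfolding j0_def by auto
    have less: "c j = 0" if "j < j0" for j
      using not_less_Least[of j "\<lambda>j. j \<le> card B \<and> c j \<noteq> 0"] that j0(1) unfolding j0_def by auto
    define t' where "t' = (\<lambda>i. const (inverse (c j0)) * (\<Sum>j\<le>card B. const (c j) * Mps (t j i)))"
    have "t' \<in> ?T"
      unfolding t'_def using t
      by (intro submod_scale[OF T] submod_lincomb[OF T]) (auto simp: tangent_ext_iff)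
    moreover have "w j0 i - t' i \<in> mp (Suc j0)" if "i < m" for i
    proof -
      have inv: "const (inverse (c j0)) * const (c j0) = 1"
        using j0(2) by (simp add: const_mult[symmetric])
      have "(\<Sum>j\<le>card B. const (c j) * w j i)
          = const (c j0) * w j0 i + (\<Sum>j\<in>{..card B} - {j0}. const (c j) * w j i)"
        using j0(1) by (intro sum.remove) auto
      then have "t' i = w j0 i + const (inverse (c j0)) * (\<Sum>j\<in>{..card B} - {j0}. const (c j) * w j i)"
        unfolding t'_def sum[OF that, symmetric]
        by (simp add: distrib_left mult.assoc[symmetric] inv)
      then have "w j0 i - t' i = - (const (inverse (c j0)) *
          (\<Sum>j\<in>{..card B} - {j0}. const (c j) * w j i))"
        by simp
      moreover have "const (c j) * w j i \<in> mp (Suc j0)" if "j \<in> {..card B} - {j0}" for j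
      proof (cases "j < j0")
        case False
        then show ?thesis
          using that mp_mono[OF w[of j i], of "Suc j0"] \<open>i < m\<close> by (auto intro: mp_multr)
      qed (simp add: less)
      ultimately show ?thesis
        by (simp only: mp_uminus mp_multr mp_sum)
    qed
    ultimately show False using not[OF j0(1)] by blast
  qed
  with that show thesis by blast
qed

text \<open>Approximating the finitely many vectors x^\<beta> e_k with \<beta> of degree j is
  enough: w is a combination of them with coefficients in m^p, and the same coefficients multiply
  the approximations. So \<open>c\<close> and \<open>g\<close> themselves have order p, not merely
  the vector they produce.\<close>

lemma tang_approx:
  fixes A :: "nat \<Rightarrow> ('v::finite, 'a::field) mps"
  assumes stable: "\<And>w. (\<And>k. k < m \<Longrightarrow> w k \<in> mp j) \<Longrightarrow> \<exists>t\<in>tang m A. \<forall>k<m. w k - t k \<in> mp (Suc j)"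
    and w: "\<And>k. k < m \<Longrightarrow> w k \<in> mp (j + p)"
  obtains c g where "\<And>k i. c k i \<in> mp p" "\<And>v. g v \<in> mp p"
    "\<And>k. k < m \<Longrightarrow> w k - ((\<Sum>i<m. c k i * A i) + (\<Sum>v\<in>UNIV. g v * pd v (A k))) \<in> mp (Suc (j + p))"
proof -
  let ?I = "{..<m} \<times> {\<beta> :: 'v \<Rightarrow> nat. mdeg \<beta> = j}"
  have "\<exists>h. (k < m \<longrightarrow> w k = (\<Sum>\<beta>\<in>{\<beta>. mdeg \<beta> = j}. xmon \<beta> * h \<beta>)) \<and> (\<forall>\<beta>. h \<beta> \<in> mp p)" for k
  proof (cases "k < m")
    case True
    obtain h where "w k = (\<Sum>\<beta>\<in>{\<beta>. mdeg \<beta> = j}. xmon \<beta> * h \<beta>)" "\<And>\<beta>. h \<beta> \<in> mp p"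
      by (rule mp_decompose[OF w[OF True]]) blast
    then show ?thesis by blast
  next
    case False
    then show ?thesis by (intro exI[of _ "\<lambda>_. 0"]) simp
  qed
  then obtain h where h: "\<And>k. k < m \<Longrightarrow> w k = (\<Sum>\<beta>\<in>{\<beta>. mdeg \<beta> = j}. xmon \<beta> * h k \<beta>)"
    and hp: "\<And>k \<beta>. h k \<beta> \<in> mp p"
    by metis
  have ex: "\<exists>c g. mdeg \<beta> = j \<longrightarrow> (\<forall>k'<m. unitv k (xmon \<beta>) k'
      - ((\<Sum>i<m. c k' i * A i) + (\<Sum>v\<in>UNIV. g v * pd v (A k'))) \<in> mp (Suc j))" for k \<beta>
  proof (cases "mdeg \<beta> = j")
    case True
    then have "\<exists>t\<in>tang m A. \<forall>k'<m. unitv k (xmon \<beta>) k' - t k' \<in> mp (Suc j)"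
      by (intro stable) (auto simp: unitv_def intro: xmon_mp)
    then obtain t where t: "t \<in> tang m A" "\<forall>k'<m. unitv k (xmon \<beta>) k' - t k' \<in> mp (Suc j)" by blast
    from t(1) obtain c g where "\<forall>k<m. t k = (\<Sum>i<m. c k i * A i) + (\<Sum>v\<in>UNIV. g v * pd v (A k))"
      unfolding tang_def by blast
    with t(2) show ?thesis by (intro exI[of _ c] exI[of _ g]) simp
  qed simp
  define P where "P k \<beta> c g \<longleftrightarrow> (mdeg \<beta> = j \<longrightarrow> (\<forall>k'<m. unitv k (xmon \<beta>) k'
      - ((\<Sum>i<m. c k' i * A i) + (\<Sum>v\<in>UNIV. g v * pd v (A k'))) \<in> mp (Suc j)))" for k \<beta> c g
  obtain c g where "\<And>k \<beta>. P k \<beta> (c k \<beta>) (g k \<beta>)"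
    using choice_pair2[of P] ex unfolding P_def by blast
  then have cg: "\<And>k \<beta> k'. mdeg \<beta> = j \<Longrightarrow> k' < m \<Longrightarrow> unitv k (xmon \<beta>) k'
      - ((\<Sum>i<m. c k \<beta> k' i * A i) + (\<Sum>v\<in>UNIV. g k \<beta> v * pd v (A k'))) \<in> mp (Suc j)"
    unfolding P_def by blast
  define c' where "c' = (\<lambda>k' i. \<Sum>(k,\<beta>)\<in>?I. h k \<beta> * c k \<beta> k' i)"
  define g' where "g' = (\<lambda>v. \<Sum>(k,\<beta>)\<in>?I. h k \<beta> * g k \<beta> v)"
  show thesis
  proof (rule that)
    show "c' k i \<in> mp p" "g' v \<in> mp p" for k i v
      unfolding c'_def g'_def by (auto intro!: mp_sum mp_multl hp)
    fix k' assume k': "k' < m"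
    have "w k' = (\<Sum>k<m. if k = k' then \<Sum>\<beta>\<in>{\<beta>. mdeg \<beta> = j}. xmon \<beta> * h k' \<beta> else 0)"
      using k' by (simp add: h)
    also have "\<dots> = (\<Sum>k<m. \<Sum>\<beta>\<in>{\<beta>. mdeg \<beta> = j}. h k \<beta> * unitv k (xmon \<beta>) k')"
      by (intro sum.cong refl) (auto simp: unitv_def mult.commute)
    finally have w': "w k' = (\<Sum>(k,\<beta>)\<in>?I. h k \<beta> * unitv k (xmon \<beta>) k')"
      by (simp add: sum.cartesian_product)
    have "(\<Sum>i<m. c' k' i * A i) = (\<Sum>(k,\<beta>)\<in>?I. h k \<beta> * (\<Sum>i<m. c k \<beta> k' i * A i))"
      unfolding c'_def sum_distrib_right sum_distrib_left
      by (subst sum.swap) (simp add: split_beta mult.assoc sum_distrib_left)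
    moreover have "(\<Sum>v\<in>UNIV. g' v * pd v (A k'))
        = (\<Sum>(k,\<beta>)\<in>?I. h k \<beta> * (\<Sum>v\<in>UNIV. g k \<beta> v * pd v (A k')))"
      unfolding g'_def sum_distrib_right sum_distrib_left
      by (subst sum.swap) (simp add: split_beta mult.assoc sum_distrib_left)
    ultimately have eq: "w k' - ((\<Sum>i<m. c' k' i * A i) + (\<Sum>v\<in>UNIV. g' v * pd v (A k')))
      = (\<Sum>(k,\<beta>)\<in>?I. h k \<beta> * (unitv k (xmon \<beta>) k'
      - ((\<Sum>i<m. c k \<beta> k' i * A i) + (\<Sum>v\<in>UNIV. g k \<beta> v * pd v (A k')))))"
      unfolding w' by (simp add: split_beta sum_subtractf sum.distrib right_diff_distrib distrib_left)
    show "w k' - ((\<Sum>i<m. c' k' i * A i) + (\<Sum>v\<in>UNIV. g' v * pd v (A k'))) \<in> mp (Suc (j + p))"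
      unfolding eq
    proof (intro mp_sum, clarsimp)
      fix k and \<beta> :: "'v \<Rightarrow> nat" assume "j = mdeg \<beta>"
      then show "h k \<beta> * (unitv k (xmon \<beta>) k' - ((\<Sum>i<m. c k \<beta> k' i * A i)
          + (\<Sum>v\<in>UNIV. g k \<beta> v * pd v (A k')))) \<in> mp (Suc (mdeg \<beta> + p))"
        using mp_mult[OF hp[of k \<beta>] cg[of \<beta> k' k]] k' by (simp add: add.commute)
    qed
  qed
qed

text \<open>Each column of a right inverse is the fixed point of w = e_j - C w. Doing the same for
  the transpose yields a left inverse, and the two coincide.\<close>

lemma matrix_inverse_near_id:
  fixes C :: "nat \<Rightarrow> nat \<Rightarrow> ('v::finite, 'a::field) mps"
  assumes C: "\<And>i j. C i j \<in> mp 1"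
  defines "U \<equiv> \<lambda>i j. (if i = j then 1 else 0) + C i j"
  obtains W where "\<And>i j. i < m \<Longrightarrow> j < m \<Longrightarrow> (\<Sum>k<m. U i k * W k j) = (if i = j then 1 else 0)"
    "\<And>i j. i < m \<Longrightarrow> j < m \<Longrightarrow> (\<Sum>k<m. W i k * U k j) = (if i = j then 1 else 0)"
proof -
  have right: "\<exists>W. \<forall>i<m. \<forall>j. (\<Sum>k<m. ((if i = k then 1 else 0) + D i k) * W k j) = (if i = j then 1 else 0)"
    if D: "\<And>i j. D i j \<in> mp 1" for D :: "nat \<Rightarrow> nat \<Rightarrow> ('v, 'a) mps"
  proof -
    have "\<exists>w. \<forall>i<m. (\<Sum>k<m. ((if i = k then 1 else 0) + D i k) * w k) = (if i = j then 1 else 0)" for j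
    proof -
      have "(if i = j then 1 else 0) - (\<Sum>k<m. D i k * w k)
          - ((if i = j then 1 else 0) - (\<Sum>k<m. D i k * w' k)) \<in> mp (Suc n)"
        if "\<And>i. w i - w' i \<in> mp n" for w w' :: "nat \<Rightarrow> ('v, 'a) mps" and n i
      proof -
        have "(if i = j then 1 else 0) - (\<Sum>k<m. D i k * w k)
          - ((if i = j then 1 else 0) - (\<Sum>k<m. D i k * w' k)) = - (\<Sum>k<m. D i k * (w k - w' k))"
          by (simp add: right_diff_distrib sum_subtractf)
        moreover have "- (\<Sum>k<m. D i k * (w k - w' k)) \<in> mp (Suc n)"
          using mp_mult[OF D that] by (intro mp_uminus mp_sum) simp
        ultimately show ?thesis by simp
      qed
      then obtain w where w: "(\<lambda>i. (if i = j then 1 else 0) - (\<Sum>k<m. D i k * w k)) = w"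
        by (rule contraction_fixpoint[of "\<lambda>w i. (if i = j then 1 else 0) - (\<Sum>k<m. D i k * w k)"])
      have "(\<Sum>k<m. ((if i = k then 1 else 0) + D i k) * w k) = (if i = j then 1 else 0)" if "i < m" for i
      proof -
        have "(\<Sum>k<m. ((if i = k then 1 else 0) + D i k) * w k)
           = (\<Sum>k<m. (if k = i then w i else 0)) + (\<Sum>k<m. D i k * w k)"
          unfolding sum.distrib[symmetric] by (intro sum.cong refl) (auto simp: distrib_right)
        also have "\<dots> = w i + (\<Sum>k<m. D i k * w k)"
          using that by simp
        finally show ?thesis using fun_cong[OF w, of i] by (simp add: algebra_simps)
      qed
      then show ?thesis by blast
    qed
    then have "\<exists>W. \<forall>j. \<forall>i<m. (\<Sum>k<m. ((if i = k then 1 else 0) + D i k) * W j k) = (if i = j then 1 else 0)"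
      by (intro choice allI)
    then obtain W where "\<forall>j. \<forall>i<m. (\<Sum>k<m. ((if i = k then 1 else 0) + D i k) * W j k) = (if i = j then 1 else 0)"
      by blast
    then show ?thesis by (intro exI[of _ "\<lambda>k j. W j k"]) simp
  qed
  obtain W where W0: "\<forall>i<m. \<forall>j. (\<Sum>k<m. ((if i = k then 1 else 0) + C i k) * W k j) = (if i = j then 1 else 0)"
    using right[of C, OF C] by (elim exE)
  then have W: "\<And>i j. i < m \<Longrightarrow> (\<Sum>k<m. U i k * W k j) = (if i = j then 1 else 0)"
    unfolding U_def by simp
  \<comment> \<open>The transposed problem: \<open>V\<close> is the transpose of a left inverse of
    \<open>U\<close>.\<close>
  obtain V where V0: "\<And>i j. i < m \<Longrightarrow>
      (\<Sum>k<m. ((if i = k then 1 else 0) + C k i) * V k j) = (if i = j then 1 else 0)"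
    using right[of "\<lambda>i j. C j i"] C by blast
  have V: "(\<Sum>k<m. V k i * U k j) = (if i = j then 1 else 0)" if "j < m" for i j
  proof -
    have "(\<Sum>k<m. V k i * U k j) = (\<Sum>k<m. ((if j = k then 1 else 0) + C k j) * V k i)"
      unfolding U_def by (intro sum.cong refl) (auto simp: mult.commute)
    then show ?thesis using V0[OF that, of i] by auto
  qed
  have VW: "V i j = W j i" if "i < m" "j < m" for i j
  proof -
    have "W j i = (\<Sum>k<m. V k j * (\<Sum>l<m. U k l * W l i))"
      by (rule matrix_cancel[symmetric]) (use V that in auto)
    also have "\<dots> = (\<Sum>k<m. if k = i then V i j else 0)"
      by (intro sum.cong refl) (auto simp: W)
    finally show ?thesis using that by simp
  qed
  show thesis
  proof (rule that[OF W])
    show "(\<Sum>k<m. W i k * U k j) = (if i = j then 1 else 0)" if "i < m" "j < m" for i j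
      using V[OF that(2), of i] that by (simp add: VW)
  qed
qed

text \<open>One Newton step: all second order terms of \<open>(1 + C) A(x + \<xi>)\<close> gain one order because
  \<open>ord A - 2 + 2e = d + e + 1\<close>.\<close>

lemma newton_step:
  fixes A :: "nat \<Rightarrow> ('v::{finite,linorder}, 'a::field) mps"
  assumes stable: "\<And>w. (\<And>k. k < m \<Longrightarrow> w k \<in> mp j) \<Longrightarrow> \<exists>t\<in>tang m A. \<forall>k<m. w k - t k \<in> mp (Suc j)"
    and jd: "j \<le> d" and ord: "\<And>i. i < m \<Longrightarrow> A i \<in> mp n" and e: "2 \<le> e" "d + 3 = n + e"
    and c: "\<And>k i. c k i \<in> mp e" and x: "\<And>v. x v \<in> mp e"
    and B: "\<And>k. k < m \<Longrightarrow> B k - (subst (\<lambda>v. var v + x v) (A k)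
        + (\<Sum>i<m. c k i * subst (\<lambda>v. var v + x v) (A i))) \<in> mp (d + e + p)"
  obtains c' x' where "\<And>k i. c' k i - c k i \<in> mp (e + p)" "\<And>v. x' v - x v \<in> mp (e + p)"
    "\<And>k. k < m \<Longrightarrow> B k - (subst (\<lambda>v. var v + x' v) (A k)
        + (\<Sum>i<m. c' k i * subst (\<lambda>v. var v + x' v) (A i))) \<in> mp (d + e + Suc p)"
proof -
  let ?\<phi> = "\<lambda>v. var v + x v"
  let ?w = "\<lambda>k. B k - (subst ?\<phi> (A k) + (\<Sum>i<m. c k i * subst ?\<phi> (A i)))"
  \<comment> \<open>The stable level j may be below d. The surplus d - j first goes into the order
    of the corrections and is then given away in \<open>\<gamma>'\<close> and
    \<open>g'\<close>.\<close>
  have deg: "j + (d - j + e + p) = d + e + p" using jd by simp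
  obtain \<gamma> g where \<gamma>: "\<And>k i. \<gamma> k i \<in> mp (d - j + e + p)" and g: "\<And>v. g v \<in> mp (d - j + e + p)"
    and rest: "\<And>k. k < m \<Longrightarrow> ?w k - ((\<Sum>i<m. \<gamma> k i * A i) + (\<Sum>v\<in>UNIV. g v * pd v (A k)))
        \<in> mp (Suc (d + e + p))"
    by (rule tang_approx[OF stable, where w = ?w and p = "d - j + e + p", unfolded deg, OF _ B]) blast+
  have \<gamma>': "\<gamma> k i \<in> mp (e + p)" for k i by (rule mp_mono[OF \<gamma>]) simp
  have g': "g v \<in> mp (e + p)" for v by (rule mp_mono[OF g]) simp
  let ?\<psi> = "\<lambda>v. var v + (x v + g v)"
  have \<phi>1: "?\<phi> v \<in> mp 1" for v
    using mp_mono[OF x, of 1] e by (intro mp_add var_mp) auto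
  have \<psi>1: "?\<psi> v \<in> mp 1" for v
    using mp_mono[OF x, of 1] mp_mono[OF g', of 1] e by (intro mp_add var_mp) auto
  have xg: "x v + g v \<in> mp e" for v
    using x mp_mono[OF g'] by (intro mp_add) auto
  have taylor: "subst ?\<psi> f - subst ?\<phi> f - (\<Sum>v\<in>UNIV. g v * pd v f) \<in> mp (Suc (d + e + p))"
    if "f \<in> mp n" for f
    using subst_taylor_mp[of ?\<phi> e ?\<psi> "e + p" f n "Suc (d + e + p)"] x g' that e by simp
  have diff1: "subst ?\<psi> f - subst ?\<phi> f \<in> mp (n + e + p - 1)" if "f \<in> mp n" for f
    by (rule subst_diff_mp[of ?\<phi> ?\<psi> "e + p" f n]) (use \<phi>1 \<psi>1 g' that e in auto)
  have diff2: "subst ?\<psi> f - f \<in> mp (n + e - 1)" if "f \<in> mp n" for f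
  proof -
    have "?\<psi> v - var v \<in> mp e" for v using xg by simp
    from subst_diff_mp[where \<phi> = var and \<psi> = ?\<psi>, OF var_mp \<psi>1 this that, of "n + e - 1"] e
    show ?thesis by (simp add: subst_id)
  qed
  show thesis
  proof (rule that[of "\<lambda>k i. c k i + \<gamma> k i" "\<lambda>v. x v + g v"])
    fix k assume k: "k < m"
    \<comment> \<open>The four groups are the linear residue, the Taylor remainder, and two products
      of a small coefficient with a change of A. The second has order n - 2 + e + (e + p), exactly d
      + e + p + 1; the products have one order to spare.\<close>
    have eq: "B k - (subst ?\<psi> (A k) + (\<Sum>i<m. (c k i + \<gamma> k i) * subst ?\<psi> (A i)))
      = (?w k - ((\<Sum>i<m. \<gamma> k i * A i) + (\<Sum>v\<in>UNIV. g v * pd v (A k))))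
      - (subst ?\<psi> (A k) - subst ?\<phi> (A k) - (\<Sum>v\<in>UNIV. g v * pd v (A k)))
      - (\<Sum>i<m. c k i * (subst ?\<psi> (A i) - subst ?\<phi> (A i)))
      - (\<Sum>i<m. \<gamma> k i * (subst ?\<psi> (A i) - A i))"
      by (simp add: algebra_simps sum.distrib sum_subtractf)
    have "\<dots> \<in> mp (Suc (d + e + p))"
    proof (rule mp_diff[OF mp_diff[OF mp_diff[OF rest[OF k] taylor[OF ord[OF k]]]]]; rule mp_sum)
      fix i assume "i \<in> {..<m}"
      then have i: "A i \<in> mp n" using ord by simp
      show "c k i * (subst ?\<psi> (A i) - subst ?\<phi> (A i)) \<in> mp (Suc (d + e + p))"
        by (rule mp_mult'[OF c diff1[OF i]]) (use e in simp)
      show "\<gamma> k i * (subst ?\<psi> (A i) - A i) \<in> mp (Suc (d + e + p))"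
        by (rule mp_mult'[OF \<gamma>' diff2[OF i]]) (use e in simp)
    qed
    then show "B k - (subst ?\<psi> (A k) + (\<Sum>i<m. (c k i + \<gamma> k i) * subst ?\<psi> (A i)))
        \<in> mp (d + e + Suc p)"
      unfolding eq by (simp only: add_Suc_right)
  qed (use \<gamma>' g' in simp_all)
qed

text \<open>The corrections in step p have order e + p, so both unknowns converge; they stay in m^e,
  and continuity of substitution turns residues of growing order into an exact equation.\<close>

lemma newton_solution:
  fixes A :: "nat \<Rightarrow> ('v::{finite,linorder}, 'a::field) mps"
  assumes stable: "\<And>w. (\<And>k. k < m \<Longrightarrow> w k \<in> mp j) \<Longrightarrow> \<exists>t\<in>tang m A. \<forall>k<m. w k - t k \<in> mp (Suc j)"
    and jd: "j \<le> d" and ord: "\<And>i. i < m \<Longrightarrow> A i \<in> mp n" and e: "2 \<le> e" "d + 3 = n + e"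
    and B: "\<And>k. k < m \<Longrightarrow> B k - A k \<in> mp (d + e)"
  obtains c x where "\<And>k i. c k i \<in> mp e" "\<And>v. x v \<in> mp e"
    "\<And>k. k < m \<Longrightarrow> B k = subst (\<lambda>v. var v + x v) (A k)
        + (\<Sum>i<m. c k i * subst (\<lambda>v. var v + x v) (A i))"
proof -
  define F where "F c x k = subst (\<lambda>v. var v + x v) (A k) + (\<Sum>i<m. c k i * subst (\<lambda>v. var v + x v) (A i))"
    for c :: "nat \<Rightarrow> nat \<Rightarrow> ('v, 'a) mps" and x k
  define P where "P p = (\<lambda>(c, x). (\<forall>k i. c k i \<in> mp e) \<and> (\<forall>v. x v \<in> mp e) \<and>
      (\<forall>k<m. B k - F c x k \<in> mp (d + e + p)))" for p
  define Q :: "nat \<Rightarrow> (nat \<Rightarrow> nat \<Rightarrow> ('v, 'a) mps) \<times> ('v \<Rightarrow> ('v, 'a) mps) \<Rightarrow>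
      (nat \<Rightarrow> nat \<Rightarrow> ('v, 'a) mps) \<times> ('v \<Rightarrow> ('v, 'a) mps) \<Rightarrow> bool"
    where "Q p = (\<lambda>(c, x) (c', x'). (\<forall>k i. c' k i - c k i \<in> mp (e + p)) \<and>
      (\<forall>v. x' v - x v \<in> mp (e + p)))" for p
  have "\<exists>s. \<forall>p. P p (s p) \<and> Q p (s p) (s (Suc p))"
  proof (rule dependent_nat_choice)
    have "P 0 (\<lambda>_ _. 0, \<lambda>_. 0)"
      using B by (simp add: P_def F_def subst_id)
    then show "\<exists>s. P 0 s" by blast
  next
    fix s p assume "P p s"
    moreover obtain c x where s: "s = (c, x)" by (cases s)
    ultimately have c: "\<And>k i. c k i \<in> mp e" and x: "\<And>v. x v \<in> mp e"
      and BF: "\<And>k. k < m \<Longrightarrow> B k - F c x k \<in> mp (d + e + p)"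
      by (auto simp: P_def)
    obtain c' x' where c': "\<And>k i. c' k i - c k i \<in> mp (e + p)" and x': "\<And>v. x' v - x v \<in> mp (e + p)"
      and "\<And>k. k < m \<Longrightarrow> B k - F c' x' k \<in> mp (d + e + Suc p)"
      using newton_step[OF stable jd ord e c x BF[unfolded F_def]] unfolding F_def by blast
    moreover have "c' k i \<in> mp e" for k i
      using mp_add[OF mp_mono[OF c', of e] c[of k i], of k i] by simp
    moreover have "x' v \<in> mp e" for v
      using mp_add[OF mp_mono[OF x', of e] x[of v], of v] by simp
    ultimately have "P (Suc p) (c', x') \<and> Q p s (c', x')"
      by (auto simp: P_def Q_def s)
    then show "\<exists>s'. P (Suc p) s' \<and> Q p s s'" by blast
  qed
  then obtain s where s: "\<And>p. P p (s p)" "\<And>p. Q p (s p) (s (Suc p))" by blast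
  define c where "c p = fst (s p)" for p
  define x where "x p = snd (s p)" for p
  have c: "\<And>p k i. c p k i \<in> mp e" and x: "\<And>p v. x p v \<in> mp e"
    and BF: "\<And>p k. k < m \<Longrightarrow> B k - F (c p) (x p) k \<in> mp (d + e + p)"
    using s(1) by (auto simp: P_def c_def x_def split_beta)
  have cstep: "c (Suc p) k i - c p k i \<in> mp p" and xstep: "x (Suc p) v - x p v \<in> mp p" for p k i v
    using s(2)[of p] mp_mono[of _ "e + p" p] by (auto simp: Q_def c_def x_def split_beta)
  have "\<exists>l. \<forall>p. l - c p k i \<in> mp p" for k i
    using mp_limit[of "\<lambda>p. c p k i"] cstep by metis
  then obtain c0 where c0: "\<And>k i p. c0 k i - c p k i \<in> mp p" by metis
  have "\<exists>l. \<forall>p. l - x p v \<in> mp p" for v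
    using mp_limit[of "\<lambda>p. x p v"] xstep by metis
  then obtain x0 where x0: "\<And>v p. x0 v - x p v \<in> mp p" by metis
  have c0e: "c0 k i \<in> mp e" for k i
    using mp_add[OF c0[of k i e] c[of e k i]] by simp
  have x0e: "x0 v \<in> mp e" for v
    using mp_add[OF x0[of v e] x[of e v]] by simp
  have "B k = F c0 x0 k" if k: "k < m" for k
  proof -
    have "B k - F c0 x0 k \<in> mp q" for q
    proof -
      \<comment> \<open>The index is \<open>Suc q\<close> because \<open>subst_diff_mp\<close>,
        applied to a series of order 0, loses one order.\<close>
      let ?\<phi> = "\<lambda>v. var v + x (Suc q) v" and ?\<psi> = "\<lambda>v. var v + x0 v"
      have \<phi>1: "?\<phi> v \<in> mp 1" "?\<psi> v \<in> mp 1" for v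
        using mp_mono[OF x, of 1] mp_mono[OF x0e, of 1] e by (auto intro!: mp_add var_mp)
      have sub: "subst ?\<psi> f - subst ?\<phi> f \<in> mp q" for f
        by (rule subst_diff_mp[of ?\<phi> ?\<psi> "Suc q" f 0]) (use \<phi>1 x0 in auto)
      have eq: "B k - F c0 x0 k = (B k - F (c (Suc q)) (x (Suc q)) k)
        - (subst ?\<psi> (A k) - subst ?\<phi> (A k))
        - (\<Sum>i<m. (c0 k i - c (Suc q) k i) * subst ?\<psi> (A i))
        - (\<Sum>i<m. c (Suc q) k i * (subst ?\<psi> (A i) - subst ?\<phi> (A i)))"
        by (simp add: F_def algebra_simps sum.distrib sum_subtractf)
      show ?thesis
        unfolding eq
        by (intro mp_diff[of _ q] mp_sum sub mp_multr[OF sub] mp_multl mp_mono[OF c0] mp_mono[OF BF[OF k]]) auto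
    qed
    then show ?thesis using mp_eq_0 by fastforce
  qed
  then show thesis
    unfolding F_def by (rule that[OF c0e x0e])
qed

text \<open>If all entries had order j + 2, their derivatives would have order j + 1, so T would lie
  in m^(j+1) R^m and could not approximate a monomial of degree j. In the sequel this gives e \<ge>
  2, as needed for the substitution to be bijective.\<close>

lemma ord_le_codim:
  fixes A :: "nat \<Rightarrow> ('v::finite, 'a::field) mps"
  assumes stable: "\<And>w. (\<And>k. k < m \<Longrightarrow> w k \<in> mp j) \<Longrightarrow> \<exists>t\<in>tang m A. \<forall>k<m. w k - t k \<in> mp (Suc j)"
    and m: "1 \<le> m" and ord: "\<And>i. i < m \<Longrightarrow> A i \<in> mp n"
  shows "n \<le> Suc j"
proof (rule ccontr)
  assume n: "\<not> n \<le> Suc j"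
  obtain \<beta> :: "'v \<Rightarrow> nat" where \<beta>: "mdeg \<beta> = j"
    using exists_le_mdeg_eq[of j "\<lambda>_. j"] le_mdeg[of "\<lambda>_. j"] by blast
  have "\<exists>t\<in>tang m A. \<forall>k<m. unitv 0 (xmon \<beta>) k - t k \<in> mp (Suc j)"
    using \<beta> by (intro stable) (auto simp: unitv_def intro: xmon_mp)
  then obtain t where t: "t \<in> tang m A" "unitv 0 (xmon \<beta>) 0 - t 0 \<in> mp (Suc j)"
    using m by auto
  from t(1) obtain c g where "t 0 = (\<Sum>i<m. c i * A i) + (\<Sum>v\<in>UNIV. g v * pd v (A 0))"
    unfolding tang_def using m by force
  moreover have "A i \<in> mp (Suc j)" "pd v (A i) \<in> mp (Suc j)" if "i < m" for i v
    using mp_mono[OF ord[OF that], of "Suc (Suc j)"] mp_mono[OF ord[OF that], of "Suc j"] n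
    by (auto intro: pd_mp)
  ultimately have "t 0 \<in> mp (Suc j)"
    using m by (auto intro!: mp_add mp_sum mp_multr)
  from mp_add[OF t(2) this] have "xmon \<beta> \<in> (mp (Suc j) :: ('v, 'a) mps set)"
    by (simp add: unitv_def)
  then have "coeff (xmon \<beta>) \<beta> = (0 :: 'a)"
    using \<beta> unfolding mp_iff by auto
  then show False by (simp add: coeff_xmon)
qed

lemma G_determined_of_finite_codim:
  fixes A :: "nat \<Rightarrow> ('v::{finite,linorder} \<Rightarrow> nat) \<Rightarrow> 'a::field"
  assumes m: "1 \<le> m" and fin: "finite_codim m (tangent_ext m A)"
  shows "G_determined m A (nat (2 * int (codim m (tangent_ext m A)) - int (vec_ord m A) + 2))"
proof -
  define d where "d = codim m (tangent_ext m A)"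
  define n where "n = vec_ord m A"
  obtain S where S: "spans_mod m (tangent_ext m A) S" "card S = d"
    using fin unfolding finite_codim_def d_def codim_def
    using LeastI_ex[of "\<lambda>n. \<exists>B. spans_mod m (tangent_ext m A) B \<and> card B = n"] by blast
  let ?A = "\<lambda>i. Mps (A i)"
  obtain j where jd: "j \<le> d"
    and stable: "\<And>w. (\<And>k. k < m \<Longrightarrow> w k \<in> mp j) \<Longrightarrow> \<exists>t\<in>tang m ?A. \<forall>k<m. w k - t k \<in> mp (Suc j)"
    using spans_mod_stable[OF S(1)] S(2) by metis
  \<comment> \<open>This holds even if all entries vanish and the LEAST in \<open>vec_ord\<close> is
    unspecified: no coefficient can be nonzero in a degree below it.\<close>
  have ord: "?A i \<in> mp n" if "i < m" for i
    unfolding mp_iff n_def vec_ord_def using not_less_Least that by fastforce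
  have "n \<le> Suc j"
    by (rule ord_le_codim[OF stable m ord])
  define e where "e = d + 3 - n"
  have e: "2 \<le> e" "d + 3 = n + e"
    using \<open>n \<le> Suc j\<close> jd by (auto simp: e_def)
  \<comment> \<open>Since n \<le> d + 1, the integer is positive and \<open>nat\<close> truncates
    nothing. The successor is the one in \<open>G_determined\<close>.\<close>
  have bound: "Suc (nat (2 * int d - int n + 2)) = d + e"
    using \<open>n \<le> Suc j\<close> jd by (simp add: e_def)
  have "G_equiv m A B" if B: "\<forall>i<m. in_mpow (d + e) (\<lambda>\<alpha>. B i \<alpha> - A i \<alpha>)" for B
  proof -
    let ?B = "\<lambda>i. Mps (B i)"
    have B': "?B k - ?A k \<in> mp (d + e)" if "k < m" for k
      using B that by (simp add: mp_def minus_mps_def)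
    obtain c x where c: "\<And>k i. c k i \<in> mp e" and x: "\<And>v. x v \<in> mp e"
      and sol: "\<And>k. k < m \<Longrightarrow> ?B k = subst (\<lambda>v. var v + x v) (?A k)
        + (\<Sum>i<m. c k i * subst (\<lambda>v. var v + x v) (?A i))"
      by (rule newton_solution[where A = ?A and B = ?B, OF stable jd ord e B']) blast+
    let ?\<phi> = "\<lambda>v. var v + x v"
    let ?U = "\<lambda>i j. (if i = j then 1 else 0) + c i j"
    have "c i j \<in> mp 1" for i j
      using mp_mono[OF c] e by simp
    then obtain W where W: "\<And>i j. i < m \<Longrightarrow> j < m \<Longrightarrow> (\<Sum>k<m. ?U i k * W k j) = (if i = j then 1 else 0)"
      "\<And>i j. i < m \<Longrightarrow> j < m \<Longrightarrow> (\<Sum>k<m. W i k * ?U k j) = (if i = j then 1 else 0)"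
      by (rule matrix_inverse_near_id[of c m]) blast+
    have "in_GL m (\<lambda>i j. coeff (?U i j))"
      unfolding in_GL_def mat_mult_Mps
      by (rule exI[of _ "\<lambda>i j. coeff (W i j)"]) (simp add: mat_mult_Mps W)
    moreover have "ps_unit ps_one"
      unfolding ps_unit_def by (rule exI[of _ ps_one]) (simp add: Mps_inject_iff Mps_simps)
    moreover have "is_aut (\<lambda>v. coeff (?\<phi> v))"
      unfolding is_aut_def in_max_ideal_iff bij_subst_iff[symmetric]
      using mp_mono[OF x, of 1] mp_mono[OF x, of 2] e
      by (auto intro!: bij_subst mp_add var_mp)
    moreover have "B i = ps_mult (mat_vec m (\<lambda>i j. coeff (?U i j))
        (\<lambda>k. ps_subst (\<lambda>v. coeff (?\<phi> v)) (A k)) i) ps_one" if "i < m" for i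
    proof -
      have "(\<Sum>k<m. ?U i k * subst ?\<phi> (?A k))
         = (\<Sum>k<m. (if k = i then subst ?\<phi> (?A i) else 0)) + (\<Sum>k<m. c i k * subst ?\<phi> (?A k))"
        unfolding sum.distrib[symmetric] by (intro sum.cong refl) (auto simp: distrib_right)
      then have "?B i = (\<Sum>k<m. ?U i k * subst ?\<phi> (?A k))"
        using that sol by simp
      then show ?thesis
        by (simp add: Mps_inject_iff Mps_simps mat_vec_def subst_def)
    qed
    ultimately show ?thesis
      unfolding G_equiv_def by blast
  qed
  then show ?thesis
    unfolding G_determined_def d_def[symmetric] n_def[symmetric] bound by blast
qed

section \<open>Polynomial relations between powers of a variable\<close>

interpretation ks: vector_space "\<lambda>c (f :: ('v::finite, 'a::field) mps). const c * f"
  by unfold_locales (simp_all add: algebra_simps const_add const_mult)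

lemma span_mult:
  assumes f: "f \<in> ks.span S" and g: "g \<in> ks.span S'"
    and V: "ks.subspace V" and mult: "\<And>s s'. s \<in> S \<Longrightarrow> s' \<in> S' \<Longrightarrow> s * s' \<in> V"
  shows "f * g \<in> V"
  using f
proof (induction rule: ks.span_induct)
  case base
  show ?case
    using ks.subspace_0[OF V] ks.subspace_add[OF V] ks.subspace_scale[OF V]
    by (auto intro!: ks.subspaceI simp: distrib_right mult.assoc)
next
  case (step s)
  show ?case
    using g
  proof (induction rule: ks.span_induct)
    case base
    show ?case
      using ks.subspace_0[OF V] ks.subspace_add[OF V] ks.subspace_scale[OF V]
      by (auto intro!: ks.subspaceI simp: distrib_left mult.left_commute[of _ "const _"])
  next
    case (step s')
    with \<open>s \<in> S\<close> show ?case by (intro mult)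
  qed
qed

text \<open>Monomials in generators \<open>y\<close> of weight 0 and \<open>z\<close> of weight 1, homogeneous of degree \<open>d\<close>
  in the latter.\<close>

definition wgens ::
  "('g \<Rightarrow> ('v::finite, 'a::field) mps) \<Rightarrow> 'g set \<Rightarrow> ('l \<Rightarrow> ('v, 'a) mps) \<Rightarrow> 'l set \<Rightarrow> nat \<Rightarrow> nat \<Rightarrow> ('v, 'a) mps set"
  where "wgens y \<Gamma> z \<Lambda> q d =
    {(\<Prod>g\<in>\<Gamma>. y g ^ n g) * (\<Prod>k\<in>\<Lambda>. z k ^ b k) | n b. (\<forall>g\<in>\<Gamma>. n g \<le> q * d) \<and> (\<Sum>k\<in>\<Lambda>. b k) = d}"

lemma wgens_mult:
  assumes "s \<in> wgens y \<Gamma> z \<Lambda> q d" "s' \<in> wgens y \<Gamma> z \<Lambda> q d'"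
  shows "s * s' \<in> wgens y \<Gamma> z \<Lambda> q (d + d')"
proof -
  obtain n b n' b' where
    "s = (\<Prod>g\<in>\<Gamma>. y g ^ n g) * (\<Prod>k\<in>\<Lambda>. z k ^ b k)" "\<forall>g\<in>\<Gamma>. n g \<le> q * d" "(\<Sum>k\<in>\<Lambda>. b k) = d"
    "s' = (\<Prod>g\<in>\<Gamma>. y g ^ n' g) * (\<Prod>k\<in>\<Lambda>. z k ^ b' k)" "\<forall>g\<in>\<Gamma>. n' g \<le> q * d'" "(\<Sum>k\<in>\<Lambda>. b' k) = d'"
    using assms unfolding wgens_def by blast
  then show ?thesis
    unfolding wgens_def
    by (intro CollectI exI[of _ "\<lambda>g. n g + n' g"] exI[of _ "\<lambda>k. b k + b' k"])
      (auto simp: power_add prod.distrib sum.distrib ac_simps distrib_left add_mono)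
qed

text \<open>Homogeneity of degree d in the z determines the exponent of z j from the others. This
  saves one in the exponent of the count, just as passing to the ratios z k / z j would.\<close>

lemma card_wgens:
  fixes y :: "'g \<Rightarrow> ('v::finite, 'a::field) mps"
  assumes fin: "finite \<Gamma>" "finite \<Lambda>" and j: "j \<in> \<Lambda>" and q: "1 \<le> q"
  shows "finite (wgens y \<Gamma> z \<Lambda> q d)"
    and "card (wgens y \<Gamma> z \<Lambda> q d) \<le> (q * d + 1) ^ (card \<Gamma> + card \<Lambda> - 1)"
proof -
  let ?X = "(PiE \<Gamma> (\<lambda>_. {..q * d})) \<times> (PiE (\<Lambda> - {j}) (\<lambda>_. {..q * d}))"
  let ?f = "\<lambda>(n, b). (\<Prod>g\<in>\<Gamma>. y g ^ n g) * (z j ^ (d - (\<Sum>k\<in>\<Lambda> - {j}. b k)) * (\<Prod>k\<in>\<Lambda> - {j}. z k ^ b k))"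
  have sub: "wgens y \<Gamma> z \<Lambda> q d \<subseteq> ?f ` ?X"
  proof
    fix s assume "s \<in> wgens y \<Gamma> z \<Lambda> q d"
    then obtain n b where s: "s = (\<Prod>g\<in>\<Gamma>. y g ^ n g) * (\<Prod>k\<in>\<Lambda>. z k ^ b k)"
      and n: "\<forall>g\<in>\<Gamma>. n g \<le> q * d" and b: "(\<Sum>k\<in>\<Lambda>. b k) = d"
      unfolding wgens_def by blast
    have bj: "b j + (\<Sum>k\<in>\<Lambda> - {j}. b k) = d"
      using b sum.remove[OF fin(2) j, of b] by simp
    have "b k \<le> q * d" if "k \<in> \<Lambda>" for k
    proof -
      have "b k \<le> d" using member_le_sum[of k \<Lambda> b] that fin b by simp
      also have "\<dots> \<le> q * d" using q by simp
      finally show ?thesis .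
    qed
    moreover have "s = ?f (restrict n \<Gamma>, restrict b (\<Lambda> - {j}))"
      using bj by (simp add: s prod.remove[OF fin(2) j] add.commute[of "b j"] flip: bj)
    ultimately show "s \<in> ?f ` ?X"
      using n by (intro image_eqI[of _ _ "(restrict n \<Gamma>, restrict b (\<Lambda> - {j}))"]) auto
  qed
  have finX: "finite ?X"
    using fin by (auto intro!: finite_PiE)
  show "finite (wgens y \<Gamma> z \<Lambda> q d)"
    using sub finX by (meson finite_imageI finite_subset)
  have "card (wgens y \<Gamma> z \<Lambda> q d) \<le> card ?X"
    using sub finX by (meson card_image_le card_mono finite_imageI order_trans)
  also have "card ?X = (q * d + 1) ^ (card \<Gamma> + (card \<Lambda> - 1))"
    using fin j by (simp add: card_cartesian_product card_PiE power_add)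
  also have "card \<Gamma> + (card \<Lambda> - 1) = card \<Gamma> + card \<Lambda> - 1"
    using fin j by (metis Nat.add_diff_assoc One_nat_def Suc_leI card_gt_0_iff empty_iff)
  finally show "card (wgens y \<Gamma> z \<Lambda> q d) \<le> (q * d + 1) ^ (card \<Gamma> + card \<Lambda> - 1)" .
qed

section \<open>Algebraic dependence modulo an ideal\<close>

definition idealp :: "('v::finite, 'a::field) mps set \<Rightarrow> bool" where
  "idealp P \<longleftrightarrow> 0 \<in> P \<and> (\<forall>f\<in>P. \<forall>g\<in>P. f + g \<in> P) \<and> (\<forall>f\<in>P. \<forall>r. r * f \<in> P)"

lemma idealp_add: "idealp P \<Longrightarrow> f \<in> P \<Longrightarrow> g \<in> P \<Longrightarrow> f + g \<in> P"
  and idealp_mult: "idealp P \<Longrightarrow> f \<in> P \<Longrightarrow> r * f \<in> P"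
  unfolding idealp_def by blast+

lemma idealp_sum:
  assumes "idealp P" "\<And>i. i \<in> S \<Longrightarrow> F i \<in> P"
  shows "sum F S \<in> P"
  using assms(2)
  by (induction S rule: infinite_finite_induct) (use assms(1) in \<open>auto simp: idealp_def\<close>)

text \<open>Modulo P the p_i behave like fractions r_i / z_j in N independent quantities. Clearing
  denominators, the (D + 1)^(N+1) monomials in the p_i with exponents up to D land in the span of at
  most (q D (N + 1) + 1)^N generators, so they satisfy a linear relation. The choice of D involves
  only q and N, not the p_i.\<close>

lemma relation_mod_ideal:
  fixes y :: "'g \<Rightarrow> ('v::finite, 'a::field) mps" and z :: "'l \<Rightarrow> ('v, 'a) mps"
  assumes fin: "finite \<Gamma>" "finite \<Lambda>" and j: "j \<in> \<Lambda>" and q: "1 \<le> q"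
    and N: "N = card \<Gamma> + card \<Lambda> - 1"
    and P: "idealp P"
    and p: "\<And>i. i < Suc N \<Longrightarrow> \<exists>r\<in>ks.span (wgens y \<Gamma> z \<Lambda> q 1). z j * p i - r \<in> P"
    and D: "(q * (D * Suc N) + 1) ^ N < (D + 1) ^ Suc N"
  defines "X \<equiv> PiE {..<Suc N} (\<lambda>_. {..D})"
  obtains c where "\<exists>a\<in>X. c a \<noteq> 0"
    "z j ^ (D * Suc N) * (\<Sum>a\<in>X. const (c a) * (\<Prod>i<Suc N. p i ^ a i)) \<in> P"
proof -
  let ?G = "wgens y \<Gamma> z \<Lambda> q"
  let ?M = "D * Suc N"
  define V where "V d = {f. \<exists>r\<in>ks.span (?G d). f - r \<in> P}" for d
  have V_mult: "f * f' \<in> V (d + d')" if f: "f \<in> V d" and f': "f' \<in> V d'" for f f' d d'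
  proof -
    obtain r r' where r: "r \<in> ks.span (?G d)" "f - r \<in> P" and r': "r' \<in> ks.span (?G d')" "f' - r' \<in> P"
      using f f' unfolding V_def by blast
    have "r * r' \<in> ks.span (?G (d + d'))"
      by (rule span_mult[OF r(1) r'(1)]) (auto intro: ks.span_base wgens_mult)
    moreover have "f * f' - r * r' = f * (f' - r') + r' * (f - r)"
      by (simp add: algebra_simps)
    then have "f * f' - r * r' \<in> P"
      using P r(2) r'(2) unfolding idealp_def by metis
    ultimately show ?thesis unfolding V_def by blast
  qed
  have base: "f \<in> V d" if "f \<in> ?G d" for f d
    using that P unfolding V_def idealp_def
    by (intro CollectI bexI[of _ f]) (auto intro: ks.span_base)
  have "1 \<in> ?G 0"
    unfolding wgens_def by (intro CollectI exI[of _ "\<lambda>_. 0"]) simp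
  then have V1: "1 \<in> V 0" by (rule base)
  have "z j \<in> ?G 1"
    unfolding wgens_def using fin j
    by (intro CollectI exI[of _ "\<lambda>_. 0"] exI[of _ "\<lambda>k. if k = j then 1 else 0"])
      (simp add: if_distrib prod.delta cong: if_cong)
  then have Vz: "z j \<in> V 1" by (rule base)
  have V_pow: "f ^ n \<in> V n" if "f \<in> V 1" for f n
    by (induction n) (use V1 V_mult[OF that] in auto)
  have V_prod: "(\<Prod>i\<in>S. F i) \<in> V (sum n S)" if "\<And>i. i \<in> S \<Longrightarrow> F i \<in> V (n i)" for F and n :: "nat \<Rightarrow> nat" and S
    using that by (induction S rule: infinite_finite_induct) (auto intro: V1 V_mult)
  have "z j ^ ?M * (\<Prod>i<Suc N. p i ^ a i) \<in> V ?M" if "a \<in> X" for a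
  proof -
    \<comment> \<open>Multiplying the p_i by z_j uses up \<open>?s\<close> of the factors z_j; those
      left over bring all monomials to the same weight \<open>?M\<close>.\<close>
    let ?s = "\<Sum>i<Suc N. a i"
    have "?s \<le> (\<Sum>i<Suc N. D)"
      by (rule sum_mono) (use that in \<open>auto simp: X_def\<close>)
    then have s: "?s \<le> ?M" by (simp add: mult.commute)
    have "(\<Prod>i<Suc N. (z j * p i) ^ a i) \<in> V ?s"
      using p by (intro V_prod V_pow) (auto simp: V_def)
    from V_mult[OF V_pow[OF Vz, of "?M - ?s"] this]
    have "z j ^ (?M - ?s) * (\<Prod>i<Suc N. (z j * p i) ^ a i) \<in> V ?M"
      using s by simp
    also have "z j ^ (?M - ?s) * (\<Prod>i<Suc N. (z j * p i) ^ a i)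
        = z j ^ (?M - ?s + ?s) * (\<Prod>i<Suc N. p i ^ a i)"
      by (simp only: power_mult_distrib prod.distrib power_add power_sum mult.assoc)
    finally show ?thesis using s by simp
  qed
  then have "\<forall>a\<in>X. \<exists>r. r \<in> ks.span (?G ?M) \<and> z j ^ ?M * (\<Prod>i<Suc N. p i ^ a i) - r \<in> P"
    unfolding V_def by blast
  then obtain w where w: "\<And>a. a \<in> X \<Longrightarrow> w a \<in> ks.span (?G ?M)"
    and wP: "\<And>a. a \<in> X \<Longrightarrow> z j ^ ?M * (\<Prod>i<Suc N. p i ^ a i) - w a \<in> P"
    unfolding bchoice_iff by blast
  have finG: "finite (?G ?M)" and cardG: "card (?G ?M) \<le> (q * ?M + 1) ^ N"
    using card_wgens[OF fin j q] unfolding N by blast+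
  have finX: "finite X"
    unfolding X_def by (rule finite_PiE) auto
  have cardX: "card X = (D + 1) ^ Suc N"
    unfolding X_def by (simp add: card_PiE)
  have "\<forall>a\<in>X. \<exists>\<kappa>. w a = (\<Sum>s\<in>?G ?M. const (\<kappa> s) * s)"
    using w unfolding ks.span_finite[OF finG] by blast
  then obtain \<kappa> where \<kappa>: "\<And>a. a \<in> X \<Longrightarrow> w a = (\<Sum>s\<in>?G ?M. const (\<kappa> a s) * s)"
    unfolding bchoice_iff by blast
  have "card (?G ?M) < card X"
    using cardG D cardX by linarith
  from linear_relation[OF finG finX this, of \<kappa>] obtain c where c: "\<exists>a\<in>X. c a \<noteq> 0"
    and rel: "\<And>s. s \<in> ?G ?M \<Longrightarrow> (\<Sum>a\<in>X. c a * \<kappa> a s) = 0"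
    by blast
  have const_sum: "(\<Sum>a\<in>X. const (h a)) = const (\<Sum>a\<in>X. h a)" for h :: "_ \<Rightarrow> 'a"
    by (rule mps_eqI) (simp add: coeff_sum coeff_const)
  have "(\<Sum>a\<in>X. const (c a) * w a) = (\<Sum>a\<in>X. \<Sum>s\<in>?G ?M. const (c a * \<kappa> a s) * s)"
  proof (intro sum.cong refl)
    fix a assume "a \<in> X"
    show "const (c a) * w a = (\<Sum>s\<in>?G ?M. const (c a * \<kappa> a s) * s)"
      unfolding \<kappa>[OF \<open>a \<in> X\<close>] sum_distrib_left const_mult mult.assoc ..
  qed
  also have "\<dots> = (\<Sum>s\<in>?G ?M. (\<Sum>a\<in>X. const (c a * \<kappa> a s)) * s)"
    unfolding sum_distrib_right by (rule sum.swap)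
  also have "\<dots> = 0"
    by (simp add: const_sum rel)
  finally have zero: "(\<Sum>a\<in>X. const (c a) * w a) = 0" .
  have "Z * (\<Sum>a\<in>X. const (c a) * h a) = (\<Sum>a\<in>X. const (c a) * (Z * h a - w a))" for Z h
    by (simp add: right_diff_distrib sum_subtractf zero sum_distrib_left mult.left_commute)
  then have "z j ^ ?M * (\<Sum>a\<in>X. const (c a) * (\<Prod>i<Suc N. p i ^ a i))
      = (\<Sum>a\<in>X. const (c a) * (z j ^ ?M * (\<Prod>i<Suc N. p i ^ a i) - w a))" .
  also have "\<dots> \<in> P"
    using wP P by (intro idealp_sum) (auto simp: idealp_def)
  finally show thesis using c that by blast
qed

section \<open>Sparse exponents\<close>

lemma digits_inject:
  fixes a a' :: "nat \<Rightarrow> nat"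
  assumes "\<And>i. i < n \<Longrightarrow> a i < b" "\<And>i. i < n \<Longrightarrow> a' i < b"
    and "(\<Sum>i<n. b ^ i * a i) = (\<Sum>i<n. b ^ i * a' i)" "i < n"
  shows "a i = a' i"
  using assms
proof (induction n arbitrary: a a' i)
  case (Suc n)
  have split: "(\<Sum>i<Suc n. b ^ i * f i) = f 0 + b * (\<Sum>i<n. b ^ i * f (Suc i))" for f :: "nat \<Rightarrow> nat"
    by (simp add: sum.lessThan_Suc_shift sum_distrib_left mult.assoc del: sum.lessThan_Suc)
  have eq: "a 0 + b * (\<Sum>i<n. b ^ i * a (Suc i)) = a' 0 + b * (\<Sum>i<n. b ^ i * a' (Suc i))"
    using Suc.prems(3) unfolding split .
  have lt: "a 0 < b" "a' 0 < b"
    using Suc.prems(1,2)[of 0] by simp_all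
  from eq have "(a 0 + b * (\<Sum>i<n. b ^ i * a (Suc i))) mod b = (a' 0 + b * (\<Sum>i<n. b ^ i * a' (Suc i))) mod b"
    by simp
  then have 0: "a 0 = a' 0"
    using lt by simp
  with eq lt have rest: "(\<Sum>i<n. b ^ i * a (Suc i)) = (\<Sum>i<n. b ^ i * a' (Suc i))"
    by simp
  show ?case
  proof (cases i)
    case (Suc i')
    then show ?thesis
      using Suc.IH[of "\<lambda>i. a (Suc i)" "\<lambda>i. a' (Suc i)" i'] Suc.prems rest by simp
  qed (simp add: 0)
qed simp

text \<open>Distinct exponents exclude cancellation. The term of least exponent w factors out and
  leaves a series with nonzero constant term.\<close>

lemma sparse_polynomial_unit:
  assumes fin: "finite X" and inj: "inj_on wt X" and c: "\<exists>a\<in>X. c a \<noteq> 0"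
  obtains w u where "(\<Sum>a\<in>X. const (c a) * var v ^ wt a) * u = var v ^ w"
proof -
  define w where "w = (LEAST w. \<exists>a\<in>X. c a \<noteq> 0 \<and> wt a = w)"
  have "\<exists>a\<in>X. c a \<noteq> 0 \<and> wt a = w"
    unfolding w_def by (rule LeastI_ex) (use c in blast)
  then obtain a0 where a0: "a0 \<in> X" "c a0 \<noteq> 0" "wt a0 = w" by blast
  have min: "w \<le> wt a" if "a \<in> X" "c a \<noteq> 0" for a
    unfolding w_def by (rule Least_le) (use that in blast)
  let ?h = "\<Sum>a\<in>X - {a0}. const (c a) * var v ^ (wt a - w - 1)"
  let ?f = "const (c a0) + var v * ?h"
  have summand: "const (c a) * var v ^ wt a = var v ^ w * (var v * (const (c a) * var v ^ (wt a - w - 1)))"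
    if "a \<in> X - {a0}" for a
  proof (cases "c a = 0")
    case False
    then have "w \<le> wt a" "wt a \<noteq> w"
      using min that a0 inj by (auto dest: inj_onD)
    then have "wt a = w + Suc (wt a - w - 1)" by simp
    then have "var v ^ wt a = var v ^ w * (var v * var v ^ (wt a - w - 1))"
      by (metis power_Suc power_add)
    then have "const (c a) * var v ^ wt a = const (c a) * (var v ^ w * (var v * var v ^ (wt a - w - 1)))"
      by (rule arg_cong)
    also have "\<dots> = var v ^ w * (var v * (const (c a) * var v ^ (wt a - w - 1)))"
      by (simp only: ac_simps)
    finally show ?thesis .
  qed simp
  have "(\<Sum>a\<in>X. const (c a) * var v ^ wt a)
      = const (c a0) * var v ^ wt a0 + (\<Sum>a\<in>X - {a0}. const (c a) * var v ^ wt a)"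
    using fin a0(1) by (rule sum.remove)
  also have "(\<Sum>a\<in>X - {a0}. const (c a) * var v ^ wt a)
      = (\<Sum>a\<in>X - {a0}. var v ^ w * (var v * (const (c a) * var v ^ (wt a - w - 1))))"
    by (rule sum.cong[OF refl summand])
  finally have eq: "(\<Sum>a\<in>X. const (c a) * var v ^ wt a) = var v ^ w * ?f"
    by (simp add: a0(3) distrib_left sum_distrib_left mult.commute)
  have "var v * ?h \<in> mp 1"
    by (rule mp_multl[OF var_mp])
  then have "coeff ?f 0 \<noteq> 0"
    using a0(2) by (simp add: mp_iff coeff_const)
  then obtain u where "?f * u = 1"
    by (rule mps_unit)
  then have "(\<Sum>a\<in>X. const (c a) * var v ^ wt a) * u = var v ^ w"
    unfolding eq by (simp add: mult.assoc)
  with that show thesis by blast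
qed

text \<open>For the powers x_v^((D+1)^i), a monomial with exponents a_i \<le> D is x_v to the number
  whose digits in base D + 1 are the a_i. Different monomials therefore become different powers, and
  the relation stays a nonzero polynomial in x_v.\<close>

lemma powers_relation_mod_ideal:
  fixes y :: "'g \<Rightarrow> ('v::finite, 'a::field) mps" and z :: "'l \<Rightarrow> ('v, 'a) mps"
  assumes fin: "finite \<Gamma>" "finite \<Lambda>" and j: "j \<in> \<Lambda>" and q: "1 \<le> q"
    and N: "N = card \<Gamma> + card \<Lambda> - 1"
    and P: "idealp P"
    and p: "\<And>i. i < Suc N \<Longrightarrow>
      \<exists>r\<in>ks.span (wgens y \<Gamma> z \<Lambda> q 1). z j * var v ^ ((D + 1) ^ i) - r \<in> P"
    and D: "(q * (D * Suc N) + 1) ^ N < (D + 1) ^ Suc N"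
  obtains M w where "z j ^ M * var v ^ w \<in> P"
proof -
  let ?X = "PiE {..<Suc N} (\<lambda>_. {..D})"
  let ?wt = "\<lambda>a. \<Sum>i<Suc N. (D + 1) ^ i * a i"
  obtain c where c: "\<exists>a\<in>?X. c a \<noteq> 0"
    and mem: "z j ^ (D * Suc N) * (\<Sum>a\<in>?X. const (c a) * (\<Prod>i<Suc N. (var v ^ ((D + 1) ^ i)) ^ a i)) \<in> P"
    by (rule relation_mod_ideal[OF fin j q N P p D])
  have powers: "(\<Prod>i<Suc N. (var v ^ ((D + 1) ^ i)) ^ a i) = var v ^ ?wt a" for a :: "nat \<Rightarrow> nat"
    by (simp only: power_sum power_mult)
  have mem': "z j ^ (D * Suc N) * (\<Sum>a\<in>?X. const (c a) * var v ^ ?wt a) \<in> P"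
    using mem unfolding powers .
  have finX: "finite ?X"
    by (rule finite_PiE) auto
  have "inj_on ?wt ?X"
  proof (rule inj_onI)
    fix a a' assume a: "a \<in> ?X" "a' \<in> ?X" and eq: "?wt a = ?wt a'"
    show "a = a'"
    proof (rule PiE_ext[OF a])
      fix i assume "i \<in> {..<Suc N}"
      then show "a i = a' i"
        using a by (intro digits_inject[OF _ _ eq]) (auto simp: PiE_iff less_Suc_eq_le)
    qed
  qed
  then obtain w u where u: "(\<Sum>a\<in>?X. const (c a) * var v ^ ?wt a) * u = var v ^ w"
    by (rule sparse_polynomial_unit[OF finX _ c])
  have "u * (Z * S) = Z * (S * u)" for Z S
    by (simp only: ac_simps)
  then have "u * (z j ^ (D * Suc N) * (\<Sum>a\<in>?X. const (c a) * var v ^ ?wt a)) = z j ^ (D * Suc N) * var v ^ w"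
    unfolding u[symmetric] .
  moreover have "u * (z j ^ (D * Suc N) * (\<Sum>a\<in>?X. const (c a) * var v ^ ?wt a)) \<in> P"
    using mem' P unfolding idealp_def by blast
  ultimately have "z j ^ (D * Suc N) * var v ^ w \<in> P"
    by (simp only:)
  then show thesis by (rule that)
qed

text \<open>The left side grows like D^N for fixed q and N. Demanding also L \<le> D makes the
  perturbation of high order, since its exponents are at least D + 1.\<close>

lemma exists_counting_bound:
  obtains D where "(q * (D * Suc N) + 1) ^ N < (D + 1) ^ Suc N" "L \<le> (D :: nat)"
proof -
  let ?c = "q * Suc N + 1"
  let ?D = "?c ^ N + L"
  have "(q * (?D * Suc N) + 1) ^ N \<le> (?c * (?D + 1)) ^ N"
    by (rule power_mono) (simp_all add: algebra_simps)
  also have "\<dots> = ?c ^ N * (?D + 1) ^ N"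
    by (rule power_mult_distrib)
  also have "\<dots> < (?D + 1) * (?D + 1) ^ N"
    by (rule mult_strict_right_mono) auto
  finally have "(q * (?D * Suc N) + 1) ^ N < (?D + 1) ^ Suc N"
    by simp
  with that show thesis by (metis le_add2)
qed

section \<open>Perturbation to finite codimension\<close>

text \<open>Polynomials measured by the degree in each variable separately, to match the exponent
  bound in \<open>wgens\<close>.\<close>

definition boxed :: "nat \<Rightarrow> ('v, 'a::field) mps \<Rightarrow> bool" where
  "boxed q f \<longleftrightarrow> (\<forall>\<alpha>. coeff f \<alpha> \<noteq> 0 \<longrightarrow> (\<forall>u. \<alpha> u \<le> q))"

lemma boxed_mono: "boxed q f \<Longrightarrow> q \<le> q' \<Longrightarrow> boxed q' f"
  unfolding boxed_def by (meson order_trans)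

lemma boxed_add: "boxed q f \<Longrightarrow> boxed q g \<Longrightarrow> boxed q (f + g)"
  unfolding boxed_def by (metis add_cancel_right_right coeff_add)

lemma boxed_sum: "(\<And>i. i \<in> S \<Longrightarrow> boxed q (F i)) \<Longrightarrow> boxed q (sum F S)"
  by (induction S rule: infinite_finite_induct) (auto simp: boxed_add, auto simp: boxed_def)

lemma boxed_pd: "boxed q f \<Longrightarrow> boxed q (pd v f)"
  unfolding boxed_def
proof (intro allI impI)
  fix \<alpha> u assume f: "\<forall>\<alpha>. coeff f \<alpha> \<noteq> 0 \<longrightarrow> (\<forall>u. \<alpha> u \<le> q)" and "coeff (pd v f) \<alpha> \<noteq> 0"
  then have "coeff f (\<alpha>(v := Suc (\<alpha> v))) \<noteq> 0"
    unfolding coeff_pd by (metis mult_zero_right)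
  then have "\<forall>u. (\<alpha>(v := Suc (\<alpha> v))) u \<le> q"
    by (rule f[THEN spec, THEN mp])
  then show "\<alpha> u \<le> q"
    by (metis Suc_leD fun_upd_other fun_upd_same)
qed

lemma boxed_xmon_mult: "boxed q f \<Longrightarrow> (\<And>u. \<alpha> u \<le> p) \<Longrightarrow> boxed (p + q) (xmon \<alpha> * f)"
  unfolding boxed_def
proof (intro allI impI)
  fix \<beta> u
  assume f: "\<forall>\<alpha>. coeff f \<alpha> \<noteq> 0 \<longrightarrow> (\<forall>u. \<alpha> u \<le> q)" and \<alpha>: "\<And>u. \<alpha> u \<le> p"
    and "coeff (xmon \<alpha> * f) \<beta> \<noteq> 0"
  then have "(\<beta> - \<alpha>) u \<le> q"
    by (auto simp: coeff_xmon_mult split: if_splits)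
  with \<alpha>[of u] show "\<beta> u \<le> p + q" by simp
qed

lemma boxed_1: "boxed 0 1"
  by (auto simp: boxed_def coeff_one)

lemma boxed_var_mult: "boxed q f \<Longrightarrow> boxed (Suc q) (var v * f)"
  unfolding var_def using boxed_xmon_mult[of q f "0(v := 1)" 1] by simp

lemma boxed_var_power: "boxed n (var v ^ n)"
  by (induction n) (auto intro: boxed_var_mult boxed_1)

lemma boxed_const_xmon: "mdeg \<alpha> \<le> q \<Longrightarrow> boxed q (const c * xmon \<alpha>)"
  by (auto simp: boxed_def coeff_xmon intro: order_trans[OF le_mdeg] split: if_splits)

lemma xmon_eq_prod: "xmon \<alpha> = (\<Prod>u\<in>UNIV. var u ^ \<alpha> u :: ('v::{finite,linorder}, 'a::field) mps)"
  using subst_xmon[where \<phi> = var and \<alpha> = \<alpha>, OF var_mp] by (simp add: subst_id)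

lemma boxed_expand:
  fixes f :: "('v::finite, 'a::field) mps"
  assumes "boxed q f"
  shows "f = (\<Sum>\<alpha>\<in>{\<alpha>. \<forall>u. \<alpha> u \<le> q}. const (coeff f \<alpha>) * xmon \<alpha>)"
proof (rule mps_eqI)
  fix \<beta>
  have "coeff (\<Sum>\<alpha>\<in>{\<alpha>. \<forall>u. \<alpha> u \<le> q}. const (coeff f \<alpha>) * xmon \<alpha>) \<beta>
      = (\<Sum>\<alpha>\<in>{\<alpha>. \<forall>u. \<alpha> u \<le> q}. if \<alpha> = \<beta> then coeff f \<beta> else 0)"
    unfolding coeff_sum by (intro sum.cong refl) (auto simp: coeff_xmon)
  also have "\<dots> = coeff f \<beta>"
    using assms by (auto simp: sum.delta boxed_def)
  finally show "coeff f \<beta> = coeff (\<Sum>\<alpha>\<in>{\<alpha>. \<forall>u. \<alpha> u \<le> q}. const (coeff f \<alpha>) * xmon \<alpha>) \<beta>" ..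
qed

text \<open>The equations for the parameters will consist of terms with one factor lam, a polynomial
  coefficient and at most one parameter power. The sum type joins the variables and the parameter
  powers into one family of weight 0.\<close>

lemma boxed_mult_wgens_span:
  fixes z :: "'l \<Rightarrow> ('v::{finite,linorder}, 'a::field) mps" and c :: "'c \<Rightarrow> ('v, 'a) mps"
  assumes fin: "finite C" "finite \<Lambda>" and k: "k \<in> \<Lambda>" and h: "boxed q h" and q: "1 \<le> q"
    and g: "g = 1 \<or> g \<in> c ` C"
  shows "z k * h * g \<in> ks.span (wgens (case_sum var c) (UNIV <+> C) z \<Lambda> q 1)"
proof -
  have zk: "(\<Prod>l\<in>\<Lambda>. z l ^ (if l = k then 1 else 0)) = z k"
    using fin k by (simp add: if_distrib prod.delta cong: if_cong)
  obtain e where e: "(\<Prod>p\<in>C. c p ^ e p) = g" "\<And>p. e p \<le> 1"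
    using g
  proof
    assume "g = 1"
    then show thesis by (intro that[of "\<lambda>_. 0"]) auto
  next
    assume "g \<in> c ` C"
    then obtain p where "p \<in> C" "g = c p" by blast
    then show thesis
      using fin by (intro that[of "\<lambda>p'. if p' = p then 1 else 0"])
        (auto simp: if_distrib prod.delta cong: if_cong)
  qed
  have "xmon \<alpha> * g * z k \<in> wgens (case_sum var c) (UNIV <+> C) z \<Lambda> q 1" if "\<forall>u. \<alpha> u \<le> q" for \<alpha>
    unfolding wgens_def
  proof (intro CollectI exI[of _ "case_sum \<alpha> e"] exI[of _ "\<lambda>l. if l = k then 1 else 0"] conjI)
    show "xmon \<alpha> * g * z k = (\<Prod>p\<in>UNIV <+> C. case_sum var c p ^ case_sum \<alpha> e p)
        * (\<Prod>l\<in>\<Lambda>. z l ^ (if l = k then 1 else 0))"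
      unfolding zk using fin by (simp add: prod.Plus o_def xmon_eq_prod e(1))
    show "\<forall>p\<in>UNIV <+> C. case_sum \<alpha> e p \<le> q * 1"
      using that order_trans[OF e(2) q] by auto
    show "(\<Sum>l\<in>\<Lambda>. if l = k then 1 else 0) = 1"
      using fin k by simp
  qed
  then have "(\<Sum>\<alpha>\<in>{\<alpha>. \<forall>u. \<alpha> u \<le> q}. const (coeff h \<alpha>) * (xmon \<alpha> * g * z k))
      \<in> ks.span (wgens (case_sum var c) (UNIV <+> C) z \<Lambda> q 1)"
    by (intro ks.span_sum ks.span_scale ks.span_base) auto
  also have "(\<Sum>\<alpha>\<in>{\<alpha>. \<forall>u. \<alpha> u \<le> q}. const (coeff h \<alpha>) * (xmon \<alpha> * g * z k))
      = (\<Sum>\<alpha>\<in>{\<alpha>. \<forall>u. \<alpha> u \<le> q}. const (coeff h \<alpha>) * xmon \<alpha>) * (g * z k)"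
    by (simp add: sum_distrib_right mult.assoc)
  also have "\<dots> = z k * h * g"
    unfolding boxed_expand[OF h, symmetric] by (simp only: ac_simps)
  finally show ?thesis .
qed

lemma pd_var_power:
  assumes "u \<noteq> v" shows "pd u (var v ^ n) = 0"
  using assms by (induction n) (simp_all add: pd_mult pd_var)

text \<open>The perturbation \<open>B\<^sub>k = A\<^sub>k + x\<^sub>v\<^bsup>E k v\<^esup> + \<Sum>\<^sub>u x\<^sub>u x\<^sub>v\<^bsup>E k u\<^esup>\<close>, with \<open>u \<noteq> v\<close>, has
  \<open>\<partial>B\<^sub>k/\<partial>x\<^sub>u = \<partial>A\<^sub>k/\<partial>x\<^sub>u + x\<^sub>v\<^bsup>E k u\<^esup>\<close>. If a power of \<open>x\<^sub>v\<close> did not annihilate \<open>R\<^sup>m\<close> modulo the tangent image,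
  some quotient of \<open>R\<^sup>m\<close> would be generated by one unit vector after inverting \<open>x\<^sub>v\<close>, with \<open>e\<^sub>k\<close> mapping to
  \<open>lam k / x\<^sub>v\<^bsup>n\<^esup>\<close>. Modulo its annihilator \<open>P\<close>, the \<open>ms + 1\<close> powers of \<open>x\<^sub>v\<close> involved are
  polynomials, of degree independent of \<open>E\<close>, in only \<open>ms\<close> quantities.\<close>

lemma stage_perturbation:
  fixes A B :: "nat \<Rightarrow> ('v::{finite,linorder}, 'a::field) mps"
  assumes boxed: "\<And>k. boxed q (A k)"
    and idx: "bij_betw idx ({..<m} \<times> (UNIV :: 'v set)) {1..N}"
    and N: "N = m * card (UNIV :: 'v set)"
    and D: "(Suc q * (D * Suc N) + 1) ^ N < (D + 1) ^ Suc N"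
    and B: "\<And>k. B k = A k + (\<Sum>u\<in>UNIV. (if u = v then 1 else var u) * var v ^ ((D + 1) ^ idx (k, u)))"
  obtains n where "\<And>k. k < m \<Longrightarrow> unitv k (var v ^ n) \<in> tang m B"
proof (rule ccontr)
  assume "\<not> thesis"
  with that have bad: "\<not> (\<forall>k<m. unitv k (var v ^ n) \<in> tang m B)" for n by blast
  \<comment> \<open>The preimage of the projection of the tangent image to the entries from j on.
    These submodules grow from the tangent image at j = 0 to all of R^m at j = m, so there is a last
    index at which no power of x_v annihilates the quotient.\<close>
  define T where "T j = {w. \<exists>t\<in>tang m B. \<forall>k<m. j \<le> k \<longrightarrow> w k = t k}" for j
  note tang = submod_tang[of m B]
  have T: "submod m (T j)" for j
  proof (rule submodI)
    show "(\<lambda>_. 0) \<in> T j"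
      unfolding T_def by (intro CollectI bexI[OF _ submod_0[OF tang]]) simp
  next
    fix w w' assume "w \<in> T j" "w' \<in> T j"
    then obtain t t' where t: "t \<in> tang m B" "t' \<in> tang m B"
      and "\<forall>k<m. j \<le> k \<longrightarrow> w k = t k" "\<forall>k<m. j \<le> k \<longrightarrow> w' k = t' k"
      unfolding T_def by blast
    then show "(\<lambda>k. w k + w' k) \<in> T j"
      unfolding T_def by (intro CollectI bexI[OF _ submod_add[OF tang t]]) auto
  next
    fix r w assume "w \<in> T j"
    then obtain t where t: "t \<in> tang m B" and "\<forall>k<m. j \<le> k \<longrightarrow> w k = t k"
      unfolding T_def by blast
    then show "(\<lambda>k. r * w k) \<in> T j"
      unfolding T_def by (intro CollectI bexI[OF _ submod_scale[OF tang t]]) auto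
  next
    fix w w' :: "nat \<Rightarrow> ('v, 'a) mps" assume "w \<in> T j" "\<And>k. k < m \<Longrightarrow> w' k = w k"
    then show "w' \<in> T j" unfolding T_def by auto
  qed
  have tangT: "w \<in> T j" if "w \<in> tang m B" for w j
    unfolding T_def using that by blast
  define good where "good j \<longleftrightarrow> (\<exists>n. \<forall>k<m. unitv k (var v ^ n) \<in> T j)" for j
  have "good m"
    unfolding good_def T_def using submod_0[OF tang] by auto
  moreover have "\<not> good 0"
  proof
    assume "good 0"
    then obtain n where n: "\<forall>k<m. unitv k (var v ^ n) \<in> T 0" unfolding good_def by blast
    have "unitv k (var v ^ n) \<in> tang m B" if k: "k < m" for k
    proof -
      obtain t where t: "t \<in> tang m B" "\<forall>i<m. unitv k (var v ^ n) i = t i"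
        using n[THEN spec, THEN mp, OF k] unfolding T_def by auto
      show ?thesis
        by (rule submod_cong[OF tang t(1)]) (use t(2) in blast)
    qed
    with bad show False by blast
  qed
  ultimately obtain j where j: "j < m" "\<not> good j" "good (Suc j)"
  proof -
    define j1 where "j1 = (LEAST j. good j)"
    have "good j1" unfolding j1_def using \<open>good m\<close> by (rule LeastI)
    with \<open>\<not> good 0\<close> obtain j where j: "j1 = Suc j" by (cases j1) auto
    have "j1 \<le> m" unfolding j1_def using \<open>good m\<close> by (rule Least_le)
    moreover have "\<not> good j" using not_less_Least[of j good] j unfolding j1_def by simp
    ultimately show thesis using j \<open>good j1\<close> by (intro that[of j]) auto
  qed
  obtain n where n: "\<And>k. k < m \<Longrightarrow> unitv k (var v ^ n) \<in> T (Suc j)"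
    using j(3) unfolding good_def by blast
  \<comment> \<open>Membership in \<open>T (Suc j)\<close> says nothing about entry j. Correcting
    that entry alone by a multiple of e_j gives membership in \<open>T j\<close>.\<close>
  have "\<exists>r. k < m \<longrightarrow> (\<lambda>i. unitv k (var v ^ n) i - unitv j r i) \<in> T j" for k
  proof (cases "k < m")
    case True
    obtain t where t: "t \<in> tang m B" "\<And>i. i < m \<Longrightarrow> Suc j \<le> i \<Longrightarrow> unitv k (var v ^ n) i = t i"
      using n[OF True] unfolding T_def by blast
    have "unitv k (var v ^ n) i - unitv j (unitv k (var v ^ n) j - t j) i = t i" if "i < m" "j \<le> i" for i
      using t(2)[of i] that by (cases "i = j") (auto simp: unitv_def)
    then show ?thesis using t(1) unfolding T_def by blast
  qed simp
  then obtain lam0 where lam0: "\<And>k. k < m \<Longrightarrow> (\<lambda>i. unitv k (var v ^ n) i - unitv j (lam0 k) i) \<in> T j"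
    by metis
  \<comment> \<open>The choice at j is normalized so that dividing by \<open>lam j\<close> only
    inverts a power of x_v.\<close>
  define lam where "lam = lam0(j := var v ^ n)"
  have lam: "(\<lambda>i. unitv k (var v ^ n) i - unitv j (lam k) i) \<in> T j" if "k < m" for k
    using lam0[OF that] submod_0[OF T[of j]] by (auto simp: lam_def)
  define P where "P = {r. unitv j r \<in> T j}"
  have P: "idealp P"
    unfolding idealp_def P_def
  proof (safe)
    show "unitv j 0 \<in> T j"
      by (rule submod_cong[OF T submod_0[OF T]]) (simp add: unitv_def)
    show "unitv j (f + g) \<in> T j" if "unitv j f \<in> T j" "unitv j g \<in> T j" for f g
      by (rule submod_cong[OF T submod_add[OF T that]]) (simp add: unitv_def)
    show "unitv j (r * f) \<in> T j" if "unitv j f \<in> T j" for f r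
      by (rule submod_cong[OF T submod_scale[OF T that, of r]]) (simp add: unitv_def)
  qed
  \<comment> \<open>If x_v^w annihilated e_j, then x_v^(w+n) would annihilate every e_k, since x_v^n
    e_k is congruent to \<open>lam k\<close> e_j. This contradicts the choice of j.\<close>
  have no_power: "var v ^ w \<notin> P" for w
  proof
    assume "var v ^ w \<in> P"
    then have w: "unitv j (var v ^ w) \<in> T j" by (simp add: P_def)
    have "unitv k (var v ^ (w + n)) \<in> T j" if "k < m" for k
      by (rule submod_cong[OF T submod_add[OF T submod_scale[OF T lam[OF that], of "var v ^ w"]
              submod_scale[OF T w, of "lam k"]]])
        (auto simp: unitv_def power_add algebra_simps)
    with j(2) show False unfolding good_def by blast
  qed
  have BP: "B k \<in> P" if "k < m" for k
    unfolding P_def using tangT[OF tang_unitv[OF that]] by simp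
  have pdP: "(\<Sum>k<m. lam k * pd u (B k)) \<in> P" for u
    unfolding P_def
  proof (rule CollectI, rule submod_cong[OF T submod_diff[OF T]])
    show "(\<lambda>i. var v ^ n * pd u (B i)) \<in> T j"
      by (rule submod_scale[OF T tangT[OF tang_pd]])
    show "(\<lambda>i. \<Sum>k<m. pd u (B k) * (unitv k (var v ^ n) i - unitv j (lam k) i)) \<in> T j"
      by (rule submod_lincomb[OF T]) (auto intro: lam)
    fix i assume i: "i < m"
    have "(\<Sum>k<m. pd u (B k) * unitv k (var v ^ n) i) = (\<Sum>k<m. if k = i then var v ^ n * pd u (B i) else 0)"
      by (intro sum.cong refl) (auto simp: unitv_def mult.commute)
    also have "\<dots> = var v ^ n * pd u (B i)" using i by simp
    finally have "var v ^ n * pd u (B i) - (\<Sum>k<m. pd u (B k) * (unitv k (var v ^ n) i - unitv j (lam k) i))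
        = (\<Sum>k<m. pd u (B k) * unitv j (lam k) i)"
      by (simp add: right_diff_distrib sum_subtractf)
    also have "\<dots> = unitv j (\<Sum>k<m. lam k * pd u (B k)) i"
      by (auto simp: unitv_def mult.commute)
    finally show "unitv j (\<Sum>k<m. lam k * pd u (B k)) i = var v ^ n * pd u (B i)
        - (\<Sum>k<m. pd u (B k) * (unitv k (var v ^ n) i - unitv j (lam k) i))" ..
  qed
  define par :: "nat \<times> 'v \<Rightarrow> ('v, 'a) mps" where "par p = var v ^ ((D + 1) ^ idx p)" for p
  \<comment> \<open>The parameters kept as independent quantities; all others are expressed through
    them by the equations in P.\<close>
  define C where "C = ({..<m} - {j}) \<times> (UNIV - {v})"
  define W where "W = ks.span (wgens (case_sum var par) (UNIV <+> C) lam {..<m} (Suc q) 1)"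
  have finC: "finite C" by (simp add: C_def)
  have Wsub: "ks.subspace W" unfolding W_def by (rule ks.subspace_span)
  have W1: "lam k * h \<in> W" if "k < m" "boxed (Suc q) h" for k h
    using boxed_mult_wgens_span[of C "{..<m}" k "Suc q" h 1 par lam] finC that by (simp add: W_def)
  have W2: "lam k * h * par p \<in> W" if "k < m" "boxed (Suc q) h" "p \<in> C" for k h p
    using boxed_mult_wgens_span[of C "{..<m}" k "Suc q" h "par p" par lam] finC that by (simp add: W_def)
  have boxA: "boxed (Suc q) (A k)" "boxed (Suc q) (pd u (A k))" "boxed (Suc q) (var u * pd w (A k))" for k u w
    using boxed_mono[OF boxed] boxed_pd[OF boxed_mono[OF boxed]] boxed_var_mult[OF boxed_pd[OF boxed]] by auto
  have box1: "boxed (Suc q) (1 :: ('v, 'a) mps)" "boxed (Suc q) (var u :: ('v, 'a) mps)" for u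
    using boxed_mono[OF boxed_1, of "Suc q"] boxed_mono[OF boxed_var_mult[OF boxed_1], of "Suc q" u] by auto
  have Bv: "B k = A k + (par (k, v) + (\<Sum>u\<in>UNIV - {v}. var u * par (k, u)))" for k
    unfolding B by (subst sum.remove[of UNIV v]) (simp_all add: par_def)
  have pdB: "pd u (B k) = pd u (A k) + par (k, u)" if "u \<noteq> v" for u k
  proof -
    have "pd u (\<Sum>w\<in>UNIV - {v}. var w * par (k, w)) = (\<Sum>w\<in>UNIV - {v}. if w = u then par (k, u) else 0)"
      unfolding pd_sum using that
      by (intro sum.cong refl) (auto simp: pd_mult pd_var par_def pd_var_power)
    also have "\<dots> = par (k, u)"
      using that by simp
    finally show ?thesis
      unfolding Bv pd_add using that by (simp add: par_def pd_var_power)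
  qed
  have lamj: "lam j = var v ^ n" by (simp add: lam_def)
  \<comment> \<open>The derivative equation along x_u solved for \<open>lam j * par (j, u)\<close>,
    times h. Besides h = 1 the case h = x_u is needed, because x_u \<open>par (j, u)\<close> occurs
    in B_j.\<close>
  define rem where "rem h u = - (\<Sum>k<m. lam k * (h * pd u (A k))) - (\<Sum>k\<in>{..<m} - {j}. lam k * h * par (k, u))"
    for h u
  have rem: "lam j * par (j, u) - rem 1 u \<in> P" if "u \<noteq> v" for u
  proof -
    have "(\<Sum>k<m. lam k * par (k, u)) = lam j * par (j, u) + (\<Sum>k\<in>{..<m} - {j}. lam k * par (k, u))"
      using j(1) by (intro sum.remove) auto
    then have "lam j * par (j, u) - rem 1 u = (\<Sum>k<m. lam k * pd u (B k))"
      unfolding rem_def pdB[OF that] by (simp add: distrib_left sum.distrib)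
    with pdP show ?thesis by simp
  qed
  have remW: "rem h u \<in> W" if "u \<noteq> v" "h = 1 \<or> h = var u" for h u
    unfolding rem_def using that boxA box1
    by (intro ks.subspace_diff[OF Wsub] ks.subspace_neg[OF Wsub] ks.subspace_sum[OF Wsub] W1 W2)
      (auto simp: C_def)
  have var_rem: "var u * rem 1 u = rem (var u) u" for u
    unfolding rem_def by (simp add: right_diff_distrib sum_distrib_left ac_simps)
  \<comment> \<open>For u different from v, a parameter is independent if k differs from j, and
    otherwise comes from a derivative equation. For u = v it comes from B_k, where for k = j the
    \<open>par (j, u)\<close> have to be replaced as well.\<close>
  have param: "\<exists>r\<in>W. lam j * par (k, u) - r \<in> P" if k: "k < m" for k u
  proof -
    have diff0: "f - f \<in> P" for f using P by (simp add: idealp_def)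
    show ?thesis
    proof (cases "u = v"; cases "k = j")
      assume "u \<noteq> v" "k \<noteq> j"
      then show ?thesis
        using W2[OF j(1) box1(1), of "(k, u)"] k diff0 by (intro bexI[of _ "lam j * par (k, u)"]) (auto simp: C_def)
    next
      assume "u \<noteq> v" "k = j"
      then show ?thesis
        using rem[of u] remW[of u 1] by blast
    next
      assume uv: "u = v" and "k \<noteq> j"
      let ?r = "- (lam j * A k) - (\<Sum>u\<in>UNIV - {v}. lam j * var u * par (k, u))"
      have r: "?r \<in> W"
        using \<open>k \<noteq> j\<close> k j(1) boxA(1) box1(2)
        by (intro ks.subspace_diff[OF Wsub] ks.subspace_neg[OF Wsub] ks.subspace_sum[OF Wsub] W1 W2)
          (auto simp: C_def)
      have eq: "lam j * par (k, u) - ?r = lam j * B k"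
        unfolding Bv uv by (simp add: distrib_left sum_distrib_left mult.assoc)
      have "lam j * B k \<in> P"
        using BP[OF k] P by (simp add: idealp_def)
      then show ?thesis
        by (intro bexI[OF _ r]) (simp only: eq)
    next
      assume uv: "u = v" and kj: "k = j"
      let ?r = "- (lam j * A j) - (\<Sum>u\<in>UNIV - {v}. rem (var u) u)"
      have r: "?r \<in> W"
        using j(1) boxA(1) remW
        by (intro ks.subspace_diff[OF Wsub] ks.subspace_neg[OF Wsub] ks.subspace_sum[OF Wsub] W1) auto
      have eq: "lam j * par (k, u) - ?r
          = lam j * B j + (\<Sum>u\<in>UNIV - {v}. (- var u) * (lam j * par (j, u) - rem 1 u))"
        unfolding Bv uv kj var_rem[symmetric]
        by (simp add: distrib_left sum_distrib_left right_diff_distrib sum_subtractf sum_negf mult.left_commute)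
      have "(\<Sum>u\<in>UNIV - {v}. (- var u) * (lam j * par (j, u) - rem 1 u)) \<in> P"
        using rem by (intro idealp_sum[OF P] idealp_mult[OF P]) auto
      then have "lam j * B j + (\<Sum>u\<in>UNIV - {v}. (- var u) * (lam j * par (j, u) - rem 1 u)) \<in> P"
        by (intro idealp_add[OF P] idealp_mult[OF P] BP[OF j(1)])
      then show ?thesis
        by (intro bexI[OF _ r]) (simp only: eq)
    qed
  qed
  have "\<exists>r\<in>W. lam j * var v ^ ((D + 1) ^ i) - r \<in> P" if "i < Suc N" for i
  proof (cases i)
    \<comment> \<open>The additional power is x_v itself, with exponent (D + 1)^0; this is why
      \<open>idx\<close> starts at 1.\<close>
    case 0
    have "lam j * var v \<in> W" by (rule W1[OF j(1) box1(2)])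
    moreover have "lam j * var v - lam j * var v \<in> P" using P by (simp add: idealp_def)
    ultimately show ?thesis using 0 by (metis power_0 power_one_right)
  next
    case (Suc i')
    then have "i \<in> idx ` ({..<m} \<times> UNIV)"
      using that bij_betw_imp_surj_on[OF idx] by simp
    then obtain k u where "k < m" "i = idx (k, u)" by auto
    then show ?thesis using param[of k u] by (simp add: par_def)
  qed
  \<comment> \<open>With s variables, (m - 1)(s - 1) independent parameters and m multipliers lam up
    to a common factor, the number is s + (m - 1)(s - 1) + m - 1 = ms.\<close>
  moreover have "N = card ((UNIV :: 'v set) <+> C) + card {..<m} - 1"
  proof -
    obtain m' where m': "m = Suc m'" using j(1) by (cases m) auto
    obtain s' where s': "card (UNIV :: 'v set) = Suc s'"
      by (cases "card (UNIV :: 'v set)") auto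
    have "card C = m' * s'"
      using j(1) m' s' by (simp add: C_def card_cartesian_product)
    then show ?thesis
      unfolding N m' s' by (simp add: card_Plus finC s')
  qed
  ultimately obtain M w where "lam j ^ M * var v ^ w \<in> P"
    using powers_relation_mod_ideal[where \<Gamma> = "UNIV <+> C" and \<Lambda> = "{..<m}" and q = "Suc q" and N = N
        and y = "case_sum var par" and z = lam and j = j and v = v and D = D, OF _ _ _ _ _ P _ D]
      finC j(1) unfolding W_def by auto
  then show False
    using no_power[of "n * M + w"] by (simp add: lamj power_add power_mult)
qed

text \<open>Apart from the annihilating power of x_v, this records what the iteration needs: B is
  again polynomial, it is close to A, and the change is divisible by x_v^2.\<close>

lemma stage:
  fixes A :: "nat \<Rightarrow> ('v::{finite,linorder}, 'a::field) mps"
  assumes boxed: "\<And>k. boxed q (A k)"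
  obtains B h q' n where "\<And>k. boxed q' (B k)" "\<And>k. B k - A k \<in> mp L"
    "\<And>k. B k = A k + var v * (var v * h k)" "\<And>k. k < m \<Longrightarrow> unitv k (var v ^ n) \<in> tang m B"
proof -
  define N where "N = m * card (UNIV :: 'v set)"
  obtain D where D: "(Suc q * (D * Suc N) + 1) ^ N < (D + 1) ^ Suc N" and DL: "L + 2 \<le> D"
    by (rule exists_counting_bound)
  have "\<exists>f. bij_betw f ({..<m} \<times> (UNIV :: 'v set)) {1..N}"
    by (rule finite_same_card_bij) (auto simp: N_def card_cartesian_product)
  then obtain idx0 where idx0: "bij_betw idx0 ({..<m} \<times> (UNIV :: 'v set)) {1..N}" by blast
  \<comment> \<open>The default 1 makes the exponents large and bounded also for k \<ge> m, since
    closeness and boxedness are claimed for all k.\<close>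
  define idx where "idx p = (if p \<in> {..<m} \<times> UNIV then idx0 p else 1)" for p :: "nat \<times> 'v"
  have idx: "bij_betw idx ({..<m} \<times> (UNIV :: 'v set)) {1..N}"
    using idx0 by (rule bij_betw_cong[THEN iffD1, rotated]) (simp add: idx_def)
  have idx1: "1 \<le> idx p" for p
    using bij_betwE[OF idx0] by (auto simp: idx_def)
  define E where "E p = (D + 1) ^ idx p" for p
  have E: "L + 2 \<le> E p" for p
  proof -
    have "(D + 1) ^ 1 \<le> E p"
      unfolding E_def by (rule power_increasing[OF idx1]) simp
    with DL show ?thesis by simp
  qed
  define B where "B k = A k + (\<Sum>u\<in>UNIV. (if u = v then 1 else var u) * var v ^ E (k, u))" for k
  define h :: "nat \<Rightarrow> ('v, 'a) mps"
    where "h k = (\<Sum>u\<in>UNIV. (if u = v then 1 else var u) * var v ^ (E (k, u) - 2))" for k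
  obtain n where n: "\<And>k. k < m \<Longrightarrow> unitv k (var v ^ n) \<in> tang m B"
    by (rule stage_perturbation[OF boxed idx N_def D B_def[unfolded E_def]]) blast
  have "\<exists>b. \<forall>k u. k < m \<longrightarrow> E (k, u) \<le> b"
  proof -
    have "E (k, u) \<le> Max (E ` ({..<m} \<times> UNIV))" if "k < m" for k u
      using that by (intro Max_ge) auto
    then show ?thesis by blast
  qed
  then obtain b0 where b0: "\<And>k u. k < m \<Longrightarrow> E (k, u) \<le> b0" by blast
  have b: "E (k, u) \<le> b0 + D + 1" for k u
    using b0[of k u] by (cases "k < m") (auto simp: E_def idx_def)
  show thesis
  proof (rule that[OF _ _ _ n])
    have var_pow: "var v ^ E p = var v * (var v * var v ^ (E p - 2))" for p
    proof -
      have "E p = Suc (Suc (E p - 2))" using E[of p] by simp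
      then show ?thesis by (metis power_Suc)
    qed
    show "B k = A k + var v * (var v * h k)" for k
      unfolding B_def h_def sum_distrib_left var_pow by (simp add: mult.left_commute)
    show "B k - A k \<in> mp L" for k
    proof -
      have "var v ^ E (k, u) \<in> mp L" for u
        using mp_mono[OF mp_power[OF var_mp, of v "E (k, u)"], of L] E[of "(k, u)"] by simp
      then show ?thesis
        unfolding B_def by (auto intro!: mp_sum mp_multr)
    qed
    show "boxed (Suc (b0 + D + 1) + q) (B k)" for k
      unfolding B_def
    proof (intro boxed_add boxed_sum)
      show "boxed (Suc (b0 + D + 1) + q) (A k)"
        by (rule boxed_mono[OF boxed]) simp
      fix u
      have "boxed (b0 + D + 1) (var v ^ E (k, u))"
        by (rule boxed_mono[OF boxed_var_power b])
      then show "boxed (Suc (b0 + D + 1) + q) ((if u = v then 1 else var u) * var v ^ E (k, u))"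
        by (auto intro: boxed_mono boxed_mono[OF boxed_var_mult])
    qed
  qed
qed

text \<open>The submodule Y + \<Sum> r_u R^m. With r = \<open>var\<close> it expresses work modulo
  the variables not yet treated; the index set \<open>{()}\<close> serves for a single element
  r.\<close>

definition ext :: "nat \<Rightarrow> ('i \<Rightarrow> ('v::finite, 'a::field) mps) \<Rightarrow> 'i set \<Rightarrow>
    (nat \<Rightarrow> ('v, 'a) mps) set \<Rightarrow> (nat \<Rightarrow> ('v, 'a) mps) set" where
  "ext m r U Y = {w. \<exists>y\<in>Y. \<exists>h. \<forall>k<m. w k = y k + (\<Sum>u\<in>U. r u * h u k)}"

lemma extI: "y \<in> Y \<Longrightarrow> (\<And>k. k < m \<Longrightarrow> w k = y k + (\<Sum>u\<in>U. r u * h u k)) \<Longrightarrow> w \<in> ext m r U Y"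
  unfolding ext_def by blast

lemma submod_ext:
  assumes Y: "submod m Y"
  shows "submod m (ext m r U Y)"
proof (rule submodI)
  show "(\<lambda>_. 0) \<in> ext m r U Y"
    by (rule extI[OF submod_0[OF Y], where h = "\<lambda>_ _. 0"]) simp
next
  fix w w' assume "w \<in> ext m r U Y" "w' \<in> ext m r U Y"
  then obtain y h y' h' where y: "y \<in> Y" "y' \<in> Y"
    and "\<forall>k<m. w k = y k + (\<Sum>u\<in>U. r u * h u k)" "\<forall>k<m. w' k = y' k + (\<Sum>u\<in>U. r u * h' u k)"
    unfolding ext_def by blast
  then show "(\<lambda>k. w k + w' k) \<in> ext m r U Y"
    by (intro extI[OF submod_add[OF Y y], where h = "\<lambda>u k. h u k + h' u k"])
      (simp add: distrib_left sum.distrib)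
next
  fix s w assume "w \<in> ext m r U Y"
  then obtain y h where y: "y \<in> Y" and "\<forall>k<m. w k = y k + (\<Sum>u\<in>U. r u * h u k)"
    unfolding ext_def by blast
  then show "(\<lambda>k. s * w k) \<in> ext m r U Y"
    by (intro extI[OF submod_scale[OF Y y, of s], where h = "\<lambda>u k. s * h u k"])
      (simp add: distrib_left sum_distrib_left mult.left_commute)
next
  fix w w' :: "nat \<Rightarrow> ('a, 'b) mps" assume "w \<in> ext m r U Y" "\<And>k. k < m \<Longrightarrow> w' k = w k"
  then show "w' \<in> ext m r U Y" unfolding ext_def by auto
qed

lemma ext_base: "y \<in> Y \<Longrightarrow> y \<in> ext m r U Y"
  by (rule extI[where h = "\<lambda>_ _. 0"]) simp_all

lemma ext_gen:
  assumes Y: "submod m Y" and U: "finite U" "u \<in> U" and w: "\<And>k. k < m \<Longrightarrow> w k = r u * h k"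
  shows "w \<in> ext m r U Y"
proof (rule extI[OF submod_0[OF Y], where h = "\<lambda>u'. if u' = u then h else (\<lambda>_. 0)"])
  fix k assume "k < m"
  have "(\<Sum>u'\<in>U. r u' * (if u' = u then h else (\<lambda>_. 0)) k) = (\<Sum>u'\<in>U. if u' = u then r u * h k else 0)"
    by (intro sum.cong refl) auto
  with U w[OF \<open>k < m\<close>] show "w k = 0 + (\<Sum>u'\<in>U. r u' * (if u' = u then h else (\<lambda>_. 0)) k)"
    by simp
qed

text \<open>Split a monomial of degree l (p + 1) into x^\<gamma> of degree l and the rest. The rest
  lies in Y + r^p R^m by induction, and x^\<gamma> times the cofactor of r^p lies in Y + r R^m by
  hypothesis.\<close>

lemma full_power:
  assumes Y: "submod m Y" and full: "full m l (ext m (\<lambda>_. r) {()} Y)"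
  shows "full m (l * p) (ext m (\<lambda>_. r ^ p) {()} Y)"
proof (induction p)
  case 0
  then show ?case
    unfolding full_def by (auto intro!: ext_gen[OF Y])
next
  case (Suc p)
  show ?case
  proof (rule full_of_monomials[OF submod_ext[OF Y]])
    fix k and \<beta> :: "'a \<Rightarrow> nat" assume k: "k < m" and \<beta>: "mdeg \<beta> = l * Suc p"
    obtain \<gamma> where \<gamma>: "\<gamma> \<le> \<beta>" "mdeg \<gamma> = l"
      using exists_le_mdeg_eq[of l \<beta>] \<beta> by auto
    have "mdeg \<gamma> + mdeg (\<beta> - \<gamma>) = mdeg \<beta>"
      using mdeg_add[of \<gamma> "\<beta> - \<gamma>"] exp_add_diff[OF \<gamma>(1)] by simp
    then have \<delta>: "mdeg (\<beta> - \<gamma>) = l * p" using \<gamma> \<beta> by simp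
    have split: "xmon \<beta> = xmon \<gamma> * xmon (\<beta> - \<gamma>)"
      by (simp add: xmon_add[symmetric] exp_add_diff[OF \<gamma>(1)])
    have "unitv k (xmon (\<beta> - \<gamma>)) \<in> ext m (\<lambda>_. r ^ p) {()} Y"
      by (rule fullD[OF Suc.IH]) (auto simp: unitv_def \<delta> intro: xmon_mp)
    then obtain y h where y: "y \<in> Y"
      and eq: "\<And>i. i < m \<Longrightarrow> unitv k (xmon (\<beta> - \<gamma>)) i = y i + r ^ p * h i"
      unfolding ext_def by auto
    have "(\<lambda>i. xmon \<gamma> * h i) \<in> ext m (\<lambda>_. r) {()} Y"
      by (rule fullD[OF full]) (auto intro!: mp_multl xmon_mp simp: \<gamma>)
    then obtain y' h' where y': "y' \<in> Y" and eq': "\<And>i. i < m \<Longrightarrow> xmon \<gamma> * h i = y' i + r * h' i"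
      unfolding ext_def by auto
    show "unitv k (xmon \<beta>) \<in> ext m (\<lambda>_. r ^ Suc p) {()} Y"
    proof (rule extI[OF submod_add[OF Y submod_scale[OF Y y] submod_scale[OF Y y']], where h = "\<lambda>_. h'"])
      fix i assume i: "i < m"
      have "unitv k (xmon \<beta>) i = xmon \<gamma> * unitv k (xmon (\<beta> - \<gamma>)) i"
        by (simp add: unitv_def split)
      also have "\<dots> = xmon \<gamma> * y i + r ^ p * (xmon \<gamma> * h i)"
        unfolding eq[OF i] by (simp add: distrib_left mult.left_commute)
      also have "\<dots> = xmon \<gamma> * y i + r ^ p * y' i + (\<Sum>u\<in>{()}. r ^ Suc p * h' i)"
        unfolding eq'[OF i] by (simp add: distrib_left mult.left_commute add.assoc)
      finally show "unitv k (xmon \<beta>) i = xmon \<gamma> * y i + r ^ p * y' i + (\<Sum>u\<in>{()}. r ^ Suc p * h' i)" .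
    qed
  qed
qed

text \<open>Both r^2 h and its derivatives are multiples of r, so generators of the tangent image
  change only by multiples of r. A perturbation divisible by r alone would not suffice for the
  derivatives.\<close>

lemma tang_perturb:
  assumes BA: "\<And>k. B k = A k + r * (r * h k)"
  shows "tang m A \<subseteq> ext m (\<lambda>_. r) {()} (tang m B)"
proof (rule tang_least[OF submod_ext[OF submod_tang]])
  fix i k assume i: "i < m"
  show "unitv k (A i) \<in> ext m (\<lambda>_. r) {()} (tang m B)"
    by (rule extI[OF tang_unitv[OF i, of k B], where h = "\<lambda>_. unitv k (- (r * h i))"])
      (auto simp: unitv_def BA)
next
  fix v
  show "(\<lambda>k. pd v (A k)) \<in> ext m (\<lambda>_. r) {()} (tang m B)"
    by (rule extI[OF tang_pd[of v B], where h = "\<lambda>_ k. - (2 * pd v r * h k + r * pd v (h k))"])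
      (simp add: BA pd_add pd_mult algebra_simps)
qed

text \<open>S is the set of variables already treated. At the start all variables generate m, so l =
  1 works for any polynomial approximation. Treating x_v, the old inclusion survives modulo x_v;
  raising it to the power n gives an inclusion modulo x_v^n, and x_v^n R^m lies in the new tangent
  image.\<close>

lemma exists_perturbation_full_mod:
  fixes A :: "nat \<Rightarrow> ('v::{finite,linorder}, 'a::field) mps"
  assumes "finite S"
  shows "\<exists>B q l. (\<forall>k. boxed q (B k)) \<and> (\<forall>k. B k - A k \<in> mp L) \<and> full m l (ext m var (- S) (tang m B))"
  using assms
proof (induction S rule: finite_induct)
  case empty
  define B where "B k = (\<Sum>\<alpha>\<in>{\<alpha>. mdeg \<alpha> < L}. const (coeff (A k) \<alpha>) * xmon \<alpha>)" for k
  have "boxed L (B k)" for k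
    unfolding B_def by (intro boxed_sum boxed_const_xmon) simp
  moreover have "B k - A k \<in> mp L" for k
    using mp_uminus[OF mp_truncate[of "A k" L]] by (simp add: B_def)
  moreover have "full m 1 (ext m var (- {}) (tang m B))"
  proof (rule full_of_monomials[OF submod_ext[OF submod_tang]])
    fix k and \<beta> :: "'v \<Rightarrow> nat" assume "mdeg \<beta> = 1"
    then obtain v \<gamma> where \<beta>: "\<beta> = \<gamma>(v := Suc (\<gamma> v))"
      using mdeg_SucE[of \<beta> 0] by (metis One_nat_def)
    show "unitv k (xmon \<beta>) \<in> ext m var (- {}) (tang m B)"
      unfolding \<beta> var_mult_xmon[symmetric]
      by (rule ext_gen[OF submod_tang, where u = v and h = "unitv k (xmon \<gamma>)"]) (auto simp: unitv_def)
  qed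
  ultimately show ?case by blast
next
  case (insert v S)
  then obtain B q l where q: "\<And>k. boxed q (B k)" and BA: "\<And>k. B k - A k \<in> mp L"
    and full: "full m l (ext m var (- S) (tang m B))" by blast
  obtain B' h q' n where q': "\<And>k. boxed q' (B' k)" and B'B: "\<And>k. B' k - B k \<in> mp L"
    and B': "\<And>k. B' k = B k + var v * (var v * h k)"
    and n: "\<And>k. k < m \<Longrightarrow> unitv k (var v ^ n) \<in> tang m B'"
    by (rule stage[where A = B and L = L and v = v and m = m, OF q]) blast
  define Y where "Y = ext m var (- insert v S) (tang m B')"
  have Y: "submod m Y" unfolding Y_def by (rule submod_ext[OF submod_tang])
  note Y1 = submod_ext[OF Y, of "\<lambda>_. var v" "{()}"]
  \<comment> \<open>The untreated variables other than x_v are absorbed into Y, and passing from B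
    to B' costs multiples of x_v only.\<close>
  have "ext m var (- S) (tang m B) \<subseteq> ext m (\<lambda>_. var v) {()} Y"
  proof
    fix w assume "w \<in> ext m var (- S) (tang m B)"
    then obtain y g where y: "y \<in> tang m B" and w: "\<And>k. k < m \<Longrightarrow> w k = y k + (\<Sum>u\<in>- S. var u * g u k)"
      unfolding ext_def by blast
    have "y \<in> ext m (\<lambda>_. var v) {()} (tang m B')"
      using tang_perturb[of B' B "var v" h, OF B'] y by blast
    then have y': "y \<in> ext m (\<lambda>_. var v) {()} Y"
      unfolding ext_def[of m "\<lambda>_. var v"] Y_def using ext_base by blast
    have "(\<lambda>k. var u * g u k) \<in> ext m (\<lambda>_. var v) {()} Y" if "u \<in> - S" for u
    proof (cases "u = v")
      case True
      then show ?thesis by (intro ext_gen[OF Y]) auto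
    next
      case False
      then have "(\<lambda>k. var u * g u k) \<in> Y"
        unfolding Y_def using that by (intro ext_gen[OF submod_tang]) auto
      then show ?thesis by (rule ext_base)
    qed
    then have "(\<lambda>k. \<Sum>u\<in>- S. var u * g u k) \<in> ext m (\<lambda>_. var v) {()} Y"
      by (rule submod_sum[OF Y1])
    from submod_add[OF Y1 y' this] show "w \<in> ext m (\<lambda>_. var v) {()} Y"
      by (rule submod_cong[OF Y1]) (rule w)
  qed
  with full have "full m l (ext m (\<lambda>_. var v) {()} Y)"
    unfolding full_def by blast
  then have fulln: "full m (l * n) (ext m (\<lambda>_. var v ^ n) {()} Y)"
    by (rule full_power[OF Y])
  have "ext m (\<lambda>_. var v ^ n) {()} Y \<subseteq> Y"
  proof
    fix w assume "w \<in> ext m (\<lambda>_. var v ^ n) {()} Y"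
    then obtain y g where y: "y \<in> Y" and w: "\<And>k. k < m \<Longrightarrow> w k = y k + var v ^ n * g k"
      unfolding ext_def by auto
    have "unitv k (var v ^ n) \<in> Y" if "k < m" for k
      unfolding Y_def by (rule ext_base[OF n[OF that]])
    then have "(\<lambda>k. var v ^ n * g k) \<in> Y"
      by (rule submod_units1[OF Y])
    from submod_add[OF Y y this] show "w \<in> Y"
      by (rule submod_cong[OF Y]) (rule w)
  qed
  with fulln have "full m (l * n) Y"
    unfolding full_def by blast
  moreover have "B' k - A k \<in> mp L" for k
    using mp_add[OF B'B BA, of k k] by simp
  ultimately show ?case
    using q' unfolding Y_def by blast
qed

lemma exists_perturbation_full:
  fixes A :: "nat \<Rightarrow> ('v::{finite,linorder}, 'a::field) mps"
  obtains B l where "\<And>k. B k - A k \<in> mp L" "full m l (tang m B)"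
proof -
  obtain B l where BA: "\<And>k. B k - A k \<in> mp L" and full: "full m l (ext m var (- UNIV) (tang m B))"
    using exists_perturbation_full_mod[of "UNIV :: 'v set" A L m] by auto
  have "ext m var (- UNIV) (tang m B) \<subseteq> tang m B"
  proof
    fix w assume "w \<in> ext m var (- UNIV) (tang m B)"
    then obtain y where y: "y \<in> tang m B" "\<And>k. k < m \<Longrightarrow> w k = y k"
      unfolding ext_def by auto
    show "w \<in> tang m B"
      by (rule submod_cong[OF submod_tang y])
  qed
  with full have "full m l (tang m B)"
    unfolding full_def by blast
  with BA that show thesis by blast
qed

lemma finite_codim_of_G_finitely_determined:
  fixes A :: "nat \<Rightarrow> ('v::{finite,linorder} \<Rightarrow> nat) \<Rightarrow> 'a::field"
  assumes "G_finitely_determined m A"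
  shows "finite_codim m (tangent_ext m A)"
proof -
  obtain k where k: "G_determined m A k"
    using assms unfolding G_finitely_determined_def by blast
  obtain B l where BA: "\<And>i. B i - Mps (A i) \<in> mp (Suc k)" and full: "full m l (tang m B)"
    using exists_perturbation_full[of "\<lambda>i. Mps (A i)" "Suc k" m] by blast
  have "\<forall>i<m. in_mpow (Suc k) (\<lambda>\<alpha>. coeff (B i) \<alpha> - A i \<alpha>)"
    using BA by (simp add: mp_def minus_mps_def)
  then have "G_equiv m A (\<lambda>i. coeff (B i))"
    by (rule k[unfolded G_determined_def, THEN spec, THEN mp])
  then have "full m l (tang m (\<lambda>i. Mps (A i)))"
    by (rule G_equiv_full) (simp add: full)
  then show ?thesis
    by (rule finite_codim_of_full)
qed

theorem mainTheorem7:
  fixes A :: "nat \<Rightarrow> ('v::{finite,linorder} \<Rightarrow> nat) \<Rightarrow> 'a::field"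
    and m :: nat
  assumes "1 \<le> m"
    and "\<forall>i<m. in_max_ideal (A i)"
  shows "((1 < m \<and> m < card (UNIV :: 'v set) \<longrightarrow> infinite (UNIV :: 'a set)) \<longrightarrow>
           (G_finitely_determined m A \<longleftrightarrow> finite_codim m (tangent_ext m A)))
       \<and> (finite_codim m (tangent_ext m A) \<longrightarrow> G_finitely_determined m A)
       \<and> (finite_codim m (tangent_ext m A) \<longrightarrow>
            G_determined m A (nat (2 * int (codim m (tangent_ext m A)) - int (vec_ord m A) + 2)))"
proof -
  have "G_determined m A (nat (2 * int (codim m (tangent_ext m A)) - int (vec_ord m A) + 2))"
    if "finite_codim m (tangent_ext m A)"
    using G_determined_of_finite_codim[OF assms(1) that] .
  then show ?thesis
    using finite_codim_of_G_finitely_determined unfolding G_finitely_determined_def by blast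
qed

end
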